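(* Let $\mathbb F$ be an algebraically closed field of characteristic $p>2$ and let $G=GL(m,n)$ be the general linear $\mathbb F$-supergroup. If $\lambda\in X^+(T)$ is $p$-typical, then there is an isomorphism of $\mathrm{Dist}(G)$-modules $$\mathrm{Ind}^G_P\lambda\cong L(\lambda).$$
   Context: Let $m,n\ge1$; $\mathcal I_0=\{(i,j):1\le i<j\le m\text{ or }m<i<j\le m+n\}$, $\mathcal I_1=\{(i,j):1\le i\le m<j\le m+n\}$. $G=GL(m,n)$ is the functor sending a commutative superalgebra $A$ to the group of invertible matrices $\begin{pmatrix} W & X \\ Y & Z \end{pmatrix}$ with $W$ ($m\times m$), $Z$ ($n\times n$) having entries in $A_{\bar0}$ and $X,Y$ having entries in $A_{\bar1}$; $P$ (resp. $G_{ev}$) is the subgroup given by $Y=0$ (resp. $X=0$, $Y=0$), so $G_{ev}=GL_m\times GL_n$; $T$ is the diagonal torus. Distribution superalgebras: with $U(\mathfrak g)_{\mathbb Z}$ the $\mathbb Z$-sub-superalgebra of $U(\mathfrak{gl}(m,n))_{\mathbb Q}$ generated by $e_{ij}^r/r!,\ e_{ji}^r/r!$ for $(i,j)\in\mathcal I_0$, $e_{ij},e_{ji}$ for $(i,j)\in\mathcal I_1$, and $\binom{e_{ss}}{r}$ ($1\le s\le m+n$, $r\ge0$), one has $\mathrm{Dist}(G)=U(\mathfrak g)_{\mathbb Z}\otimes_{\mathbb Z}\mathbb F$; $\mathrm{Dist}(G_{ev})$ is the subalgebra generated by the images of $e_{ij}^r/r!,e_{ji}^r/r!$ ($(i,j)\in\mathcal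 I_0$) and $\binom{e_{ss}}{r}$; $\mathrm{Dist}(P)$ is generated by $\mathrm{Dist}(G_{ev})$ and $e_{ij}$, $(i,j)\in\mathcal I_1$. $G$-modules are identified with integrable (i.e. locally finite and sums of weight spaces) $\mathrm{Dist}(G)$-modules, where for $\lambda=\sum\lambda_i\epsilon_i\in\Lambda=\bigoplus_{i=1}^{m+n}\mathbb Z\epsilon_i$ the $\lambda$-weight space is $\{v:\binom{e_{ii}}{r}v=\binom{\lambda_i}{r}v\ \forall i,\ r\ge0\}$; similarly for $G_{ev}$. $X^+(T)=\{\sum\lambda_i\epsilon_i\in\Lambda:\lambda_1\ge\dots\ge\lambda_m,\ \lambda_{m+1}\ge\dots\ge\lambda_{m+n}\}$. For $\lambda\in X^+(T)$, $L(\lambda)$ (resp. $L_0(\lambda)$) is the simple $G$-module (resp. $G_{ev}$-module) of highest weight $\lambda$ with respect to the upper triangular Borel subgroup. $L_0(\lambda)$ is viewed as a $\mathrm{Dist}(P)$-module with $e_{ij}$, $(i,j)\in\mathcal I_1$, acting as $0$, and $\mathrm{Ind}^G_P\lambda=\mathrm{Dist}(G)\otimes_{\mathrm{Dist}(P)}L_0(\lambda)$. Bilinear form on $\Lambda$: $(\epsilon_i,\epsilon_j)=\delta_{ij}$ if $i\le m$ and $-\delta_{ij}$ if $i>m$ (extended to $\frac12\Lambda$). $\rho=\frac12\sum_{(i,j)\in\mathcal I_0}(\epsilon_i-\epsilon_j)-\frac12\sum_{(i,j)\in\mathcal I_1}(\epsilon_i-\epsilon_j)$. $\lambda\in\Lambda$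 is $p$-typical if the integer $\prod_{(i,j)\in\mathcal I_1}(\lambda+\rho,\epsilon_i-\epsilon_j)$ is not divisible by $p$. *)

theory Defs
  imports
    "HOL-Algebra.Algebra"
    "HOL-Algebra.Algebraic_Closure_Type"
begin

section \<open>Rings and modules\<close>

text \<open>The locale \<^locale>\<open>module\<close> requires a commutative ring; its module axioms alone do not.
  Over an algebra over a field the vector space structure of a left module, and the linearity of
  submodules and homomorphisms, come from the action of the scalars of the algebra. The fields
  \<^const>\<open>monoid.mult\<close> and \<^const>\<open>monoid.one\<close> of a module record play no role.\<close>

definition left_module :: "'a ring \<Rightarrow> ('a, 'v) module \<Rightarrow> bool" where
  "left_module A M \<longleftrightarrow> ring A \<and> abelian_group M \<and> module_axioms A M"

definition simple_module :: "'a ring \<Rightarrow> ('a, 'v) module \<Rightarrow> bool" where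
  "simple_module A M \<longleftrightarrow> left_module A M \<and> carrier M \<noteq> {\<zero>\<^bsub>M\<^esub>} \<and>
     (\<forall>N. submodule N A M \<longrightarrow> N = {\<zero>\<^bsub>M\<^esub>} \<or> N = carrier M)"

definition modules_isomorphic :: "'a ring \<Rightarrow> ('a, 'v) module \<Rightarrow> ('a, 'w) module \<Rightarrow> bool" where
  "modules_isomorphic A M N \<longleftrightarrow> (\<exists>f. bij_betw f (carrier M) (carrier N) \<and>
     (\<forall>v\<in>carrier M. \<forall>w\<in>carrier M. f (v \<oplus>\<^bsub>M\<^esub> w) = f v \<oplus>\<^bsub>N\<^esub> f w) \<and>
     (\<forall>a\<in>carrier A. \<forall>v\<in>carrier M. f (a \<odot>\<^bsub>M\<^esub> v) = a \<odot>\<^bsub>N\<^esub> f v))"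

definition monoid_algebra :: "('a, 'b) monoid_scheme \<Rightarrow> ('a \<Rightarrow>\<^sub>0 'k::comm_ring_1) ring" where
  "monoid_algebra M =
     \<lparr>carrier = {f. Poly_Mapping.keys f \<subseteq> carrier M},
      monoid.mult = (\<lambda>f g. \<Sum>x\<in>Poly_Mapping.keys f. \<Sum>y\<in>Poly_Mapping.keys g.
        Poly_Mapping.single (x \<otimes>\<^bsub>M\<^esub> y) (Poly_Mapping.lookup f x * Poly_Mapping.lookup g y)),
      one = Poly_Mapping.single \<one>\<^bsub>M\<^esub> 1,
      ring.zero = 0,
      add = (+)\<rparr>"

definition word_monoid :: "'a set \<Rightarrow> 'a list monoid" where
  "word_monoid S = \<lparr>carrier = lists S, monoid.mult = (@), one = []\<rparr>"

text \<open>The tensor product over the integers of two rings: the free abelian group on all pairs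
  modulo biadditivity, with multiplication given by \<open>(r, s) (r', s') = (r r', s s')\<close>.
  The additive span of the relators is already a two-sided ideal.\<close>

definition tensor_relators ::
  "('a, 'c) ring_scheme \<Rightarrow> ('b, 'd) ring_scheme \<Rightarrow> ('a \<times> 'b \<Rightarrow>\<^sub>0 int) set" where
  "tensor_relators R S =
     {frag_of (x \<oplus>\<^bsub>R\<^esub> y, a) - frag_of (x, a) - frag_of (y, a) | x y a.
        x \<in> carrier R \<and> y \<in> carrier R \<and> a \<in> carrier S} \<union>
     {frag_of (x, a \<oplus>\<^bsub>S\<^esub> b) - frag_of (x, a) - frag_of (x, b) | x a b.
        x \<in> carrier R \<and> a \<in> carrier S \<and> b \<in> carrier S}"

definition tensor_ideal ::
  "('a, 'c) ring_scheme \<Rightarrow> ('b, 'd) ring_scheme \<Rightarrow> ('a \<times> 'b \<Rightarrow>\<^sub>0 int) set" where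
  "tensor_ideal R S = Idl\<^bsub>monoid_algebra (R \<times>\<times> S)\<^esub> (tensor_relators R S)"

definition ring_tensor ::
  "('a, 'c) ring_scheme \<Rightarrow> ('b, 'd) ring_scheme \<Rightarrow> ('a \<times> 'b \<Rightarrow>\<^sub>0 int) set ring" where
  "ring_tensor R S = monoid_algebra (R \<times>\<times> S) Quot tensor_ideal R S"

definition pure_tensor ::
  "('a, 'c) ring_scheme \<Rightarrow> ('b, 'd) ring_scheme \<Rightarrow> 'a \<Rightarrow> 'b \<Rightarrow> ('a \<times> 'b \<Rightarrow>\<^sub>0 int) set" where
  "pure_tensor R S x a = tensor_ideal R S +>\<^bsub>monoid_algebra (R \<times>\<times> S)\<^esub> frag_of (x, a)"

text \<open>For a subring \<open>B\<close> of \<open>A\<close> and a left \<open>B\<close>-module \<open>M\<close>, the left \<open>A\<close>-module \<open>A \<otimes>\<^sub>B M\<close>: the free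
  abelian group on pairs modulo biadditivity and \<open>(x b, v) = (x, b v)\<close>.\<close>

definition balanced_relators ::
  "'a ring \<Rightarrow> 'a set \<Rightarrow> ('a, 'v) module \<Rightarrow> ('a \<times> 'v \<Rightarrow>\<^sub>0 int) set" where
  "balanced_relators A B M = tensor_relators A M \<union>
     {frag_of (x \<otimes>\<^bsub>A\<^esub> b, v) - frag_of (x, b \<odot>\<^bsub>M\<^esub> v) | x b v.
        x \<in> carrier A \<and> b \<in> B \<and> v \<in> carrier M}"

definition extension_of_scalars ::
  "'a ring \<Rightarrow> 'a set \<Rightarrow> ('a, 'v) module \<Rightarrow> ('a, ('a \<times> 'v \<Rightarrow>\<^sub>0 int) set) module" where
  "extension_of_scalars A B M =
     (let F = free_Abelian_group (carrier A \<times> carrier M);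
          K = generate F (balanced_relators A B M)
      in \<lparr>carrier = carrier (F Mod K),
          monoid.mult = undefined, one = undefined,
          ring.zero = \<one>\<^bsub>F Mod K\<^esub>,
          add = (\<otimes>\<^bsub>F Mod K\<^esub>),
          module.smult = (\<lambda>a C. (\<Union>c\<in>C.
            K #>\<^bsub>F\<^esub> frag_extend (\<lambda>(x, v). frag_of (a \<otimes>\<^bsub>A\<^esub> x, v)) c))\<rparr>)"

section \<open>The enveloping superalgebra of \<open>gl(m,n)\<close> and its integral form\<close>

definition I0 :: "nat \<Rightarrow> nat \<Rightarrow> (nat \<times> nat) set" where
  "I0 m n = {(i, j). (1 \<le> i \<and> i < j \<and> j \<le> m) \<or> (m < i \<and> i < j \<and> j \<le> m + n)}"

definition I1 :: "nat \<Rightarrow> nat \<Rightarrow> (nat \<times> nat) set" where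
  "I1 m n = {(i, j). 1 \<le> i \<and> i \<le> m \<and> m < j \<and> j \<le> m + n}"

text \<open>\<open>(-1)\<close> to the product of the parities of \<open>e\<^sub>i\<^sub>j\<close> and \<open>e\<^sub>k\<^sub>l\<close>.\<close>

definition supersign :: "nat \<Rightarrow> nat \<times> nat \<Rightarrow> nat \<times> nat \<Rightarrow> rat" where
  "supersign m = (\<lambda>(i, j) (k, l). if (i \<le> m) \<noteq> (j \<le> m) \<and> (k \<le> m) \<noteq> (l \<le> m) then -1 else 1)"

definition gl_free :: "nat \<Rightarrow> nat \<Rightarrow> ((nat \<times> nat) list \<Rightarrow>\<^sub>0 rat) ring" where
  "gl_free m n = monoid_algebra (word_monoid ({1..m + n} \<times> {1..m + n}))"

text \<open>Supercommutators of matrix units: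
  \<open>[e\<^sub>i\<^sub>j, e\<^sub>k\<^sub>l] = \<delta>\<^sub>j\<^sub>k e\<^sub>i\<^sub>l - (-1)\<^bsup>|e\<^sub>i\<^sub>j| |e\<^sub>k\<^sub>l|\<^esup> \<delta>\<^sub>i\<^sub>l e\<^sub>k\<^sub>j\<close>.\<close>

definition gl_relator ::
  "nat \<Rightarrow> nat \<Rightarrow> nat \<Rightarrow> nat \<Rightarrow> nat \<Rightarrow> (nat \<times> nat) list \<Rightarrow>\<^sub>0 rat" where
  "gl_relator m i j k l =
     (Poly_Mapping.single [(i, j), (k, l)] 1
       - Poly_Mapping.single [(k, l), (i, j)] (supersign m (i, j) (k, l)))
     - ((if j = k then Poly_Mapping.single [(i, l)] 1 else 0)
       - (if i = l then Poly_Mapping.single [(k, j)] (supersign m (i, j) (k, l)) else 0))"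

definition gl_ideal :: "nat \<Rightarrow> nat \<Rightarrow> ((nat \<times> nat) list \<Rightarrow>\<^sub>0 rat) set" where
  "gl_ideal m n = Idl\<^bsub>gl_free m n\<^esub>
     {gl_relator m i j k l | i j k l. {i, j, k, l} \<subseteq> {1..m + n}}"

definition UQ :: "nat \<Rightarrow> nat \<Rightarrow> ((nat \<times> nat) list \<Rightarrow>\<^sub>0 rat) set ring" where
  "UQ m n = gl_free m n Quot gl_ideal m n"

definition UQ_monomial ::
  "nat \<Rightarrow> nat \<Rightarrow> (nat \<times> nat) list \<Rightarrow> rat \<Rightarrow> ((nat \<times> nat) list \<Rightarrow>\<^sub>0 rat) set" where
  "UQ_monomial m n w c = gl_ideal m n +>\<^bsub>gl_free m n\<^esub> Poly_Mapping.single w c"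

text \<open>\<open>e\<^sub>i\<^sub>j\<^sup>r / r!\<close>\<close>

definition e_divpow ::
  "nat \<Rightarrow> nat \<Rightarrow> nat \<Rightarrow> nat \<Rightarrow> nat \<Rightarrow> ((nat \<times> nat) list \<Rightarrow>\<^sub>0 rat) set" where
  "e_divpow m n i j r = UQ_monomial m n (replicate r (i, j)) (1 / fact r)"

primrec falling_power :: "('a, 'b) ring_scheme \<Rightarrow> 'a \<Rightarrow> nat \<Rightarrow> 'a" where
  "falling_power R x 0 = \<one>\<^bsub>R\<^esub>"
| "falling_power R x (Suc k) = falling_power R x k \<otimes>\<^bsub>R\<^esub> (x \<ominus>\<^bsub>R\<^esub> [k] \<cdot>\<^bsub>R\<^esub> \<one>\<^bsub>R\<^esub>)"

definition h_binom :: "nat \<Rightarrow> nat \<Rightarrow> nat \<Rightarrow> nat \<Rightarrow> ((nat \<times> nat) list \<Rightarrow>\<^sub>0 rat) set" where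
  "h_binom m n s r =
     UQ_monomial m n [] (1 / fact r) \<otimes>\<^bsub>UQ m n\<^esub> falling_power (UQ m n) (e_divpow m n s s 1) r"

definition even_generators :: "nat \<Rightarrow> nat \<Rightarrow> ((nat \<times> nat) list \<Rightarrow>\<^sub>0 rat) set set" where
  "even_generators m n =
     {e_divpow m n i j r | i j r. (i, j) \<in> I0 m n} \<union>
     {e_divpow m n j i r | i j r. (i, j) \<in> I0 m n} \<union>
     {h_binom m n s r | s r. s \<in> {1..m + n}}"

definition UZ :: "nat \<Rightarrow> nat \<Rightarrow> ((nat \<times> nat) list \<Rightarrow>\<^sub>0 rat) set ring" where
  "UZ m n = (UQ m n)\<lparr>carrier := generate_ring (UQ m n)
     (even_generators m n \<union>
      {e_divpow m n i j 1 | i j. (i, j) \<in> I1 m n} \<union>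
      {e_divpow m n j i 1 | i j. (i, j) \<in> I1 m n})\<rparr>"

section \<open>Distribution algebras\<close>

type_synonym 'f dist = "(((nat \<times> nat) list \<Rightarrow>\<^sub>0 rat) set \<times> 'f \<Rightarrow>\<^sub>0 int) set"

definition Dist_G :: "nat \<Rightarrow> nat \<Rightarrow> ('f::field) dist ring" where
  "Dist_G m n = ring_tensor (UZ m n) (ring_of_type_algebra :: 'f ring)"

text \<open>The image \<open>u \<otimes> 1\<close> of an element of the integral form, and the scalar \<open>1 \<otimes> c\<close>.\<close>

definition dist_of :: "nat \<Rightarrow> nat \<Rightarrow> ((nat \<times> nat) list \<Rightarrow>\<^sub>0 rat) set \<Rightarrow> ('f::field) dist" where
  "dist_of m n u = pure_tensor (UZ m n) (ring_of_type_algebra :: 'f ring) u 1"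

definition dist_scalar :: "nat \<Rightarrow> nat \<Rightarrow> 'f \<Rightarrow> ('f::field) dist" where
  "dist_scalar m n c = pure_tensor (UZ m n) (ring_of_type_algebra :: 'f ring) \<one>\<^bsub>UZ m n\<^esub> c"

text \<open>An \<open>'f\<close>-subalgebra is a subring containing the scalars.\<close>

definition Dist_Gev :: "nat \<Rightarrow> nat \<Rightarrow> ('f::field) dist ring" where
  "Dist_Gev m n = (Dist_G m n)\<lparr>carrier := generate_ring (Dist_G m n)
     (range (dist_scalar m n) \<union> dist_of m n ` even_generators m n)\<rparr>"

definition Dist_P :: "nat \<Rightarrow> nat \<Rightarrow> ('f::field) dist ring" where
  "Dist_P m n = (Dist_G m n)\<lparr>carrier := generate_ring (Dist_G m n)
     (carrier (Dist_Gev m n) \<union> {dist_of m n (e_divpow m n i j 1) | i j. (i, j) \<in> I1 m n})\<rparr>"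

section \<open>Weights\<close>

text \<open>\<open>\<Sum> \<lambda>\<^sub>i \<epsilon>\<^sub>i\<close> is the function \<open>i \<mapsto> \<lambda>\<^sub>i\<close>, zero outside \<open>{1..m + n}\<close>.\<close>

definition weights :: "nat \<Rightarrow> nat \<Rightarrow> (nat \<Rightarrow> int) set" where
  "weights m n = {lam. \<forall>i. i \<notin> {1..m + n} \<longrightarrow> lam i = 0}"

definition dominant_weights :: "nat \<Rightarrow> nat \<Rightarrow> (nat \<Rightarrow> int) set" where
  "dominant_weights m n = {lam \<in> weights m n. \<forall>(i, j)\<in>I0 m n. lam i \<ge> lam j}"

definition eps :: "nat \<Rightarrow> nat \<Rightarrow> rat" where
  "eps i = (\<lambda>k. if k = i then 1 else 0)"

definition weight_form :: "nat \<Rightarrow> nat \<Rightarrow> (nat \<Rightarrow> rat) \<Rightarrow> (nat \<Rightarrow> rat) \<Rightarrow> rat" where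
  "weight_form m n x y = (\<Sum>i\<in>{1..m}. x i * y i) - (\<Sum>i\<in>{m + 1..m + n}. x i * y i)"

definition rho :: "nat \<Rightarrow> nat \<Rightarrow> nat \<Rightarrow> rat" where
  "rho m n = (\<lambda>k. 1 / 2 * (\<Sum>(i, j)\<in>I0 m n. eps i k - eps j k)
                - 1 / 2 * (\<Sum>(i, j)\<in>I1 m n. eps i k - eps j k))"

text \<open>The product is computed in the rationals, as \<^const>\<open>rho\<close> may be half-integral, but is an
  integer.\<close>

definition p_typical :: "nat \<Rightarrow> nat \<Rightarrow> nat \<Rightarrow> (nat \<Rightarrow> int) \<Rightarrow> bool" where
  "p_typical p m n lam \<longleftrightarrow>
     \<not> (\<exists>k::int. (\<Prod>(i, j)\<in>I1 m n.
          weight_form m n (\<lambda>t. of_int (lam t) + rho m n t) (\<lambda>t. eps i t - eps j t))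
        = of_int (int p * k))"

section \<open>Integrable modules and highest weights\<close>

text \<open>Modules carry no parity grading. On an integrable module the sum of the weight spaces whose
  weight has \<open>\<Sum>\<^bsub>j > m\<^esub> \<lambda>\<^sub>j\<close> even (respectively odd) is a compatible grading, for which every
  submodule is graded and every homomorphism is even.\<close>

text \<open>\<^const>\<open>gbinomial\<close> on the integers; its division is exact. Its type is constrained to fields after
  its definition, so it cannot be used here directly.\<close>

definition int_binomial :: "int \<Rightarrow> nat \<Rightarrow> int" where
  "int_binomial a r = (\<Prod>k<r. a - int k) div fact r"

definition weight_space ::
  "nat \<Rightarrow> nat \<Rightarrow> (('f::field) dist, 'v) module \<Rightarrow> (nat \<Rightarrow> int) \<Rightarrow> 'v set" where
  "weight_space m n M lam =
     {v \<in> carrier M. \<forall>i\<in>{1..m + n}. \<forall>r.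
        dist_of m n (h_binom m n i r) \<odot>\<^bsub>M\<^esub> v
        = dist_scalar m n (of_int (int_binomial (lam i) r)) \<odot>\<^bsub>M\<^esub> v}"

definition finite_dimensional ::
  "nat \<Rightarrow> nat \<Rightarrow> (('f::field) dist, 'v) module \<Rightarrow> 'v set \<Rightarrow> bool" where
  "finite_dimensional m n M N \<longleftrightarrow>
     (\<exists>S. finite S \<and> S \<subseteq> N \<and> (\<forall>v\<in>N. \<exists>c. v = (\<Oplus>\<^bsub>M\<^esub>s\<in>S. dist_scalar m n (c s) \<odot>\<^bsub>M\<^esub> s)))"

definition integrable ::
  "nat \<Rightarrow> nat \<Rightarrow> ('f::field) dist ring \<Rightarrow> ('f dist, 'v) module \<Rightarrow> bool" where
  "integrable m n A M \<longleftrightarrow>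
     left_module A M \<and>
     (\<forall>v\<in>carrier M. \<exists>N. submodule N A M \<and> v \<in> N \<and> finite_dimensional m n M N) \<and>
     carrier M = generate (add_monoid M) (\<Union>mu\<in>weights m n. weight_space m n M mu)"

text \<open>Simple modules of highest weight \<open>lam\<close>: there is a nonzero vector of weight \<open>lam\<close>
  annihilated by the distributions of the unipotent radical of the upper triangular Borel subgroup.\<close>

definition simple_G_module ::
  "nat \<Rightarrow> nat \<Rightarrow> (nat \<Rightarrow> int) \<Rightarrow> (('f::field) dist, 'v) module \<Rightarrow> bool" where
  "simple_G_module m n lam L \<longleftrightarrow>
     integrable m n (Dist_G m n) L \<and> simple_module (Dist_G m n) L \<and>
     (\<exists>v\<in>weight_space m n L lam. v \<noteq> \<zero>\<^bsub>L\<^esub> \<and>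
        (\<forall>(i, j)\<in>I0 m n. \<forall>r\<ge>1. dist_of m n (e_divpow m n i j r) \<odot>\<^bsub>L\<^esub> v = \<zero>\<^bsub>L\<^esub>) \<and>
        (\<forall>(i, j)\<in>I1 m n. dist_of m n (e_divpow m n i j 1) \<odot>\<^bsub>L\<^esub> v = \<zero>\<^bsub>L\<^esub>))"

definition simple_Gev_module ::
  "nat \<Rightarrow> nat \<Rightarrow> (nat \<Rightarrow> int) \<Rightarrow> (('f::field) dist, 'v) module \<Rightarrow> bool" where
  "simple_Gev_module m n lam L \<longleftrightarrow>
     integrable m n (Dist_Gev m n) L \<and> simple_module (Dist_Gev m n) L \<and>
     (\<exists>v\<in>weight_space m n L lam. v \<noteq> \<zero>\<^bsub>L\<^esub> \<and>
        (\<forall>(i, j)\<in>I0 m n. \<forall>r\<ge>1. dist_of m n (e_divpow m n i j r) \<odot>\<^bsub>L\<^esub> v = \<zero>\<^bsub>L\<^esub>))"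

text \<open>\<open>L\<^sub>0(lam)\<close> viewed as a module over \<^const>\<open>Dist_P\<close>; the module over \<^const>\<open>Dist_Gev\<close> is its
  restriction, given by the same record.\<close>

definition inflated_simple_Gev_module ::
  "nat \<Rightarrow> nat \<Rightarrow> (nat \<Rightarrow> int) \<Rightarrow> (('f::field) dist, 'v) module \<Rightarrow> bool" where
  "inflated_simple_Gev_module m n lam L \<longleftrightarrow>
     left_module (Dist_P m n) L \<and> simple_Gev_module m n lam L \<and>
     (\<forall>(i, j)\<in>I1 m n. \<forall>v\<in>carrier L. dist_of m n (e_divpow m n i j 1) \<odot>\<^bsub>L\<^esub> v = \<zero>\<^bsub>L\<^esub>)"

definition Ind_GP ::
  "nat \<Rightarrow> nat \<Rightarrow> (('f::field) dist, 'v) module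
    \<Rightarrow> ('f dist, ('f dist \<times> 'v \<Rightarrow>\<^sub>0 int) set) module" where
  "Ind_GP m n L0 = extension_of_scalars (Dist_G m n) (carrier (Dist_P m n)) L0"

end

(* Only relations in the integral form are needed, never a basis of it. Let v0 and v be highest
   weight vectors of L0 and L. By Kostant's straightening formulas, the divided powers of the simple
   even lowering operators, applied to (v0, v) in L0 x L, span an even submodule. It is the graph of
   a map L0 -> L: its fibre over 0 generates a submodule of L all of whose weights are strictly below
   lam, which must vanish. The induced map Ind -> L is onto because L is simple. For injectivity, let
   f_top be the product of all odd lowering root vectors. As these anticommute and square to zero, a
   nonzero submodule of Ind contains f_top (x) w for some nonzero w in L0. Since f_top commutes with
   the even root vectors, the submodule contains f_top (x) v0. Applying the odd raising root vectors
   along a chain of odd reflections turns f_top (x) v0 into 1 (x) v0 times the product of the numbers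
   (lam + rho, eps_i - eps_j), which is nonzero, so the submodule is not in the kernel. *)

theory Submission
  imports Defs "HOL-Library.Product_Plus"
begin

section \<open>Divided powers and binomials in rational algebras\<close>

class rat_algebra = ring_1 +
  fixes of_q :: "rat \<Rightarrow> 'a"
  assumes of_q_add: "of_q (x + y) = of_q x + of_q y"
    and of_q_mult: "of_q (x * y) = of_q x * of_q y"
    and of_q_1: "of_q 1 = 1"
    and of_q_commute: "of_q x * a = a * of_q x"

lemma of_q_0: "of_q 0 = (0 :: 'a::rat_algebra)"
  using of_q_add[of 0 0, where 'a = 'a] by simp

lemma of_q_of_nat: "of_q (of_nat k) = (of_nat k :: 'a::rat_algebra)"
  by (induction k) (simp_all add: of_q_0 of_q_1 of_q_add)

lemma of_nat_Suc_cancel: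
  fixes x y :: "'a::rat_algebra"
  assumes "of_nat (Suc k) * x = of_nat (Suc k) * y"
  shows "x = y"
proof -
  have "of_q (1 / of_nat (Suc k)) * of_nat (Suc k) = (1 :: 'a)"
    unfolding of_q_of_nat[symmetric] of_q_mult[symmetric] by (simp add: of_q_1 del: of_nat_Suc)
  then show ?thesis
    using arg_cong[OF assms, of "\<lambda>z. of_q (1 / of_nat (Suc k)) * z"]
    by (simp only: mult.assoc[symmetric] mult_1_left)
qed

definition divpow :: "'a::rat_algebra \<Rightarrow> nat \<Rightarrow> 'a" where
  "divpow x r = of_q (1 / fact r) * x ^ r"

primrec falling :: "'a::ring_1 \<Rightarrow> nat \<Rightarrow> 'a" where
  "falling h 0 = 1"
| "falling h (Suc r) = falling h r * (h - of_nat r)"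

definition binom :: "'a::rat_algebra \<Rightarrow> nat \<Rightarrow> 'a" where
  "binom h r = of_q (1 / fact r) * falling h r"

lemma of_nat_commute: "of_nat k * x = x * (of_nat k :: 'a::ring_1)"
  by (rule mult_of_nat_commute)

lemma Suc_of_q_fact: "of_nat (Suc r) * of_q (1 / fact (Suc r)) = (of_q (1 / fact r) :: 'a::rat_algebra)"
proof -
  have "of_nat (Suc r) * (1 / fact (Suc r)) = (1 / fact r :: rat)"
    by simp
  then show ?thesis
    by (metis of_q_of_nat of_q_mult)
qed

lemma divpow_0 [simp]: "divpow x 0 = 1"
  by (simp add: divpow_def of_q_1)

lemma divpow_1 [simp]: "divpow x (Suc 0) = x"
  by (simp add: divpow_def of_q_1)

lemma divpow_Suc: "of_nat (Suc r) * divpow x (Suc r) = x * divpow x r"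
proof -
  have "of_nat (Suc r) * divpow x (Suc r) = of_q (1 / fact r) * (x * x ^ r)"
    unfolding divpow_def by (metis Suc_of_q_fact mult.assoc power_Suc)
  then show ?thesis
    unfolding divpow_def by (metis of_q_commute mult.assoc)
qed

lemma commute_divpow: "x * y = y * x \<Longrightarrow> divpow x r * y = y * divpow x r"
  unfolding divpow_def using power_commuting_commutes[of x y r] by (metis of_q_commute mult.assoc)

lemma binom_0 [simp]: "binom x 0 = 1"
  by (simp add: binom_def of_q_1)

lemma binom_1 [simp]: "binom x (Suc 0) = x"
  by (simp add: binom_def of_q_1)

lemma binom_Suc: "of_nat (Suc r) * binom h (Suc r) = binom h r * (h - of_nat r)"
proof -
  have "of_nat (Suc r) * binom h (Suc r) = of_q (1 / fact r) * (falling h r * (h - of_nat r))"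
    unfolding binom_def by (metis Suc_of_q_fact mult.assoc falling.simps(2))
  then show ?thesis
    unfolding binom_def by (metis mult.assoc)
qed

lemma commute_falling:
  assumes "h * x = x * h'"
  shows "falling h r * x = x * falling h' r"
proof (induction r)
  case (Suc r)
  have "(h - of_nat r) * x = x * (h' - of_nat r)"
    using assms by (simp add: algebra_simps of_nat_commute)
  then have "falling h r * (h - of_nat r) * x = x * (falling h' r * (h' - of_nat r))"
    using Suc by (metis mult.assoc)
  then show ?case by simp
qed simp

lemma commute_binom:
  assumes "h * x = x * h'"
  shows "binom h r * x = x * binom h' r"
  unfolding binom_def using commute_falling[OF assms, of r] by (metis of_q_commute mult.assoc)

lemma falling_plus_1:
  fixes h :: "'a::ring_1"
  shows "falling (h + 1) (Suc r) = falling h r * (h + 1)"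
proof (induction r)
  case (Suc r)
  have "falling (h + 1) (Suc (Suc r)) = falling h r * (h + 1) * (h + 1 - of_nat (Suc r))"
    using Suc by simp
  also have "\<dots> = falling h r * ((h - of_nat r) * (h + 1))"
    by (simp add: algebra_simps of_nat_commute)
  finally show ?case by (simp add: mult.assoc)
qed simp

lemma binom_plus_1:
  fixes h :: "'a::rat_algebra"
  shows "binom (h + 1) (Suc r) = binom h (Suc r) + binom h r"
proof -
  have "falling (h + 1) (Suc r) = falling h (Suc r) + of_nat (Suc r) * falling h r"
    unfolding falling_plus_1 by (simp add: algebra_simps of_nat_commute)
  then have "binom (h + 1) (Suc r) = binom h (Suc r) + of_q (1 / fact (Suc r)) * of_nat (Suc r) * falling h r"
    unfolding binom_def by (simp add: distrib_left mult.assoc del: falling.simps of_nat_Suc fact_Suc)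
  moreover have "of_q (1 / fact (Suc r)) * of_nat (Suc r) = (of_q (1 / fact r) :: 'a)"
    using Suc_of_q_fact of_q_commute by metis
  ultimately show ?thesis
    unfolding binom_def by simp
qed

lemma falling_zero: "r > 0 \<Longrightarrow> falling 0 r = 0"
  by (induction r) (simp, case_tac r, simp_all)

lemma binom_zero: "r > 0 \<Longrightarrow> binom 0 r = 0"
  by (simp add: binom_def falling_zero)

lemma binom_add:
  fixes x y :: "'a::rat_algebra"
  assumes "x * y = y * x"
  shows "binom (x + y) r = (\<Sum>a\<le>r. binom x a * binom y (r - a))"
proof (induction r)
  case (Suc r)
  have *: "of_nat (Suc r) * binom (x + y) (Suc r)
    = (\<Sum>a\<le>r. binom x a * binom y (r - a) * (x + y - of_nat r))"
    unfolding binom_Suc Suc sum_distrib_right ..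
  also have "\<dots> = (\<Sum>a\<le>r. of_nat (Suc a) * binom x (Suc a) * binom y (r - a)
    + of_nat (Suc r - a) * binom x a * binom y (Suc r - a))"
  proof (intro sum.cong refl)
    fix a assume "a \<in> {..r}"
    then have a: "a \<le> r" by simp
    have 1: "x + y - of_nat r = (x - of_nat a) + (y - of_nat (r - a))"
      using a by (simp add: of_nat_diff)
    have 2: "binom y (r - a) * (x - of_nat a) = (x - of_nat a) * binom y (r - a)"
      by (intro commute_binom) (simp add: assms algebra_simps of_nat_commute)
    have 3: "binom x a * binom y (r - a) * (x - of_nat a)
      = of_nat (Suc a) * binom x (Suc a) * binom y (r - a)"
      unfolding mult.assoc 2 by (simp add: mult.assoc[symmetric] binom_Suc[symmetric] del: of_nat_Suc)
    have 4: "binom x a * binom y (r - a) * (y - of_nat (r - a))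
      = of_nat (Suc r - a) * binom x a * binom y (Suc r - a)"
    proof -
      have "binom y (r - a) * (y - of_nat (r - a)) = of_nat (Suc r - a) * binom y (Suc r - a)"
        using a binom_Suc[of "r - a" y] by (simp add: Suc_diff_le del: of_nat_Suc)
      then show ?thesis
        by (metis mult.assoc of_nat_commute)
    qed
    show "binom x a * binom y (r - a) * (x + y - of_nat r)
      = of_nat (Suc a) * binom x (Suc a) * binom y (r - a)
      + of_nat (Suc r - a) * binom x a * binom y (Suc r - a)"
      unfolding 1 distrib_left 3 4 ..
  qed
  also have "\<dots> = (\<Sum>a\<le>r. of_nat (Suc a) * binom x (Suc a) * binom y (Suc r - Suc a))
    + (\<Sum>a\<le>r. of_nat (Suc r - a) * binom x a * binom y (Suc r - a))"
    by (simp add: sum.distrib)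
  also have "(\<Sum>a\<le>r. of_nat (Suc a) * binom x (Suc a) * binom y (Suc r - Suc a))
    = (\<Sum>a\<le>Suc r. of_nat a * binom x a * binom y (Suc r - a))"
    unfolding sum.atMost_Suc_shift[of "\<lambda>a. of_nat a * binom x a * binom y (Suc r - a)"] by simp
  also have "(\<Sum>a\<le>r. of_nat (Suc r - a) * binom x a * binom y (Suc r - a))
    = (\<Sum>a\<le>Suc r. of_nat (Suc r - a) * binom x a * binom y (Suc r - a))"
    by simp
  also have "(\<Sum>a\<le>Suc r. of_nat a * binom x a * binom y (Suc r - a))
    + (\<Sum>a\<le>Suc r. of_nat (Suc r - a) * binom x a * binom y (Suc r - a))
    = of_nat (Suc r) * (\<Sum>a\<le>Suc r. binom x a * binom y (Suc r - a))"
    unfolding sum.distrib[symmetric] sum_distrib_left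
  proof (intro sum.cong refl)
    fix a assume "a \<in> {..Suc r}"
    then have "of_nat (Suc r) = (of_nat a + of_nat (Suc r - a) :: 'a)"
      by (metis atMost_iff le_add_diff_inverse of_nat_add)
    then show "of_nat a * binom x a * binom y (Suc r - a)
      + of_nat (Suc r - a) * binom x a * binom y (Suc r - a)
      = of_nat (Suc r) * (binom x a * binom y (Suc r - a))"
      by (simp add: distrib_right mult.assoc)
  qed
  finally show ?case
    by (rule of_nat_Suc_cancel)
qed simp

definition addsub :: "'a::ab_group_add set \<Rightarrow> bool" where
  "addsub N \<longleftrightarrow> 0 \<in> N \<and> (\<forall>x\<in>N. \<forall>y\<in>N. x - y \<in> N)"

lemma addsub_0: "addsub N \<Longrightarrow> 0 \<in> N"
  and addsub_diff: "addsub N \<Longrightarrow> x \<in> N \<Longrightarrow> y \<in> N \<Longrightarrow> x - y \<in> N"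
  by (auto simp: addsub_def)

lemma addsub_minus: "addsub N \<Longrightarrow> x \<in> N \<Longrightarrow> - x \<in> N"
  using addsub_0 addsub_diff by (metis diff_0)

lemma addsub_add: "addsub N \<Longrightarrow> x \<in> N \<Longrightarrow> y \<in> N \<Longrightarrow> x + y \<in> N"
  using addsub_minus addsub_diff by (metis diff_minus_eq_add)

lemma addsub_sum: "addsub N \<Longrightarrow> (\<And>i. i \<in> I \<Longrightarrow> f i \<in> N) \<Longrightarrow> sum f I \<in> N"
  by (induction I rule: infinite_finite_induct) (auto simp: addsub_0 addsub_add)

lemmas addsub_closed = addsub_0 addsub_add addsub_diff addsub_minus addsub_sum

inductive_set addspan :: "'a::ab_group_add set \<Rightarrow> 'a set" for S where
  base: "x \<in> S \<Longrightarrow> x \<in> addspan S"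
| zero: "0 \<in> addspan S"
| diff: "x \<in> addspan S \<Longrightarrow> y \<in> addspan S \<Longrightarrow> x - y \<in> addspan S"

lemma addsub_addspan: "addsub (addspan S)"
  by (simp add: addsub_def addspan.zero addspan.diff)

lemma addspan_subset: "addsub N \<Longrightarrow> S \<subseteq> N \<Longrightarrow> addspan S \<subseteq> N"
proof
  fix x assume "addsub N" "S \<subseteq> N" "x \<in> addspan S"
  from this(3,1,2) show "x \<in> N"
    by induction (auto simp: addsub_closed)
qed

definition subrng :: "'a::ring_1 set \<Rightarrow> bool" where
  "subrng S \<longleftrightarrow> 1 \<in> S \<and> (\<forall>x\<in>S. \<forall>y\<in>S. x - y \<in> S \<and> x * y \<in> S)"

lemma subrng_1: "subrng S \<Longrightarrow> 1 \<in> S"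
  and subrng_diff: "subrng S \<Longrightarrow> x \<in> S \<Longrightarrow> y \<in> S \<Longrightarrow> x - y \<in> S"
  and subrng_mult: "subrng S \<Longrightarrow> x \<in> S \<Longrightarrow> y \<in> S \<Longrightarrow> x * y \<in> S"
  by (auto simp: subrng_def)

lemma subrng_addsub: "subrng S \<Longrightarrow> addsub S"
  unfolding subrng_def addsub_def by (metis diff_self)

lemmas subrng_0 = addsub_0[OF subrng_addsub]
  and subrng_minus = addsub_minus[OF subrng_addsub]
  and subrng_add = addsub_add[OF subrng_addsub]
  and subrng_sum = addsub_sum[OF subrng_addsub]

lemma subrng_of_nat: "subrng S \<Longrightarrow> of_nat k \<in> S"
  by (induction k) (auto simp: subrng_0 subrng_1 subrng_add)

lemma subrng_of_int: "subrng S \<Longrightarrow> of_int k \<in> S"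
  by (cases k rule: int_cases2) (auto simp: subrng_of_nat subrng_minus)

lemmas subrng_closed = subrng_1 subrng_0 subrng_add subrng_diff subrng_minus subrng_mult subrng_sum
  subrng_of_nat subrng_of_int

lemma binom_plus_of_nat_addsub:
  assumes "addsub S" "\<And>r. binom h r \<in> S"
  shows "binom (h + of_nat c) r \<in> S"
proof (induction c arbitrary: r)
  case (Suc c)
  show ?case
  proof (cases r)
    case (Suc r')
    have "binom (h + of_nat (Suc c)) r = binom (h + of_nat c) (Suc r') + binom (h + of_nat c) r'"
      using binom_plus_1[of "h + of_nat c" r'] Suc by (simp add: algebra_simps)
    then show ?thesis
      using Suc.IH assms(1) by (simp add: addsub_add)
  qed (use assms(2)[of 0] in simp)
qed (simp add: assms)

lemma binom_minus_of_nat_addsub: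
  assumes "addsub S" "\<And>r. binom h r \<in> S"
  shows "binom (h - of_nat c) r \<in> S"
proof (induction c arbitrary: r)
  case (Suc c)
  show ?case
  proof (induction r)
    case (Suc r)
    have "h - of_nat c = h - of_nat (Suc c) + 1"
      by simp
    then have "binom (h - of_nat c) (Suc r) = binom (h - of_nat (Suc c)) (Suc r) + binom (h - of_nat (Suc c)) r"
      using binom_plus_1[of "h - of_nat (Suc c)" r] by metis
    then show ?case
      using Suc.IH \<open>\<And>r. binom (h - of_nat c) r \<in> S\<close> assms(1) by (metis add_diff_cancel_right' addsub_diff)
  qed (use assms(2)[of 0] in simp)
qed (simp add: assms)

lemma binom_plus_of_int_addsub:
  assumes "addsub S" "\<And>r. binom h r \<in> S"
  shows "binom (h + of_int c) r \<in> S"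
  using binom_plus_of_nat_addsub[OF assms] binom_minus_of_nat_addsub[OF assms]
  by (cases c rule: int_cases2) auto

text \<open>Since \<open>binom 0 r = 0\<close>, \<open>binom_add\<close> for \<open>y + (- y)\<close> expresses \<open>binom (- y) r\<close> through lower ones.\<close>

lemma binom_uminus_subrng:
  assumes "subrng S" "\<And>r. binom y r \<in> S"
  shows "binom (- y) r \<in> S"
proof (induction r rule: less_induct)
  case (less r)
  show ?case
  proof (cases r)
    case (Suc r')
    have "0 = (\<Sum>a\<le>Suc r'. binom y a * binom (- y) (Suc r' - a))"
      using binom_add[of y "- y" "Suc r'"] by (simp add: binom_zero)
    then have "binom (- y) r = - (\<Sum>a\<le>r'. binom y (Suc a) * binom (- y) (r' - a))"
      unfolding sum.atMost_Suc_shift Suc by (simp add: eq_neg_iff_add_eq_0)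
    moreover have "(\<Sum>a\<le>r'. binom y (Suc a) * binom (- y) (r' - a)) \<in> S"
      using less.IH Suc by (intro subrng_sum subrng_mult assms) auto
    ultimately show ?thesis
      using assms(1) by (simp add: subrng_minus)
  qed (simp add: assms subrng_1)
qed

lemma binom_diff_subrng:
  assumes S: "subrng S" and "\<And>r. binom x r \<in> S" "\<And>r. binom y r \<in> S" "x * y = y * x"
  shows "binom (x - y) r \<in> S"
proof -
  have "binom (x + - y) r \<in> S"
    by (subst binom_add) (use assms in \<open>auto intro!: subrng_sum subrng_mult binom_uminus_subrng\<close>)
  then show ?thesis by simp
qed

text \<open>The common shape of the commutation formulas for divided powers.\<close>

lemma divpow_straighten:
  fixes A :: "'a::rat_algebra"
  assumes b: "\<And>t. A * b t = b t * A + b (Suc t) * k t"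
    and Q: "\<And>r t. A * Q r t = Q' r t * A"
    and Q0: "\<And>r. Q r 0 = 1" "\<And>r. Q' r 0 = 1"
    and rec: "\<And>r t. t \<le> r \<Longrightarrow>
      of_nat (Suc r) * Q (Suc r) (Suc t) = of_nat (r - t) * Q' r (Suc t) + k t * Q r t"
  shows "divpow A r * b 0 = (\<Sum>t\<le>r. b t * Q r t * divpow A (r - t))"
proof (induction r)
  case (Suc r)
  have step: "A * (b t * Q r t * divpow A (r - t)) =
    of_nat (Suc r - t) * (b t * Q' r t * divpow A (Suc r - t)) + b (Suc t) * k t * Q r t * divpow A (r - t)"
    if "t \<le> r" for t
  proof -
    have "A * (b t * Q r t * divpow A (r - t)) = (A * b t) * Q r t * divpow A (r - t)"
      by (simp add: mult.assoc)
    also have "\<dots> = b t * (A * Q r t) * divpow A (r - t) + b (Suc t) * k t * Q r t * divpow A (r - t)"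
      unfolding b by (simp add: distrib_right mult.assoc)
    also have "b t * (A * Q r t) * divpow A (r - t) = b t * Q' r t * (of_nat (Suc r - t) * divpow A (Suc r - t))"
      unfolding Q using divpow_Suc[of "r - t" A] that by (simp add: mult.assoc Suc_diff_le del: of_nat_Suc)
    also have "\<dots> = of_nat (Suc r - t) * (b t * Q' r t * divpow A (Suc r - t))"
      by (metis of_nat_commute mult.assoc)
    finally show ?thesis .
  qed
  have "of_nat (Suc r) * (divpow A (Suc r) * b 0) = A * (divpow A r * b 0)"
    by (simp add: mult.assoc[symmetric] divpow_Suc[symmetric] del: of_nat_Suc)
  also have "\<dots> = (\<Sum>t\<le>r. of_nat (Suc r - t) * (b t * Q' r t * divpow A (Suc r - t))
      + b (Suc t) * k t * Q r t * divpow A (r - t))"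
    unfolding Suc sum_distrib_left by (intro sum.cong refl) (use step in simp)
  also have "\<dots> = (\<Sum>t\<le>Suc r. of_nat (Suc r - t) * (b t * Q' r t * divpow A (Suc r - t)))
      + (\<Sum>t\<le>r. b (Suc t) * k t * Q r t * divpow A (r - t))"
    by (simp add: sum.distrib)
  also have "\<dots> = of_nat (Suc r) * (b 0 * divpow A (Suc r))
      + (\<Sum>t\<le>r. b (Suc t) * (of_nat (r - t) * Q' r (Suc t) + k t * Q r t) * divpow A (r - t))"
  proof -
    have eq: "of_nat (r - t) * (b (Suc t) * Q' r (Suc t) * divpow A (r - t))
        = b (Suc t) * (of_nat (r - t) * Q' r (Suc t)) * divpow A (r - t)" for t
      by (metis of_nat_commute mult.assoc)
    have "(\<Sum>t\<le>Suc r. of_nat (Suc r - t) * (b t * Q' r t * divpow A (Suc r - t)))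
      = of_nat (Suc r) * (b 0 * divpow A (Suc r))
        + (\<Sum>t\<le>r. b (Suc t) * (of_nat (r - t) * Q' r (Suc t)) * divpow A (r - t))"
      unfolding sum.atMost_Suc_shift diff_Suc_Suc eq by (simp add: Q0)
    then show ?thesis
      by (simp only: add.assoc sum.distrib[symmetric]) (simp only: distrib_left distrib_right mult.assoc)
  qed
  also have "\<dots> = of_nat (Suc r) * (b 0 * divpow A (Suc r))
      + (\<Sum>t\<le>r. of_nat (Suc r) * (b (Suc t) * Q (Suc r) (Suc t) * divpow A (r - t)))"
  proof -
    have "b (Suc t) * (of_nat (r - t) * Q' r (Suc t) + k t * Q r t) * divpow A (r - t)
      = of_nat (Suc r) * (b (Suc t) * Q (Suc r) (Suc t) * divpow A (r - t))" if "t \<le> r" for t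
      unfolding rec[OF that, symmetric] by (metis of_nat_commute mult.assoc)
    then show ?thesis by simp
  qed
  also have "\<dots> = of_nat (Suc r) * (\<Sum>t\<le>Suc r. b t * Q (Suc r) t * divpow A (Suc r - t))"
    unfolding sum.atMost_Suc_shift sum_distrib_left distrib_left by (simp add: Q0)
  finally show ?case
    by (rule of_nat_Suc_cancel)
qed (simp add: Q0)

lemma sl2_single:
  assumes ef: "e * f = f * e + h" and hf: "h * f = f * (h - 2)"
  shows "e * divpow f (Suc s) = divpow f (Suc s) * e + divpow f s * (h - of_nat s)"
proof (induction s)
  case (Suc s)
  have hfs: "h * divpow f s = divpow f s * (h - 2 * of_nat s)" for s
  proof (induction s)
    case (Suc s)
    have "of_nat (Suc s) * (h * divpow f (Suc s)) = h * f * divpow f s"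
      by (metis divpow_Suc of_nat_commute mult.assoc)
    also have "\<dots> = f * (divpow f s * (h - 2 * of_nat s)) - f * divpow f s * 2"
      unfolding hf by (simp add: mult.assoc right_diff_distrib left_diff_distrib Suc mult_2 mult_2_right algebra_simps)
    also have "\<dots> = f * divpow f s * (h - 2 * of_nat (Suc s))"
      by (simp add: algebra_simps)
    also have "\<dots> = of_nat (Suc s) * (divpow f (Suc s) * (h - 2 * of_nat (Suc s)))"
      by (metis divpow_Suc mult.assoc)
    finally show ?case by (rule of_nat_Suc_cancel)
  qed simp
  have "of_nat (Suc (Suc s)) * (e * divpow f (Suc (Suc s))) = e * f * divpow f (Suc s)"
    by (metis divpow_Suc of_nat_commute mult.assoc)
  also have "\<dots> = f * (e * divpow f (Suc s)) + h * divpow f (Suc s)"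
    unfolding ef by (simp add: distrib_right mult.assoc)
  also have "f * (e * divpow f (Suc s))
      = f * divpow f (Suc s) * e + of_nat (Suc s) * (divpow f (Suc s) * (h - of_nat s))"
    unfolding Suc distrib_left by (metis divpow_Suc mult.assoc)
  also have "h * divpow f (Suc s) = divpow f (Suc s) * (h - 2 * of_nat (Suc s))"
    by (rule hfs)
  also have "f * divpow f (Suc s) * e = of_nat (Suc (Suc s)) * (divpow f (Suc (Suc s)) * e)"
    by (metis divpow_Suc mult.assoc)
  also have "of_nat (Suc (Suc s)) * (divpow f (Suc (Suc s)) * e)
      + of_nat (Suc s) * (divpow f (Suc s) * (h - of_nat s)) + divpow f (Suc s) * (h - 2 * of_nat (Suc s))
      = of_nat (Suc (Suc s)) * (divpow f (Suc (Suc s)) * e + divpow f (Suc s) * (h - of_nat (Suc s)))"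
  proof -
    have "of_nat (Suc s) * (h - of_nat s) + (h - 2 * of_nat (Suc s))
        = of_nat (Suc (Suc s)) * (h - of_nat (Suc s))"
      by (simp add: algebra_simps mult_2)
    then have "divpow f (Suc s) * (of_nat (Suc s) * (h - of_nat s) + (h - 2 * of_nat (Suc s)))
        = divpow f (Suc s) * (of_nat (Suc (Suc s)) * (h - of_nat (Suc s)))"
      by simp
    then show ?thesis
      unfolding distrib_left of_nat_commute[of _ "divpow f (Suc s) * _"] mult.assoc
        of_nat_commute[of _ "h - _"] add.assoc by simp
  qed
  finally show ?case by (rule of_nat_Suc_cancel)
qed (simp add: ef)

lemma sl2_divpow:
  fixes e f h :: "'a::rat_algebra"
  assumes ef: "e * f = f * e + h" and hf: "h * f = f * (h - 2)" and he: "h * e = e * (h + 2)"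
  shows "divpow e r * divpow f s = (\<Sum>t\<le>r. (if t \<le> s then divpow f (s - t) else 0)
    * binom (h + of_int (2 * int t - int r - int s)) t * divpow e (r - t))"
proof -
  define b where "b t = (if t \<le> s then divpow f (s - t) else 0)" for t
  define k :: "nat \<Rightarrow> 'a" where "k t = h - of_int (int s - int t - 1)" for t
  define Q where "Q r t = binom (h + of_int (2 * int t - int r - int s)) t" for r t
  define Q' where "Q' r t = binom (h + of_int (2 * int t - int r - int s - 2)) t" for r t
  have "divpow e r * b 0 = (\<Sum>t\<le>r. b t * Q r t * divpow e (r - t))"
  proof (rule divpow_straighten)
    show "e * b t = b t * e + b (Suc t) * k t" for t
    proof (cases "t < s")
      case True
      then obtain d where "s = Suc (t + d)"
        using less_imp_Suc_add by auto
      then show ?thesis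
        using sl2_single[OF ef hf, of d] by (simp add: b_def k_def)
    next
      case False
      then show ?thesis by (simp add: b_def)
    qed
    show "e * Q r t = Q' r t * e" for r t
    proof -
      define c where "c = 2 * int t - int r - int s"
      have "e * h = (h - 2) * e"
        using he by (simp add: algebra_simps mult_2 mult_2_right)
      then have *: "(h + of_int (c - 2)) * e = e * (h + of_int c)"
        by (simp add: algebra_simps mult_of_int_commute)
      show ?thesis
        unfolding Q_def Q'_def c_def[symmetric] using commute_binom[OF *] by simp
    qed
    show "Q r 0 = 1" "Q' r 0 = 1" for r
      by (simp_all add: Q_def Q'_def)
    show "of_nat (Suc r) * Q (Suc r) (Suc t) = of_nat (r - t) * Q' r (Suc t) + k t * Q r t"
      if "t \<le> r" for r t
    proof -
      define y where "y = h + of_int (2 * int t - int r - int s)"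
      have 1: "Q (Suc r) (Suc t) = binom y (Suc t) + binom y t"
        unfolding Q_def y_def binom_plus_1[symmetric] by (simp add: algebra_simps)
      have 2: "Q' r (Suc t) = binom y (Suc t)" "Q r t = binom y t"
        unfolding Q_def Q'_def y_def by (simp_all add: algebra_simps)
      have k: "k t = y + of_nat (r - t) + 1"
      proof -
        have "2 * int t - int r - int s + int (r - t) + 1 = - (int s - int t - 1)"
          using that by (simp add: of_nat_diff)
        then have "h + of_int (2 * int t - int r - int s + int (r - t) + 1) = k t"
          by (simp only: k_def of_int_minus diff_conv_add_uminus)
        then show ?thesis
          by (simp add: y_def algebra_simps)
      qed
      have 3: "of_nat (Suc t) * binom y (Suc t) = y * binom y t - of_nat t * binom y t"
        unfolding binom_Suc using commute_binom[of y y y t]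
        by (simp add: algebra_simps of_nat_commute)
      have r: "of_nat (Suc r) = (of_nat (r - t) + of_nat (Suc t) :: 'a)"
        using that by (simp add: of_nat_diff)
      show ?thesis
        unfolding 1 2 k r distrib_left distrib_right 3 by (simp add: algebra_simps)
    qed
  qed
  then show ?thesis
    unfolding b_def Q_def by simp
qed

lemma heisenberg_divpow:
  fixes a b c :: "'a::rat_algebra"
  assumes ab: "a * b = b * a + c" and ac: "a * c = c * a" and bc: "b * c = c * b"
  shows "divpow a r * divpow b s
    = (\<Sum>t\<le>r. (if t \<le> s then divpow b (s - t) else 0) * divpow c t * divpow a (r - t))"
proof -
  have single: "a * divpow b (Suc s) = divpow b (Suc s) * a + divpow b s * c" for s
  proof (induction s)
    case (Suc s)
    have "of_nat (Suc (Suc s)) * (a * divpow b (Suc (Suc s))) = a * b * divpow b (Suc s)"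
      by (metis divpow_Suc of_nat_commute mult.assoc)
    also have "\<dots> = b * (a * divpow b (Suc s)) + c * divpow b (Suc s)"
      unfolding ab by (simp add: distrib_right mult.assoc)
    also have "c * divpow b (Suc s) = divpow b (Suc s) * c"
      using commute_divpow[OF bc] by simp
    also have "b * (a * divpow b (Suc s)) = b * divpow b (Suc s) * a + b * divpow b s * c"
      unfolding Suc by (simp add: distrib_left mult.assoc)
    also have "\<dots> = of_nat (Suc (Suc s)) * divpow b (Suc (Suc s)) * a + of_nat (Suc s) * divpow b (Suc s) * c"
      by (simp only: divpow_Suc)
    finally have "of_nat (Suc (Suc s)) * (a * divpow b (Suc (Suc s)))
        = of_nat (Suc (Suc s)) * (divpow b (Suc (Suc s)) * a + divpow b (Suc s) * c)"
      by (simp add: algebra_simps)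
    then show ?case by (rule of_nat_Suc_cancel)
  qed (simp add: ab)
  define B where "B t = (if t \<le> s then divpow b (s - t) else 0)" for t
  have "divpow a r * B 0 = (\<Sum>t\<le>r. B t * divpow c t * divpow a (r - t))"
  proof (rule divpow_straighten)
    show "a * B t = B t * a + B (Suc t) * c" for t
    proof (cases "t < s")
      case True
      then obtain d where "s = Suc (t + d)"
        using less_imp_Suc_add by auto
      then show ?thesis
        using single[of d] by (simp add: B_def)
    next
      case False
      then show ?thesis by (simp add: B_def)
    qed
    show "a * divpow c t = divpow c t * a" for t
      using commute_divpow[of c a] ac by simp
    show "of_nat (Suc r) * divpow c (Suc t) = of_nat (r - t) * divpow c (Suc t) + c * divpow c t"
      if "t \<le> r" for r t
    proof -
      have "of_nat (Suc r) = (of_nat (r - t) + of_nat (Suc t) :: 'a)"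
        using that by (simp add: of_nat_diff)
      then show ?thesis
        by (simp only: distrib_right divpow_Suc)
    qed
  qed auto
  then show ?thesis
    unfolding B_def by simp
qed

lemma divpow_commutator_subrng:
  assumes S: "subrng S" and "\<And>r. divpow a r \<in> S" "\<And>r. divpow b r \<in> S"
    and "a * b = b * a + c" "a * c = c * a" "b * c = c * b"
  shows "divpow c r \<in> S"
proof (induction r rule: less_induct)
  case (less r)
  have "divpow a r * divpow b r = (\<Sum>t\<le>r. divpow b (r - t) * divpow c t * divpow a (r - t))"
    unfolding heisenberg_divpow[OF assms(4-6)] by (intro sum.cong) auto
  also have "\<dots> = (\<Sum>t<r. divpow b (r - t) * divpow c t * divpow a (r - t)) + divpow c r"
    unfolding lessThan_Suc_atMost[symmetric] by simp
  finally have "divpow c r = divpow a r * divpow b r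
      - (\<Sum>t<r. divpow b (r - t) * divpow c t * divpow a (r - t))"
    by simp
  also have "\<dots> \<in> S"
    using assms less by (intro subrng_diff subrng_mult subrng_sum) auto
  finally show ?case .
qed

lemma divpow_past:
  fixes e x y :: "'a::rat_algebra"
  assumes "e * x = x * e + y" "e * y = y * e"
  shows "divpow e (Suc r) * x = x * divpow e (Suc r) + y * divpow e r"
proof (induction r)
  case (Suc r)
  have "of_nat (Suc (Suc r)) * (divpow e (Suc (Suc r)) * x) = e * (divpow e (Suc r) * x)"
    by (simp only: mult.assoc[symmetric] divpow_Suc)
  also have "\<dots> = (e * x) * divpow e (Suc r) + (e * y) * divpow e r"
    unfolding Suc by (simp add: algebra_simps)
  also have "\<dots> = x * (e * divpow e (Suc r)) + y * divpow e (Suc r) + y * (e * divpow e r)"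
    unfolding assms by (simp add: algebra_simps)
  also have "\<dots> = x * (of_nat (Suc (Suc r)) * divpow e (Suc (Suc r))) + y * divpow e (Suc r)
      + y * (of_nat (Suc r) * divpow e (Suc r))"
    by (simp only: divpow_Suc)
  also have "\<dots> = of_nat (Suc (Suc r)) * (x * divpow e (Suc (Suc r)) + y * divpow e (Suc r))"
  proof -
    have *: "x * (of_nat k * z) = of_nat k * (x * z)" for k and x z :: 'a
      by (metis of_nat_commute mult.assoc)
    have "y * z + y * (of_nat (Suc r) * z) = of_nat (Suc (Suc r)) * (y * z)" for z
      unfolding * by (simp add: distrib_right)
    with * show ?thesis
      by (simp only: distrib_left add.assoc)
  qed
  finally show ?case by (rule of_nat_Suc_cancel)
qed (simp add: assms)

lemma commute_pow_shift:
  assumes "h * x = x * (h + of_int c)"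
  shows "h * x ^ s = x ^ s * (h + of_int (int s * c))"
proof (induction s)
  case (Suc s)
  have "h * x ^ Suc s = x * (h * x ^ s) + x * (of_int c * x ^ s)"
    using assms by (simp add: mult.assoc[symmetric] distrib_left distrib_right)
  also have "of_int c * x ^ s = x ^ s * of_int c"
    by (rule mult_of_int_commute)
  also have "x * (h * x ^ s) + x * (x ^ s * of_int c) = x ^ Suc s * (h + of_int (int (Suc s) * c))"
    unfolding Suc by (simp add: algebra_simps)
  finally show ?case .
qed simp

lemma binom_past_divpow:
  assumes "h * x = x * (h + of_int c)"
  shows "binom h r * divpow x s = divpow x s * binom (h + of_int (int s * c)) r"
proof (rule commute_binom)
  show "h * divpow x s = divpow x s * (h + of_int (int s * c))"
    unfolding divpow_def using commute_pow_shift[OF assms, of s] by (metis of_q_commute mult.assoc)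
qed

section \<open>Integer binomial coefficients\<close>

lemma fact_int_binomial: "fact r * int_binomial a r = (\<Prod>k<r. a - int k)"
proof -
  have "(\<Prod>k<r. a - int k) = pochhammer (a - int r + 1) r"
    unfolding lessThan_atLeast0 falling_fact_pochhammer' ..
  then show ?thesis
    unfolding int_binomial_def using fact_dvd_pochhammer by (metis dvd_mult_div_cancel)
qed

lemma int_binomial_0 [simp]: "int_binomial a 0 = 1"
  by (simp add: int_binomial_def)

lemma int_binomial_1 [simp]: "int_binomial a (Suc 0) = a"
  by (simp add: int_binomial_def)

lemma int_binomial_plus_1:
  "int_binomial (a + 1) (Suc r) = int_binomial a (Suc r) + int_binomial a r"
proof -
  have "(\<Prod>k<Suc r. a + 1 - int k) = (a + 1) * (\<Prod>k<r. a - int k)"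
    unfolding prod.lessThan_Suc_shift by simp
  moreover have "fact (Suc r) * int_binomial a r = int (Suc r) * (\<Prod>k<r. a - int k)"
    using fact_int_binomial[of r a] by simp
  ultimately have "fact (Suc r) * int_binomial (a + 1) (Suc r)
      = fact (Suc r) * (int_binomial a (Suc r) + int_binomial a r)"
    unfolding distrib_left fact_int_binomial by (simp add: algebra_simps)
  then show ?thesis by simp
qed

lemma int_binomial_zero:
  assumes "r > 0"
  shows "int_binomial 0 r = 0"
proof -
  have "(\<Prod>k<r. 0 - int k) = 0"
    using assms by (intro prod_zero) auto
  then show ?thesis
    unfolding int_binomial_def by (simp only: div_0)
qed

lemma int_binomial_same: "int_binomial (int d) d = 1"
proof -
  have "(\<Prod>k<d. int d - int k) = fact d"
  proof (induction d)
    case (Suc d)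
    have "(\<Prod>k<Suc d. int (Suc d) - int k) = (1 + int d) * (\<Prod>k<d. int d - int k)"
      unfolding prod.lessThan_Suc_shift by simp
    then show ?case
      using Suc by (simp add: algebra_simps)
  qed simp
  then show ?thesis by (simp add: int_binomial_def)
qed

lemma int_binomial_separates:
  assumes "a \<noteq> b"
  shows "\<exists>r. (of_int (int_binomial a r) :: 'f::comm_ring_1) \<noteq> of_int (int_binomial b r)"
proof (rule ccontr)
  define P where "P a b \<longleftrightarrow> (\<forall>r. (of_int (int_binomial a r) :: 'f) = of_int (int_binomial b r))" for a b
  assume "\<not> ?thesis"
  then have "P a b" by (simp add: P_def)
  have up: "P (a + 1) (b + 1)" if "P a b" for a b
    unfolding P_def
  proof
    fix r show "(of_int (int_binomial (a + 1) r) :: 'f) = of_int (int_binomial (b + 1) r)"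
      using that by (cases r) (simp_all add: P_def int_binomial_plus_1)
  qed
  have down: "P (a - 1) (b - 1)" if "P a b" for a b
    unfolding P_def
  proof
    fix r show "(of_int (int_binomial (a - 1) r) :: 'f) = of_int (int_binomial (b - 1) r)"
    proof (induction r)
      case (Suc r)
      have "int_binomial (c - 1) (Suc r) = int_binomial c (Suc r) - int_binomial (c - 1) r" for c
        using int_binomial_plus_1[of "c - 1" r] by simp
      then show ?case
        using that Suc by (simp add: P_def)
    qed simp
  qed
  have shift: "P (a + c) (b + c)" if "P a b" for a b c
  proof (induction c rule: int_induct[where k = 0])
    case (step1 i)
    then show ?case using up[of "a + i" "b + i"] by (simp add: add.assoc)
  next
    case (step2 i)
    then show ?case using down[of "a + i" "b + i"] by (simp add: algebra_simps)
  qed (use that in simp)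
  have "\<not> P (int d) 0" if "d > 0" for d
  proof
    assume "P (int d) 0"
    then have "(of_int (int_binomial (int d) d) :: 'f) = of_int (int_binomial 0 d)"
      by (simp add: P_def)
    then show False
      using that by (simp add: int_binomial_same int_binomial_zero)
  qed
  then have "\<not> P d 0" if "d > 0" for d
    using that by (metis zero_less_imp_eq_int)
  moreover have "P (a - b) 0" "P (b - a) 0"
    using shift[OF \<open>P a b\<close>, of "- b"] shift[OF \<open>P a b\<close>, of "- a"] by (simp_all add: P_def)
  ultimately show False
    using assms by (metis diff_gt_0_iff_gt linorder_neqE)
qed

section \<open>Relations of the general linear superalgebra\<close>

lemma I0_D: "(i, j) \<in> I0 m n \<Longrightarrow>
    i < j \<and> i \<in> {1..m + n} \<and> j \<in> {1..m + n} \<and> (i \<le> m \<longleftrightarrow> j \<le> m)"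
  by (auto simp: I0_def)

lemma I1_D: "(i, j) \<in> I1 m n \<Longrightarrow>
    i < j \<and> i \<in> {1..m + n} \<and> j \<in> {1..m + n} \<and> i \<le> m \<and> \<not> j \<le> m"
  by (auto simp: I1_def)

lemma I0_I: "i < j \<Longrightarrow> i \<in> {1..m + n} \<Longrightarrow> j \<in> {1..m + n} \<Longrightarrow> (i \<le> m \<longleftrightarrow> j \<le> m) \<Longrightarrow> (i, j) \<in> I0 m n"
  by (auto simp: I0_def)

lemma I1_I: "i \<in> {1..m + n} \<Longrightarrow> j \<in> {1..m + n} \<Longrightarrow> i \<le> m \<Longrightarrow> \<not> j \<le> m \<Longrightarrow> (i, j) \<in> I1 m n"
  by (auto simp: I1_def)

locale gl_relations =
  fixes m n :: nat and E :: "nat \<Rightarrow> nat \<Rightarrow> 'u::rat_algebra"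
  assumes even_rel: "\<lbrakk>i \<in> {1..m + n}; j \<in> {1..m + n}; k \<in> {1..m + n}; l \<in> {1..m + n};
      (i \<le> m \<longleftrightarrow> j \<le> m) \<or> (k \<le> m \<longleftrightarrow> l \<le> m)\<rbrakk> \<Longrightarrow>
      E i j * E k l = E k l * E i j + ((if j = k then E i l else 0) - (if i = l then E k j else 0))"
    and odd_rel: "\<lbrakk>i \<in> {1..m + n}; j \<in> {1..m + n}; k \<in> {1..m + n}; l \<in> {1..m + n};
      \<not> (i \<le> m \<longleftrightarrow> j \<le> m); \<not> (k \<le> m \<longleftrightarrow> l \<le> m)\<rbrakk> \<Longrightarrow>
      E i j * E k l = - (E k l * E i j) + ((if j = k then E i l else 0) + (if i = l then E k j else 0))"
begin

definition even_gens :: "'u set" where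
  "even_gens = {divpow (E i j) r | i j r. (i, j) \<in> I0 m n} \<union>
     {divpow (E j i) r | i j r. (i, j) \<in> I0 m n} \<union> {binom (E s s) r | s r. s \<in> {1..m + n}}"

lemma even_gensI:
  "(i, j) \<in> I0 m n \<Longrightarrow> divpow (E i j) r \<in> even_gens"
  "(i, j) \<in> I0 m n \<Longrightarrow> divpow (E j i) r \<in> even_gens"
  "s \<in> {1..m + n} \<Longrightarrow> binom (E s s) r \<in> even_gens"
  unfolding even_gens_def by blast+

lemma divpow_in_even_gens:
  assumes "i \<in> {1..m + n}" "j \<in> {1..m + n}" "i \<noteq> j" "i \<le> m \<longleftrightarrow> j \<le> m"
  shows "divpow (E i j) r \<in> even_gens"
proof (cases "i < j")
  case True
  then show ?thesis using even_gensI(1) I0_I assms by blast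
next
  case False
  then have "j < i" using assms by simp
  then show ?thesis using even_gensI(2) I0_I assms by blast
qed

lemma in_even_gens:
  assumes "i \<in> {1..m + n}" "j \<in> {1..m + n}" "i \<le> m \<longleftrightarrow> j \<le> m"
  shows "E i j \<in> even_gens"
  using divpow_in_even_gens[OF assms(1,2) _ assms(3), of 1] even_gensI(3)[OF assms(1), of 1]
  by (cases "i = j") auto

lemma even_gens_cases:
  assumes "u \<in> even_gens"
  obtains (divpow) i j r where "u = divpow (E i j) r" "i \<in> {1..m + n}" "j \<in> {1..m + n}"
      "i \<noteq> j" "i \<le> m \<longleftrightarrow> j \<le> m"
    | (binom) s r where "u = binom (E s s) r" "s \<in> {1..m + n}"
  using assms unfolding even_gens_def by (auto dest!: I0_D)

lemma diag_past:
  assumes "s \<in> {1..m + n}" "i \<in> {1..m + n}" "j \<in> {1..m + n}"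
  shows "E s s * E i j = E i j * (E s s + of_int (of_bool (s = i) - of_bool (s = j)))"
  using even_rel[of s s i j] assms by (auto simp: algebra_simps)

lemma divpow_even_past_odd:
  assumes "i \<in> {1..m + n}" "j \<in> {1..m + n}" "i \<noteq> j" "i \<le> m \<longleftrightarrow> j \<le> m"
    and "k \<in> {1..m + n}" "l \<in> {1..m + n}" "\<not> (k \<le> m \<longleftrightarrow> l \<le> m)"
  shows "divpow (E i j) (Suc r) * E k l = E k l * divpow (E i j) (Suc r)
    + ((if j = k then E i l else 0) - (if i = l then E k j else 0)) * divpow (E i j) r"
proof (rule divpow_past)
  show "E i j * E k l = E k l * E i j + ((if j = k then E i l else 0) - (if i = l then E k j else 0))"
    using assms by (intro even_rel) auto
  have "E i j * E i l = E i l * E i j" if "j = k"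
    using even_rel[of i j i l] assms that by auto
  moreover have "E i j * E k j = E k j * E i j" if "i = l"
    using even_rel[of i j k j] assms that by auto
  ultimately show "E i j * ((if j = k then E i l else 0) - (if i = l then E k j else 0))
      = ((if j = k then E i l else 0) - (if i = l then E k j else 0)) * E i j"
    by (auto simp: algebra_simps)
qed

lemma odd_square:
  assumes "i \<in> {1..m + n}" "j \<in> {1..m + n}" "\<not> (i \<le> m \<longleftrightarrow> j \<le> m)"
  shows "E i j * E i j = 0"
proof (rule of_nat_Suc_cancel[of 1])
  have "E i j * E i j = - (E i j * E i j)"
    using odd_rel[of i j i j] assms by auto
  then have "E i j * E i j + E i j * E i j = 0"
    by (metis add.right_inverse)
  then show "of_nat (Suc 1) * (E i j * E i j) = of_nat (Suc 1) * 0"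
    by (simp add: distrib_right mult_2)
qed

lemma lower_anticommute:
  assumes "(i, j) \<in> I1 m n" "(k, l) \<in> I1 m n"
  shows "E j i * E l k = - (E l k * E j i)"
  using odd_rel[of j i l k] I1_D[OF assms(1)] I1_D[OF assms(2)] by auto

lemma simple_generation:
  assumes S: "subrng S"
    and e: "\<And>i r. (i, Suc i) \<in> I0 m n \<Longrightarrow> divpow (E i (Suc i)) r \<in> S"
    and f: "\<And>i r. (i, Suc i) \<in> I0 m n \<Longrightarrow> divpow (E (Suc i) i) r \<in> S"
    and h: "\<And>s r. s \<in> {1..m + n} \<Longrightarrow> binom (E s s) r \<in> S"
  shows "even_gens \<subseteq> S"
proof -
  have *: "\<forall>r. divpow (E i j) r \<in> S \<and> divpow (E j i) r \<in> S" if "(i, j) \<in> I0 m n" for i j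
    using that
  proof (induction "j - i" arbitrary: j rule: less_induct)
    case less
    note ij = I0_D[OF less.prems]
    show ?case
    proof (cases "j = Suc i")
      case True
      then show ?thesis using e f less.prems by blast
    next
      case False
      define k where "k = j - 1"
      have k: "i < k" "j = Suc k" "k \<in> {1..m + n}" "k \<le> m \<longleftrightarrow> i \<le> m"
        using ij False less.prems by (auto simp: k_def I0_def)
      have ik: "(i, k) \<in> I0 m n" and kj: "(k, j) \<in> I0 m n"
        using ij k by (auto intro!: I0_I simp del: atLeastAtMost_iff)
      have 1: "divpow (E i k) r \<in> S" "divpow (E k i) r \<in> S" "divpow (E k j) r \<in> S" "divpow (E j k) r \<in> S" for r
        using less.hyps[OF _ ik] e f k kj by auto
      have "divpow (E i j) r \<in> S" for r
        by (rule divpow_commutator_subrng[OF S 1(1) 1(3)])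
          (use even_rel[of i k k j] even_rel[of i k i j] even_rel[of k j i j] ij k in auto)
      moreover have "divpow (E j i) r \<in> S" for r
        by (rule divpow_commutator_subrng[OF S 1(4) 1(2)])
          (use even_rel[of j k k i] even_rel[of j k j i] even_rel[of k i j i] ij k in auto)
      ultimately show ?thesis by simp
    qed
  qed
  then show ?thesis
    unfolding even_gens_def using h by blast
qed

lemma simple_sl2:
  assumes "(i, Suc i) \<in> I0 m n"
  shows "divpow (E i (Suc i)) r * divpow (E (Suc i) i) s = (\<Sum>t\<le>r.
    (if t \<le> s then divpow (E (Suc i) i) (s - t) else 0)
    * binom (E i i - E (Suc i) (Suc i) + of_int (2 * int t - int r - int s)) t
    * divpow (E i (Suc i)) (r - t))"
proof (rule sl2_divpow)
  note i = I0_D[OF assms]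
  show "E i (Suc i) * E (Suc i) i = E (Suc i) i * E i (Suc i) + (E i i - E (Suc i) (Suc i))"
    using even_rel[of i "Suc i" "Suc i" i] i by simp
  show "(E i i - E (Suc i) (Suc i)) * E (Suc i) i = E (Suc i) i * (E i i - E (Suc i) (Suc i) - 2)"
    using diag_past[of i "Suc i" i] diag_past[of "Suc i" "Suc i" i] i
    by (simp add: left_diff_distrib right_diff_distrib distrib_left mult_2_right)
  show "(E i i - E (Suc i) (Suc i)) * E i (Suc i) = E i (Suc i) * (E i i - E (Suc i) (Suc i) + 2)"
    using diag_past[of i i "Suc i"] diag_past[of "Suc i" i "Suc i"] i
    by (simp add: left_diff_distrib right_diff_distrib distrib_left mult_2_right)
qed

lemma simple_commute:
  assumes "(i, Suc i) \<in> I0 m n" "(j, Suc j) \<in> I0 m n" "i \<noteq> j"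
  shows "divpow (E i (Suc i)) r * divpow (E (Suc j) j) s = divpow (E (Suc j) j) s * divpow (E i (Suc i)) r"
proof (intro commute_divpow)
  have "E i (Suc i) * E (Suc j) j = E (Suc j) j * E i (Suc i)"
    using even_rel[of i "Suc i" "Suc j" j] I0_D[OF assms(1)] I0_D[OF assms(2)] assms(3) by simp
  then show "E i (Suc i) * divpow (E (Suc j) j) s = divpow (E (Suc j) j) s * E i (Suc i)"
    using commute_divpow by metis
qed

end

section \<open>Weight modules\<close>

locale gl_module = gl_relations m n E
  for m n :: nat and E :: "nat \<Rightarrow> nat \<Rightarrow> 'u::rat_algebra" +
  fixes Z :: "'u set" and C :: "'v::ab_group_add set"
    and act :: "'u \<Rightarrow> 'v \<Rightarrow> 'v" and sc :: "'f::field \<Rightarrow> 'v \<Rightarrow> 'v"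
  assumes Z: "subrng Z" and even_Z: "even_gens \<subseteq> Z" and C: "addsub C"
    and act_closed [intro]: "\<And>u x. u \<in> Z \<Longrightarrow> x \<in> C \<Longrightarrow> act u x \<in> C"
    and act_add_left: "\<And>u w x. u \<in> Z \<Longrightarrow> w \<in> Z \<Longrightarrow> x \<in> C \<Longrightarrow> act (u + w) x = act u x + act w x"
    and act_add_right: "\<And>u x y. u \<in> Z \<Longrightarrow> x \<in> C \<Longrightarrow> y \<in> C \<Longrightarrow> act u (x + y) = act u x + act u y"
    and act_mult: "\<And>u w x. u \<in> Z \<Longrightarrow> w \<in> Z \<Longrightarrow> x \<in> C \<Longrightarrow> act (u * w) x = act u (act w x)"
    and act_one: "\<And>x. x \<in> C \<Longrightarrow> act 1 x = x"
    and sc_closed [intro]: "\<And>c x. x \<in> C \<Longrightarrow> sc c x \<in> C"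
    and sc_add_left: "\<And>c d x. x \<in> C \<Longrightarrow> sc (c + d) x = sc c x + sc d x"
    and sc_add_right: "\<And>c x y. x \<in> C \<Longrightarrow> y \<in> C \<Longrightarrow> sc c (x + y) = sc c x + sc c y"
    and sc_mult: "\<And>c d x. x \<in> C \<Longrightarrow> sc (c * d) x = sc c (sc d x)"
    and sc_one: "\<And>x. x \<in> C \<Longrightarrow> sc 1 x = x"
    and act_sc: "\<And>u c x. u \<in> Z \<Longrightarrow> x \<in> C \<Longrightarrow> act u (sc c x) = sc c (act u x)"
begin

lemmas Z_closed = subrng_closed[OF Z]
  and C_closed = addsub_closed[OF C]

lemma act_zero_right [simp]: "u \<in> Z \<Longrightarrow> act u 0 = 0"
  using act_add_right[of u 0 0] C_closed(1) by simp

lemma act_zero_left [simp]: "x \<in> C \<Longrightarrow> act 0 x = 0"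
  using act_add_left[of 0 0 x] Z_closed(2) by simp

lemma act_diff_right: "u \<in> Z \<Longrightarrow> x \<in> C \<Longrightarrow> y \<in> C \<Longrightarrow> act u (x - y) = act u x - act u y"
  using act_add_right[of u "x - y" y] C_closed by (simp add: eq_diff_eq)

lemma act_diff_left: "u \<in> Z \<Longrightarrow> w \<in> Z \<Longrightarrow> x \<in> C \<Longrightarrow> act (u - w) x = act u x - act w x"
  using act_add_left[of "u - w" w x] Z_closed by (simp add: eq_diff_eq)

lemma act_minus_left: "u \<in> Z \<Longrightarrow> x \<in> C \<Longrightarrow> act (- u) x = - act u x"
  using act_diff_left[of 0 u x] Z_closed by simp

lemma act_sum: "(\<And>i. i \<in> I \<Longrightarrow> f i \<in> Z) \<Longrightarrow> x \<in> C \<Longrightarrow> act (sum f I) x = (\<Sum>i\<in>I. act (f i) x)"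
  by (induction I rule: infinite_finite_induct) (auto simp: act_add_left Z_closed)

lemma sc_zero_right [simp]: "sc c 0 = 0"
  using sc_add_right[of 0 0 c] C_closed(1) by simp

lemma sc_zero_left [simp]: "x \<in> C \<Longrightarrow> sc 0 x = 0"
  using sc_add_left[of x 0 0] by simp

lemma sc_diff_right: "x \<in> C \<Longrightarrow> y \<in> C \<Longrightarrow> sc c (x - y) = sc c x - sc c y"
  using sc_add_right[of "x - y" y c] C_closed by (simp add: eq_diff_eq)

lemma sc_diff_left: "x \<in> C \<Longrightarrow> sc (c - d) x = sc c x - sc d x"
  using sc_add_left[of x "c - d" d] by (simp add: eq_diff_eq)

lemma sc_inverse: "x \<in> C \<Longrightarrow> c \<noteq> 0 \<Longrightarrow> sc (inverse c) (sc c x) = x"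
  using sc_mult[of x "inverse c" c] sc_one by simp

lemma sc_eq_0: "x \<in> C \<Longrightarrow> sc c x = 0 \<Longrightarrow> x \<noteq> 0 \<Longrightarrow> c = 0"
  using sc_inverse by fastforce

lemma act_of_nat: "x \<in> C \<Longrightarrow> act (of_nat k) x = sc (of_nat k) x"
  by (induction k) (auto simp: act_add_left sc_add_left act_one sc_one Z_closed)

lemma act_of_int: "x \<in> C \<Longrightarrow> act (of_int k) x = sc (of_int k) x"
proof (cases k rule: int_cases2)
  case (nonpos j)
  assume x: "x \<in> C"
  show ?thesis
    using act_minus_left[of "of_nat j" x] sc_diff_left[of x 0 "of_nat j"] act_of_nat[OF x, of j] x nonpos
    by (simp add: Z_closed)
qed (simp add: act_of_nat)

lemma subrng_stab:
  assumes "addsub N" "N \<subseteq> C"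
  shows "subrng {u \<in> Z. \<forall>x\<in>N. act u x \<in> N}"
  using assms unfolding subrng_def
  by (auto simp: Z_closed act_one subset_iff act_diff_left act_mult addsub_closed)

lemma addsub_stab: "addsub N \<Longrightarrow> x \<in> C \<Longrightarrow> addsub {u \<in> Z. act u x \<in> N}"
  unfolding addsub_def using Z_closed by (auto simp: act_diff_left)

definition even_stable :: "'v set \<Rightarrow> bool" where
  "even_stable N \<longleftrightarrow> addsub N \<and> N \<subseteq> C \<and> (\<forall>u\<in>even_gens. \<forall>x\<in>N. act u x \<in> N) \<and> (\<forall>c. \<forall>x\<in>N. sc c x \<in> N)"

lemma even_stableD:
  assumes "even_stable N"
  shows "addsub N" "N \<subseteq> C" "u \<in> even_gens \<Longrightarrow> x \<in> N \<Longrightarrow> act u x \<in> N" "x \<in> N \<Longrightarrow> sc c x \<in> N"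
  using assms by (auto simp: even_stable_def)

lemma divpow_Z:
  "i \<in> {1..m + n} \<Longrightarrow> j \<in> {1..m + n} \<Longrightarrow> i \<noteq> j \<Longrightarrow> i \<le> m \<longleftrightarrow> j \<le> m \<Longrightarrow> divpow (E i j) r \<in> Z"
  using divpow_in_even_gens even_Z by blast

lemma binom_diag_Z: "s \<in> {1..m + n} \<Longrightarrow> binom (E s s) r \<in> Z"
  using even_gensI(3) even_Z by blast

lemma binom_diag_shift_Z: "s \<in> {1..m + n} \<Longrightarrow> binom (E s s + of_int c) r \<in> Z"
  by (intro binom_plus_of_int_addsub subrng_addsub Z binom_diag_Z)

definition wt :: "(nat \<Rightarrow> int) \<Rightarrow> 'v set" where
  "wt mu = {v \<in> C. \<forall>i\<in>{1..m + n}. \<forall>r.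
     act (binom (E i i) r) v = sc (of_int (int_binomial (mu i) r)) v}"

lemma wt_C: "v \<in> wt mu \<Longrightarrow> v \<in> C"
  and wt_act: "v \<in> wt mu \<Longrightarrow> i \<in> {1..m + n} \<Longrightarrow>
     act (binom (E i i) r) v = sc (of_int (int_binomial (mu i) r)) v"
  by (auto simp: wt_def)

lemma wt_sc: "v \<in> wt mu \<Longrightarrow> sc c v \<in> wt mu"
  by (auto simp: wt_def act_sc binom_diag_Z sc_mult[symmetric] mult.commute)

lemma wt_diag: "v \<in> wt mu \<Longrightarrow> i \<in> {1..m + n} \<Longrightarrow> act (E i i) v = sc (of_int (mu i)) v"
  using wt_act[of v mu i 1] by simp

lemma act_binom_shift:
  assumes bZ: "\<And>r. binom h r \<in> Z" and x: "x \<in> C"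
    and act: "\<And>r. act (binom h r) x = sc (of_int (int_binomial a r)) x"
  shows "act (binom (h + of_int c) r) x = sc (of_int (int_binomial (a + c) r)) x"
proof -
  have hZ: "binom (h + of_int c) r \<in> Z" for c r
    by (intro binom_plus_of_int_addsub subrng_addsub Z bZ)
  show ?thesis
  proof (induction c arbitrary: r rule: int_induct[where k = 0])
    case (step1 c)
    show ?case
    proof (cases r)
      case (Suc r')
      have "binom (h + of_int (c + 1)) r = binom (h + of_int c) (Suc r') + binom (h + of_int c) r'"
        using binom_plus_1[of "h + of_int c" r'] Suc by (simp add: algebra_simps)
      moreover have "int_binomial (a + (c + 1)) r = int_binomial (a + c) (Suc r') + int_binomial (a + c) r'"
        using int_binomial_plus_1[of "a + c" r'] Suc by (simp add: algebra_simps)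
      ultimately show ?thesis
        using step1.IH x by (simp add: act_add_left hZ sc_add_left)
    qed (simp add: act_one sc_one x)
  next
    case (step2 c)
    show ?case
    proof (induction r)
      case (Suc r)
      have "binom (h + of_int (c - 1)) (Suc r) = binom (h + of_int c) (Suc r) - binom (h + of_int (c - 1)) r"
        using binom_plus_1[of "h + of_int (c - 1)" r] by (simp add: algebra_simps)
      moreover have "int_binomial (a + (c - 1)) (Suc r) = int_binomial (a + c) (Suc r) - int_binomial (a + (c - 1)) r"
        using int_binomial_plus_1[of "a + (c - 1)" r] by (simp add: algebra_simps)
      ultimately show ?case
        using step2.IH Suc act_diff_left[OF hZ[of c "Suc r"] hZ[of "c - 1" r] x] x
        by (simp only: sc_diff_left of_int_diff)
    qed (simp add: act_one sc_one x)
  qed (use act in simp)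
qed

lemma wt_shift:
  assumes v: "v \<in> wt mu" and kl: "k \<in> {1..m + n}" "l \<in> {1..m + n}" and Z: "divpow (E k l) s \<in> Z"
  shows "act (divpow (E k l) s) v \<in> wt (\<lambda>i. mu i + int s * (of_bool (i = k) - of_bool (i = l)))"
  unfolding wt_def
proof (intro CollectI conjI ballI allI)
  note C = wt_C[OF v]
  show "act (divpow (E k l) s) v \<in> C"
    using C Z by auto
  fix i r assume i: "i \<in> {1..m + n}"
  define c :: int where "c = int s * (of_bool (i = k) - of_bool (i = l))"
  have "binom (E i i) r * divpow (E k l) s = divpow (E k l) s * binom (E i i + of_int c) r"
    unfolding c_def by (intro binom_past_divpow diag_past i kl)
  moreover have "act (binom (E i i + of_int c) r) v = sc (of_int (int_binomial (mu i + c) r)) v"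
    using v i C by (intro act_binom_shift binom_diag_Z wt_act) auto
  ultimately show "act (binom (E i i) r) (act (divpow (E k l) s) v)
      = sc (of_int (int_binomial (mu i + int s * (of_bool (i = k) - of_bool (i = l))) r)) (act (divpow (E k l) s) v)"
    unfolding c_def[symmetric] using C Z i
    by (metis act_mult act_sc binom_diag_Z binom_diag_shift_Z)
qed

text \<open>All lowering operators, even and odd, strictly increase \<open>height\<close>.\<close>

definition height :: "(nat \<Rightarrow> int) \<Rightarrow> int" where
  "height mu = (\<Sum>i\<in>{1..m + n}. int i * mu i)"

definition low :: "int \<Rightarrow> 'v set" where
  "low d = addspan (\<Union>mu\<in>{mu. height mu > d}. wt mu)"

lemma height_shift:
  assumes "k \<in> {1..m + n}" "l \<in> {1..m + n}"
  shows "height (\<lambda>i. mu i + c * (of_bool (i = k) - of_bool (i = l))) = height mu + c * (int k - int l)"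
proof -
  have "(\<Sum>i\<in>{1..m + n}. int i * (c * (of_bool (i = k) - of_bool (i = l))))
    = (\<Sum>i\<in>{1..m + n}. if i = k then int k * c else 0) - (\<Sum>i\<in>{1..m + n}. if i = l then int l * c else 0)"
    unfolding sum_subtractf[symmetric] by (intro sum.cong refl) auto
  also have "\<dots> = c * (int k - int l)"
    using assms by (simp add: algebra_simps)
  finally show ?thesis
    unfolding height_def distrib_left sum.distrib by simp
qed

lemma low_addsub: "addsub (low d)"
  by (simp add: low_def addsub_addspan)

lemma wt_low: "v \<in> wt mu \<Longrightarrow> height mu > d \<Longrightarrow> v \<in> low d"
  unfolding low_def by (intro addspan.base) auto

lemma low_C: "low d \<subseteq> C"
  unfolding low_def by (intro addspan_subset C) (auto simp: wt_C)

lemma low_induct [consumes 1, case_names wt zero diff]: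
  assumes "x \<in> low d" "\<And>mu v. v \<in> wt mu \<Longrightarrow> height mu > d \<Longrightarrow> P v" "P 0"
    "\<And>x y. x \<in> low d \<Longrightarrow> y \<in> low d \<Longrightarrow> P x \<Longrightarrow> P y \<Longrightarrow> P (x - y)"
  shows "P x"
  using assms(1) unfolding low_def
  by (induction rule: addspan.induct) (use assms(2-4) in \<open>auto simp: low_def\<close>)

lemma low_sc: "x \<in> low d \<Longrightarrow> sc c x \<in> low d"
proof (induction rule: low_induct)
  case (diff x y)
  then show ?case using low_C by (auto simp: sc_diff_right subset_iff addsub_closed[OF low_addsub])
qed (auto simp: addsub_closed[OF low_addsub] intro: wt_low wt_sc)

lemma low_lower:
  assumes "x \<in> low d" "j < i" "i \<in> {1..m + n}" "j \<in> {1..m + n}" "divpow (E i j) s \<in> Z"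
  shows "act (divpow (E i j) s) x \<in> low d"
  using assms(1)
proof (induction rule: low_induct)
  case (wt mu v)
  have "int s * (int i - int j) \<ge> 0"
    using assms(2) by simp
  then have "height mu + int s * (int i - int j) > d"
    using wt(2) by linarith
  then show ?case
    using wt_shift[OF wt(1) assms(3-5)] height_shift[OF assms(3,4), of mu "int s"] wt_low by metis
next
  case (diff x y)
  then show ?case using low_C assms(5) by (auto simp: act_diff_right subset_iff addsub_closed[OF low_addsub])
qed (use assms in \<open>auto simp: addsub_closed[OF low_addsub]\<close>)

text \<open>The integral Cartan part acts on each weight space by a scalar; a product of
  differences \<open>binom (E i i) r - binom (mu i) r\<close> annihilates a given element of \<open>low (height lam)\<close>
  and is invertible on the weight space of \<open>lam\<close>.\<close>

lemma wt_inter_low: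
  assumes v: "v \<in> wt lam" "v \<in> low (height lam)"
  shows "v = 0"
proof -
  define T where "T = {u \<in> Z. \<forall>mu. \<exists>c. \<forall>v\<in>wt mu. act u v = sc c v}"
  have TZ: "u \<in> Z" if "u \<in> T" for u
    using that by (simp add: T_def)
  have one: "\<forall>v\<in>wt mu. act 1 v = sc 1 v" for mu
    by (simp add: act_one sc_one wt_C)
  then have T1: "1 \<in> T"
    unfolding T_def using Z_closed(1) by blast
  have Tmult: "u * w \<in> T" if uw: "u \<in> T" "w \<in> T" for u w
    unfolding T_def
  proof (intro CollectI conjI allI)
    show "u * w \<in> Z" using uw by (simp add: TZ Z_closed)
    fix mu
    obtain c d where "\<forall>v\<in>wt mu. act u v = sc c v" "\<forall>v\<in>wt mu. act w v = sc d v"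
      using uw unfolding T_def by blast
    then have "act (u * w) v = sc (d * c) v" if "v \<in> wt mu" for v
      using that TZ[OF uw(1)] TZ[OF uw(2)] wt_C[OF that] by (simp add: act_mult sc_mult act_sc)
    then show "\<exists>c. \<forall>v\<in>wt mu. act (u * w) v = sc c v" by blast
  qed
  have "\<exists>u\<in>T. (\<exists>c. c \<noteq> 0 \<and> (\<forall>v\<in>wt lam. act u v = sc c v)) \<and> (\<forall>t\<in>T. act u (act t x) = 0)"
    if "x \<in> low (height lam)" for x
    using that
  proof (induction rule: low_induct)
    case (wt mu v)
    then obtain i where i: "i \<in> {1..m + n}" "lam i \<noteq> mu i"
      unfolding height_def by (metis (no_types, lifting) less_irrefl sum.cong)
    then obtain r where r: "(of_int (int_binomial (lam i) r) :: 'f) \<noteq> of_int (int_binomial (mu i) r)"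
      using int_binomial_separates by blast
    define u where "u = binom (E i i) r - of_int (int_binomial (mu i) r)"
    have uZ: "u \<in> Z"
      unfolding u_def using binom_diag_Z[OF i(1)] by (simp add: Z_closed)
    have u: "act u v = sc (of_int (int_binomial (nu i) r) - of_int (int_binomial (mu i) r)) v"
      if "v \<in> wt nu" for v nu
      unfolding u_def using that i(1) binom_diag_Z[OF i(1)] Z_closed wt_C[OF that]
      by (simp add: act_diff_left act_of_int sc_diff_left wt_act)
    have "u \<in> T"
      unfolding T_def using uZ u by blast
    moreover have "act u (act t v) = 0" if "t \<in> T" for t
    proof -
      obtain c where "act t v = sc c v"
        using \<open>t \<in> T\<close> wt(1) unfolding T_def by blast
      then show ?thesis
        using u[OF wt_sc[OF wt(1)]] wt_C[OF wt(1)] by (simp add: sc_closed)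
    qed
    ultimately show ?case
      using u[of _ lam] r
      by (intro bexI[of _ u] conjI exI[of _ "of_int (int_binomial (lam i) r) - of_int (int_binomial (mu i) r)"]) auto
  next
    case zero
    have "act 1 (act t 0) = 0" if "t \<in> T" for t
      using that TZ Z_closed(1) by simp
    then show ?case
      using T1 one[of lam] zero_neq_one[where 'a = 'f] by metis
  next
    case (diff x y)
    then obtain u w c d where u: "u \<in> T" "c \<noteq> 0" "\<forall>v\<in>wt lam. act u v = sc c v" "\<forall>t\<in>T. act u (act t x) = 0"
      and w: "w \<in> T" "d \<noteq> 0" "\<forall>v\<in>wt lam. act w v = sc d v" "\<forall>t\<in>T. act w (act t y) = 0"
      by blast
    have C: "x \<in> C" "y \<in> C"
      using diff low_C by auto
    have "act (u * w) (act t (x - y)) = 0" if "t \<in> T" for t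
    proof -
      have "act (u * w) (act t (x - y)) = act u (act (w * t) x) - act u (act w (act t y))"
        using u(1) w(1) that TZ C C_closed
        by (simp add: act_mult act_diff_right act_closed)
      then show ?thesis
        using u w that Tmult TZ by simp
    qed
    moreover have "act (u * w) v = sc (d * c) v" if "v \<in> wt lam" for v
      using u(3) w(3) TZ[OF u(1)] TZ[OF w(1)] wt_C[OF that] that by (simp add: act_mult sc_mult act_sc)
    ultimately show ?case
      using u w Tmult by (intro bexI[of _ "u * w"] conjI exI[of _ "d * c"]) auto
  qed
  then obtain u c where u: "u \<in> T" "c \<noteq> 0" "act u v = sc c v" "act u (act 1 v) = 0"
    using v T1 by blast
  then have "sc c v = 0"
    using wt_C[OF v(1)] by (simp add: act_one)
  then show ?thesis
    using sc_inverse[OF wt_C[OF v(1)] u(2)] by simp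
qed

section \<open>Highest weight vectors\<close>

definition highest :: "(nat \<Rightarrow> int) \<Rightarrow> 'v \<Rightarrow> bool" where
  "highest lam v \<longleftrightarrow> v \<in> wt lam \<and> (\<forall>(i, j)\<in>I0 m n. \<forall>r\<ge>1. act (divpow (E i j) r) v = 0)"

inductive_set words for v where
  start: "v \<in> words v"
| lower: "x \<in> words v \<Longrightarrow> (i, Suc i) \<in> I0 m n \<Longrightarrow> act (divpow (E (Suc i) i) s) x \<in> words v"

definition cyclic :: "'v \<Rightarrow> 'v set" where
  "cyclic v = addspan {sc c x | c x. x \<in> words v}"

lemma simple_Z:
  assumes "(i, Suc i) \<in> I0 m n"
  shows "divpow (E i (Suc i)) r \<in> Z" "divpow (E (Suc i) i) r \<in> Z"
  using even_gensI(1,2)[OF assms] even_Z by auto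

lemma words_wt:
  assumes "v \<in> wt lam" "x \<in> words v"
  shows "\<exists>mu. x \<in> wt mu"
  using assms(2)
proof induction
  case (lower x i s)
  then show ?case
    using wt_shift[of x _ "Suc i" i s] I0_D[OF lower(2)] simple_Z[OF lower(2)] by blast
qed (use assms in blast)

lemma cyclic_addsub: "addsub (cyclic v)"
  by (simp add: cyclic_def addsub_addspan)

lemma cyclic_word: "x \<in> words v \<Longrightarrow> sc c x \<in> cyclic v"
  unfolding cyclic_def by (intro addspan.base) auto

lemma cyclic_induct [consumes 1, case_names word zero diff]:
  assumes "x \<in> cyclic v" "\<And>c x. x \<in> words v \<Longrightarrow> P (sc c x)" "P 0"
    "\<And>x y. x \<in> cyclic v \<Longrightarrow> y \<in> cyclic v \<Longrightarrow> P x \<Longrightarrow> P y \<Longrightarrow> P (x - y)"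
  shows "P x"
  using assms(1) unfolding cyclic_def
  by (induction rule: addspan.induct) (use assms(2-4) in \<open>auto simp: cyclic_def\<close>)

context
  fixes lam v assumes hw: "highest lam v"
begin

lemma hw_wt: "v \<in> wt lam"
  using hw by (simp add: highest_def)

lemma words_C: "x \<in> words v \<Longrightarrow> x \<in> C"
  using words_wt[OF hw_wt] wt_C by blast

lemma cyclic_C: "cyclic v \<subseteq> C"
  unfolding cyclic_def by (intro addspan_subset C) (auto simp: words_C)

lemma cyclic_self: "v \<in> cyclic v"
  using cyclic_word[OF words.start, of 1 v] sc_one[OF wt_C[OF hw_wt]] by simp

lemma cyclic_sc: "x \<in> cyclic v \<Longrightarrow> sc c x \<in> cyclic v"
proof (induction rule: cyclic_induct)
  case (word d x)
  then show ?case
    using cyclic_word[OF word, of "c * d"] by (simp add: sc_mult words_C)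
next
  case (diff x y)
  then show ?case using cyclic_C by (auto simp: sc_diff_right subset_iff addsub_closed[OF cyclic_addsub])
qed (simp add: addsub_closed[OF cyclic_addsub])

lemma cyclic_act:
  assumes "u \<in> Z" and words: "\<And>x. x \<in> words v \<Longrightarrow> act u x \<in> cyclic v" and "x \<in> cyclic v"
  shows "act u x \<in> cyclic v"
  using assms(3)
proof (induction rule: cyclic_induct)
  case (word d x)
  then show ?case
    using words[OF word] assms(1) by (simp add: act_sc words_C cyclic_sc)
next
  case (diff x y)
  then show ?case
    using cyclic_C assms(1) by (auto simp: act_diff_right subset_iff addsub_closed[OF cyclic_addsub])
qed (simp add: assms(1) addsub_closed[OF cyclic_addsub])

lemma cyclic_lower:
  assumes "(i, Suc i) \<in> I0 m n" "x \<in> cyclic v"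
  shows "act (divpow (E (Suc i) i) s) x \<in> cyclic v"
proof (rule cyclic_act[OF simple_Z(2)[OF assms(1)] _ assms(2)])
  fix x assume "x \<in> words v"
  then have "act (divpow (E (Suc i) i) s) x \<in> words v"
    using words.lower assms(1) by blast
  then show "act (divpow (E (Suc i) i) s) x \<in> cyclic v"
    using cyclic_word[of _ v 1] sc_one words_C by fastforce
qed

lemma cyclic_diag:
  assumes "i \<in> {1..m + n}" "x \<in> cyclic v"
  shows "act (binom (E i i) r) x \<in> cyclic v"
proof (rule cyclic_act[OF binom_diag_Z[OF assms(1)] _ assms(2)])
  fix x assume x: "x \<in> words v"
  then obtain mu where "x \<in> wt mu"
    using words_wt[OF hw_wt] by blast
  then show "act (binom (E i i) r) x \<in> cyclic v"
    using wt_act assms(1) cyclic_word[OF x] by simp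
qed

lemma cyclic_raise_word:
  assumes "x \<in> words v" "(i, Suc i) \<in> I0 m n"
  shows "act (divpow (E i (Suc i)) r) x \<in> cyclic v"
  using assms
proof (induction arbitrary: i r rule: words.induct)
  case start
  then show ?case
    using hw cyclic_self by (cases r) (auto simp: highest_def act_one words_C words.start addsub_closed[OF cyclic_addsub])
next
  case (lower x j s)
  note x = words_C[OF lower(1)]
  note eZ = simple_Z(1)[OF lower.prems] and fZ = simple_Z(2)[OF lower(2)]
  show ?case
  proof (cases "i = j")
    case False
    have "act (divpow (E i (Suc i)) r) (act (divpow (E (Suc j) j) s) x)
      = act (divpow (E (Suc j) j) s) (act (divpow (E i (Suc i)) r) x)"
      using simple_commute[OF lower.prems lower(2) False] eZ fZ x by (simp add: act_mult[symmetric])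
    then show ?thesis
      using lower cyclic_lower by simp
  next
    case True
    define b where "b t = (if t \<le> s then divpow (E (Suc i) i) (s - t) else 0)" for t
    define q where "q t = binom (E i i - E (Suc i) (Suc i) + of_int (2 * int t - int r - int s)) t" for t
    have st: "subrng {u \<in> Z. \<forall>x\<in>cyclic v. act u x \<in> cyclic v}"
      by (rule subrng_stab[OF cyclic_addsub cyclic_C])
    have d: "binom (E k k) r \<in> {u \<in> Z. \<forall>x\<in>cyclic v. act u x \<in> cyclic v}" if "k \<in> {1..m + n}" for k r
      using binom_diag_Z cyclic_diag that by blast
    have q: "q t \<in> {u \<in> Z. \<forall>x\<in>cyclic v. act u x \<in> cyclic v}" for t
      unfolding q_def using I0_D[OF lower.prems]
      by (intro binom_plus_of_int_addsub subrng_addsub st binom_diff_subrng d)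
        (use even_rel[of i i "Suc i" "Suc i"] in auto)
    have b: "b t \<in> {u \<in> Z. \<forall>x\<in>cyclic v. act u x \<in> cyclic v}" for t
      unfolding b_def using simple_Z(2) cyclic_lower lower.prems subrng_0[OF st] by auto
    have e: "act (divpow (E i (Suc i)) k) x \<in> cyclic v" for k
      using lower by blast
    have "act (divpow (E i (Suc i)) r) (act (divpow (E (Suc j) j) s) x)
      = act (\<Sum>t\<le>r. b t * q t * divpow (E i (Suc i)) (r - t)) x"
      using eZ fZ x True simple_sl2[OF lower.prems, of r s]
      by (simp add: act_mult[symmetric] b_def q_def)
    also have "\<dots> = (\<Sum>t\<le>r. act (b t) (act (q t) (act (divpow (E i (Suc i)) (r - t)) x)))"
      using b q simple_Z(1)[OF lower.prems] x
      by (subst act_sum) (simp_all add: Z_closed act_mult mult.assoc act_closed)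
    also have "\<dots> \<in> cyclic v"
      using b q e by (intro addsub_sum cyclic_addsub) auto
    finally show ?thesis .
  qed
qed

lemma cyclic_even_stable: "even_stable (cyclic v)"
proof -
  have "even_gens \<subseteq> {u \<in> Z. \<forall>x\<in>cyclic v. act u x \<in> cyclic v}"
  proof (rule simple_generation)
    show "subrng {u \<in> Z. \<forall>x\<in>cyclic v. act u x \<in> cyclic v}"
      by (rule subrng_stab[OF cyclic_addsub cyclic_C])
  qed (use simple_Z cyclic_act[OF simple_Z(1)] cyclic_raise_word cyclic_lower cyclic_diag binom_diag_Z in auto)
  then show ?thesis
    unfolding even_stable_def using cyclic_addsub cyclic_C cyclic_sc by blast
qed

lemma words_top: "x \<in> words v \<Longrightarrow> x = v \<or> x \<in> low (height lam)"
proof (induction rule: words.induct)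
  case (lower x i s)
  note i = I0_D[OF lower(2)] and Zf = simple_Z(2)[OF lower(2)]
  show ?case
  proof (cases "s = 0 \<or> x \<noteq> v")
    case True
    then show ?thesis
      using lower low_lower[of x "height lam" i "Suc i" s] i Zf act_one[OF words_C[OF lower(1)]] by auto
  next
    case False
    then have "act (divpow (E (Suc i) i) s) x
        \<in> wt (\<lambda>k. lam k + int s * (of_bool (k = Suc i) - of_bool (k = i)))"
      using wt_shift[OF hw_wt _ _ Zf] i by auto
    then show ?thesis
      using False wt_low height_shift[of "Suc i" i lam "int s"] i by fastforce
  qed
qed simp

lemma cyclic_top: "x \<in> cyclic v \<Longrightarrow> \<exists>c. x - sc c v \<in> low (height lam)"
proof (induction rule: cyclic_induct)
  case (word c x)
  then show ?case
  proof (cases "x = v")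
    case True
    then show ?thesis
      by (intro exI[of _ c]) (simp add: addsub_closed[OF low_addsub])
  next
    case False
    then show ?thesis
      using words_top[OF word] low_sc wt_C[OF hw_wt] by (intro exI[of _ 0]) auto
  qed
next
  case zero
  show ?case
    using wt_C[OF hw_wt] by (intro exI[of _ 0]) (simp add: addsub_closed[OF low_addsub])
next
  case (diff x y)
  then obtain c d where "x - sc c v \<in> low (height lam)" "y - sc d v \<in> low (height lam)" by blast
  then have "(x - sc c v) - (y - sc d v) \<in> low (height lam)"
    using addsub_diff low_addsub by blast
  then show ?case
    using wt_C[OF hw_wt] by (intro exI[of _ "c - d"]) (simp add: sc_diff_left algebra_simps)
qed

end

end

section \<open>The odd directions\<close>

context gl_relations
begin

definition lower_word :: "(nat \<times> nat) list \<Rightarrow> 'u" where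
  "lower_word bs = prod_list (map (\<lambda>(i, j). E j i) bs)"

lemma lower_word_simps [simp]:
  "lower_word [] = 1"
  "lower_word ((i, j) # bs) = E j i * lower_word bs"
  "lower_word (bs @ cs) = lower_word bs * lower_word cs"
  by (simp_all add: lower_word_def)

lemma lower_word_anticommute:
  assumes "(i, j) \<in> I1 m n" "set bs \<subseteq> I1 m n"
  shows "E j i * lower_word bs = lower_word bs * E j i \<or> E j i * lower_word bs = - (lower_word bs * E j i)"
  using assms(2)
proof (induction bs)
  case (Cons b bs)
  obtain k l where b: "b = (k, l)" by force
  have "E j i * E l k = - (E l k * E j i)"
    using lower_anticommute[OF assms(1), of k l] Cons.prems b by simp
  then have "E j i * lower_word (b # bs) = - (E l k * (E j i * lower_word bs))"
    unfolding b lower_word_simps mult.assoc[symmetric] by simp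
  then show ?case
    using Cons b by (auto simp: mult.assoc)
qed simp

lemma lower_word_mem:
  assumes "(i, j) \<in> set bs" "set bs \<subseteq> I1 m n"
  shows "E j i * lower_word bs = 0" "lower_word bs * E j i = 0"
proof -
  show *: "E j i * lower_word bs = 0"
    using assms
  proof (induction bs)
    case (Cons b bs)
    obtain k l where b: "b = (k, l)" by force
    have ij: "(i, j) \<in> I1 m n" using Cons.prems by auto
    show ?case
    proof (cases "(i, j) = (k, l)")
      case True
      then show ?thesis
        using odd_square[of j i] I1_D[OF ij] b by (simp add: mult.assoc[symmetric])
    next
      case False
      have "E j i * E l k = - (E l k * E j i)"
        using lower_anticommute[OF ij, of k l] Cons.prems b by simp
      then have "E j i * lower_word (b # bs) = - (E l k * (E j i * lower_word bs))"
        unfolding b lower_word_simps mult.assoc[symmetric] by simp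
      moreover have "(i, j) \<in> set bs"
        using Cons.prems b False by auto
      ultimately show ?thesis
        using Cons by simp
    qed
  qed simp
  show "lower_word bs * E j i = 0"
    using lower_word_anticommute[of i j bs] * assms by auto
qed

text \<open>If every bracket of \<open>e\<close> with a factor is a multiple of another factor, the product of these
  anticommuting square-zero factors commutes with \<open>e\<close>. The prefix \<open>xs\<close> makes the induction work.\<close>

lemma lower_word_commute_aux:
  assumes "set xs \<subseteq> I1 m n" "set bs \<subseteq> I1 m n"
    and "\<And>i j. (i, j) \<in> set bs \<Longrightarrow> \<exists>c k l. e * E j i = E j i * e + of_int c * E l k \<and>
      (c = 0 \<or> (k, l) \<in> set xs \<union> set bs - {(i, j)})"
  shows "lower_word xs * (e * lower_word bs - lower_word bs * e) = 0"
  using assms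
proof (induction bs arbitrary: xs)
  case (Cons b bs)
  obtain i j where b: "b = (i, j)" by force
  obtain c k l where c: "e * E j i = E j i * e + of_int c * E l k"
      "c = 0 \<or> (k, l) \<in> set xs \<union> set bs"
    using Cons.prems(3)[of i j] b by auto
  have "lower_word xs * (of_int c * E l k * lower_word bs) = of_int c * (lower_word xs * E l k * lower_word bs)"
    by (metis mult.assoc mult_of_int_commute)
  also have "c = 0 \<or> lower_word xs * E l k * lower_word bs = 0"
    using c(2) lower_word_mem(2)[of k l xs] lower_word_mem(1)[of k l bs] Cons.prems(1,2)
    by (cases "(k, l) \<in> set xs") (auto simp: mult.assoc)
  then have "of_int c * (lower_word xs * E l k * lower_word bs) = 0"
    by auto
  finally have 1: "lower_word xs * (of_int c * E l k * lower_word bs) = 0" .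
  have "lower_word (xs @ [b]) * (e * lower_word bs - lower_word bs * e) = 0"
  proof (rule Cons.IH)
    fix k l assume "(k, l) \<in> set bs"
    then show "\<exists>c i j. e * E l k = E l k * e + of_int c * E j i \<and>
        (c = 0 \<or> (i, j) \<in> set (xs @ [b]) \<union> set bs - {(k, l)})"
      using Cons.prems(3)[of k l] by auto
  qed (use Cons.prems b in auto)
  then have 2: "lower_word xs * (E j i * (e * lower_word bs - lower_word bs * e)) = 0"
    unfolding b by (simp add: mult.assoc)
  have "e * lower_word (b # bs) - lower_word (b # bs) * e
      = of_int c * E l k * lower_word bs + E j i * (e * lower_word bs - lower_word bs * e)"
    unfolding b lower_word_simps mult.assoc[symmetric] c(1)
    by (simp add: algebra_simps)
  then show ?case
    using 1 2 by (simp only: distrib_left add_0)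
qed simp

lemma even_bracket_lower:
  assumes e: "i \<in> {1..m + n}" "j \<in> {1..m + n}" "i \<noteq> j" "i \<le> m \<longleftrightarrow> j \<le> m" and ab: "(a, b) \<in> I1 m n"
  shows "\<exists>c k l. E i j * E b a = E b a * E i j + of_int c * E l k \<and>
    (c = 0 \<or> (k, l) \<in> I1 m n \<and> (k, l) \<noteq> (a, b) \<and> (k = a \<and> l = i \<and> j = b \<or> k = j \<and> l = b \<and> i = a))"
proof -
  note D = I1_D[OF ab]
  have rel: "E i j * E b a = E b a * E i j + ((if j = b then E i a else 0) - (if i = a then E b j else 0))"
    using even_rel[of i j b a] e D by auto
  consider "j = b" "i \<noteq> a" | "i = a" "j \<noteq> b" | "j \<noteq> b" "i \<noteq> a" | "j = b" "i = a" by blast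
  then show ?thesis
  proof cases
    case 1
    then have "(a, i) \<in> I1 m n" "(a, i) \<noteq> (a, b)"
      using e D by (auto simp: I1_def)
    then show ?thesis
      using 1 rel by (intro exI[of _ 1] exI[of _ a] exI[of _ i]) simp
  next
    case 2
    then have "(j, b) \<in> I1 m n" "(j, b) \<noteq> (a, b)"
      using e D by (auto simp: I1_def)
    then show ?thesis
      using 2 rel by (intro exI[of _ "- 1"] exI[of _ j] exI[of _ b]) simp
  next
    case 3
    then show ?thesis
      using rel by (intro exI[of _ 0]) simp
  next
    case 4
    then show ?thesis using e D by auto
  qed
qed

lemma lower_word_commute:
  assumes e: "i \<in> {1..m + n}" "j \<in> {1..m + n}" "i \<noteq> j" "i \<le> m \<longleftrightarrow> j \<le> m" and bs: "set bs \<subseteq> I1 m n"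
    and closed: "\<And>a b. (a, b) \<in> set bs \<Longrightarrow> j = b \<Longrightarrow> (a, i) \<in> I1 m n \<Longrightarrow> (a, i) \<in> set bs"
      "\<And>a b. (a, b) \<in> set bs \<Longrightarrow> i = a \<Longrightarrow> (j, b) \<in> I1 m n \<Longrightarrow> (j, b) \<in> set bs"
  shows "E i j * lower_word bs = lower_word bs * E i j"
proof -
  have "lower_word [] * (E i j * lower_word bs - lower_word bs * E i j) = 0"
  proof (rule lower_word_commute_aux)
    fix a b assume ab: "(a, b) \<in> set bs"
    then obtain c k l where c: "E i j * E b a = E b a * E i j + of_int c * E l k"
      "c = 0 \<or> (k, l) \<in> I1 m n \<and> (k, l) \<noteq> (a, b) \<and> (k = a \<and> l = i \<and> j = b \<or> k = j \<and> l = b \<and> i = a)"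
      using even_bracket_lower[OF e, of a b] bs by blast
    then have "c = 0 \<or> (k, l) \<in> set [] \<union> set bs - {(a, b)}"
      using closed[OF ab] by auto
    then show "\<exists>c k l. E i j * E b a = E b a * E i j + of_int c * E l k \<and>
        (c = 0 \<or> (k, l) \<in> set [] \<union> set bs - {(a, b)})"
      using c(1) by blast
  qed (use bs in auto)
  then show ?thesis by simp
qed

lemma lower_word_diag:
  assumes "set bs \<subseteq> I1 m n" "s \<in> {1..m + n}"
  shows "\<exists>c. E s s * lower_word bs = lower_word bs * (E s s + of_int c)"
  using assms(1)
proof (induction bs)
  case (Cons b bs)
  obtain i j where b: "b = (i, j)" by force
  obtain c where c: "E s s * lower_word bs = lower_word bs * (E s s + of_int c)"
    using Cons by auto
  define d :: int where "d = of_bool (s = j) - of_bool (s = i)"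
  have "E s s * E j i = E j i * (E s s + of_int d)"
    unfolding d_def using diag_past[of s j i] I1_D[of i j m n] assms(2) Cons.prems b by simp
  then have "E s s * lower_word (b # bs) = E j i * ((E s s + of_int d) * lower_word bs)"
    unfolding b lower_word_simps by (metis mult.assoc)
  also have "(E s s + of_int d) * lower_word bs = lower_word bs * (E s s + of_int (c + d))"
    unfolding distrib_right c mult_of_int_commute by (simp add: algebra_simps)
  finally show ?case
    unfolding b by (intro exI[of _ "c + d"]) (simp add: mult.assoc)
qed (auto intro: exI[of _ 0])

end

locale gl_supermodule = gl_module m n E Z C act sc
  for m n :: nat and E :: "nat \<Rightarrow> nat \<Rightarrow> 'u::rat_algebra" and Z :: "'u set"
    and C :: "'v::ab_group_add set" and act :: "'u \<Rightarrow> 'v \<Rightarrow> 'v" and sc :: "'f::field \<Rightarrow> 'v \<Rightarrow> 'v" +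
  assumes odd_Z: "\<And>i j. (i, j) \<in> I1 m n \<Longrightarrow> E i j \<in> Z" "\<And>i j. (i, j) \<in> I1 m n \<Longrightarrow> E j i \<in> Z"
begin

definition stable :: "'v set \<Rightarrow> bool" where
  "stable N \<longleftrightarrow> even_stable N \<and> (\<forall>(i, j)\<in>I1 m n. \<forall>x\<in>N. act (E i j) x \<in> N \<and> act (E j i) x \<in> N)"

lemma stableD:
  assumes "stable N"
  shows "even_stable N" "(i, j) \<in> I1 m n \<Longrightarrow> x \<in> N \<Longrightarrow> act (E i j) x \<in> N"
    "(i, j) \<in> I1 m n \<Longrightarrow> x \<in> N \<Longrightarrow> act (E j i) x \<in> N"
  using assms by (auto simp: stable_def)

definition killed :: "'v set" where
  "killed = {x \<in> C. \<forall>(i, j)\<in>I1 m n. act (E i j) x = 0}"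

lemma killedD: "x \<in> killed \<Longrightarrow> x \<in> C" "x \<in> killed \<Longrightarrow> (i, j) \<in> I1 m n \<Longrightarrow> act (E i j) x = 0"
  by (auto simp: killed_def)

lemma E_Z:
  assumes "i \<in> {1..m + n}" "j \<in> {1..m + n}"
  shows "E i j \<in> Z"
proof (cases "i \<le> m \<longleftrightarrow> j \<le> m")
  case True
  then show ?thesis using in_even_gens assms even_Z by blast
next
  case False
  then show ?thesis
    using odd_Z(1)[of i j] odd_Z(2)[of j i] I1_I assms by blast
qed

lemma killed_addsub: "addsub killed"
  unfolding addsub_def
proof (intro conjI ballI)
  fix x y assume "x \<in> killed" "y \<in> killed"
  then have "x \<in> C" "y \<in> C" "act (E i j) x = 0" "act (E i j) y = 0" if "(i, j) \<in> I1 m n" for i j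
    using killedD that by blast+
  then show "x - y \<in> killed"
    using \<open>x \<in> killed\<close> \<open>y \<in> killed\<close> odd_Z(1) C_closed(3) unfolding killed_def
    by (simp add: act_diff_right split_beta)
next
  show "0 \<in> killed"
    using odd_Z(1) by (auto simp: killed_def C_closed(1))
qed

lemma killed_even_stable: "even_stable killed"
  unfolding even_stable_def
proof (intro conjI ballI allI killed_addsub)
  show "killed \<subseteq> C" by (auto simp: killed_def)
  show "sc c x \<in> killed" if "x \<in> killed" for c x
    using that odd_Z(1) unfolding killed_def by (auto simp: act_sc)
  fix u x assume "u \<in> even_gens" and x: "x \<in> killed"
  from this(1) show "act u x \<in> killed"
  proof (cases rule: even_gens_cases)
    case (binom s r)
    have "act (E k l) (act (binom (E s s) r) x) = 0" if kl: "(k, l) \<in> I1 m n" for k l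
    proof -
      note k = I1_D[OF kl]
      define c :: int where "c = of_bool (s = k) - of_bool (s = l)"
      have "(E s s + of_int (- c)) * E k l = E k l * E s s"
        using diag_past[of s k l] binom k unfolding c_def[symmetric]
        by (simp add: left_diff_distrib distrib_left mult_of_int_commute)
      then have "E k l * binom (E s s) r = binom (E s s + of_int (- c)) r * E k l"
        using commute_binom by metis
      then have "act (E k l) (act (binom (E s s) r) x) = act (binom (E s s + of_int (- c)) r) (act (E k l) x)"
        using binom_diag_shift_Z[OF binom(2)] binom_diag_Z[OF binom(2)] odd_Z(1)[OF kl] killedD(1)[OF x]
        by (metis act_mult)
      then show ?thesis
        using killedD(2)[OF x kl] act_zero_right[OF binom_diag_shift_Z[OF binom(2)]] by metis
    qed
    then show ?thesis
      using binom killedD(1)[OF x] binom_diag_Z[OF binom(2)] by (auto simp: killed_def)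
  next
    case (divpow i j r)
    have "act (divpow (E i j) r) x \<in> killed"
    proof (induction r)
      case 0
      then show ?case using x killedD(1) act_one by simp
    next
      case (Suc r)
      note Zd = divpow_Z[OF divpow(2-5)]
      have "act (E k l) (act (divpow (E i j) (Suc r)) x) = 0" if kl: "(k, l) \<in> I1 m n" for k l
      proof -
        note k = I1_D[OF kl]
        define y where "y = (if j = k then E i l else 0) - (if i = l then E k j else 0)"
        have yZ: "y \<in> Z"
          unfolding y_def using divpow E_Z k by (auto simp: Z_closed)
        have "E i l \<in> Z \<and> act (E i l) (act (divpow (E i j) r) x) = 0" if "j = k"
          using that divpow k killedD(2)[OF Suc] odd_Z(1) I1_I by metis
        moreover have "E k j \<in> Z \<and> act (E k j) (act (divpow (E i j) r) x) = 0" if "i = l"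
          using that divpow k killedD(2)[OF Suc] odd_Z(1) I1_I by metis
        ultimately have y0: "act y (act (divpow (E i j) r) x) = 0"
          unfolding y_def using killedD(1)[OF Suc] by (auto simp: act_diff_left Z_closed)
        have "E k l * divpow (E i j) (Suc r) = divpow (E i j) (Suc r) * E k l - y * divpow (E i j) r"
          using divpow_even_past_odd[OF divpow(2-5), of k l r] k unfolding y_def by simp
        then have "act (E k l) (act (divpow (E i j) (Suc r)) x)
            = act (divpow (E i j) (Suc r)) (act (E k l) x) - act y (act (divpow (E i j) r) x)"
          using Zd odd_Z(1)[OF kl] killedD(1)[OF x] yZ
          by (simp add: act_mult[symmetric] act_diff_left[symmetric] Z_closed)
        then show ?thesis
          using y0 killedD(2)[OF x kl] Zd by simp
      qed
      then show ?case
        using killedD(1)[OF x] Zd by (auto simp: killed_def)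
    qed
    then show ?thesis using divpow by simp
  qed
qed

inductive_set odd_span for Y where
  base: "y \<in> Y \<Longrightarrow> y \<in> odd_span Y"
| lower: "x \<in> odd_span Y \<Longrightarrow> (i, j) \<in> I1 m n \<Longrightarrow> act (E j i) x \<in> odd_span Y"
| diff: "x \<in> odd_span Y \<Longrightarrow> y \<in> odd_span Y \<Longrightarrow> x - y \<in> odd_span Y"

context
  fixes Y assumes Y: "even_stable Y"
begin

lemma odd_span_C: "odd_span Y \<subseteq> C"
proof
  fix x assume "x \<in> odd_span Y"
  then show "x \<in> C"
    using even_stableD(2)[OF Y] odd_Z(2) by induction (auto simp: C_closed)
qed

lemma odd_span_addsub: "addsub (odd_span Y)"
  unfolding addsub_def using odd_span.base odd_span.diff even_stableD(1)[OF Y] addsub_0 by blast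

lemma odd_span_diag:
  assumes "x \<in> odd_span Y" "s \<in> {1..m + n}"
  shows "act (binom (E s s) r) x \<in> odd_span Y"
  using assms(1)
proof (induction arbitrary: r)
  case (base y)
  then show ?case
    using even_stableD(3)[OF Y even_gensI(3)[OF assms(2)]] odd_span.base by blast
next
  case (lower x i j)
  define c :: int where "c = of_bool (s = j) - of_bool (s = i)"
  have x: "x \<in> C" using lower odd_span_C by blast
  have "E s s * E j i = E j i * (E s s + of_int c)"
    unfolding c_def using diag_past[of s j i] I1_D[OF lower(2)] assms(2) by blast
  then have "binom (E s s) r * E j i = E j i * binom (E s s + of_int c) r"
    by (rule commute_binom)
  then have "act (binom (E s s) r) (act (E j i) x) = act (E j i) (act (binom (E s s + of_int c) r) x)"
    using binom_diag_shift_Z[OF assms(2)] binom_diag_Z[OF assms(2)] odd_Z(2)[OF lower(2)] x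
    by (metis act_mult)
  moreover have "binom (E s s + of_int c) r \<in> {u \<in> Z. act u x \<in> odd_span Y}"
    using lower.IH binom_diag_Z[OF assms(2)]
    by (intro binom_plus_of_int_addsub addsub_stab odd_span_addsub x) auto
  ultimately show ?case
    using odd_span.lower lower(2) by simp
next
  case (diff x y)
  then show ?case
    using odd_span_C binom_diag_Z[OF assms(2)] by (auto simp: act_diff_right subset_iff odd_span.diff)
qed

lemma odd_span_divpow:
  assumes "x \<in> odd_span Y" "i \<in> {1..m + n}" "j \<in> {1..m + n}" "i \<noteq> j" "i \<le> m \<longleftrightarrow> j \<le> m"
  shows "act (divpow (E i j) r) x \<in> odd_span Y"
  using assms(1)
proof (induction arbitrary: r)
  case (base y)
  then show ?case
    using even_stableD(3)[OF Y divpow_in_even_gens[OF assms(2-5)]] odd_span.base by blast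
next
  case (lower x a b)
  have x: "x \<in> C" using lower odd_span_C by blast
  note ab = I1_D[OF lower(2)] and Zd = divpow_Z[OF assms(2-5)]
  show ?case
  proof (cases r)
    case 0
    then show ?thesis
      using odd_span.lower[OF lower(1,2)] x odd_Z(2)[OF lower(2)] by (simp add: act_one act_closed)
  next
    case (Suc q)
    define y where "y = (if j = b then E i a else 0) - (if i = a then E b j else 0)"
    have yZ: "y \<in> Z"
      unfolding y_def using assms E_Z ab by (auto simp: Z_closed)
    have "act (E i a) (act (divpow (E i j) q) x) \<in> odd_span Y" if "j = b"
      using odd_span.lower[OF lower.IH] I1_I[of a m n i] assms ab that by simp
    moreover have "act (E b j) (act (divpow (E i j) q) x) \<in> odd_span Y" if "i = a"
      using odd_span.lower[OF lower.IH] I1_I[of j m n b] assms ab that by simp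
    ultimately have y: "act y (act (divpow (E i j) q) x) \<in> odd_span Y"
      unfolding y_def using Zd x E_Z ab assms
      by (auto simp: act_diff_left act_minus_left Z_closed act_closed addsub_closed[OF odd_span_addsub])
    have "divpow (E i j) (Suc q) * E b a = E b a * divpow (E i j) (Suc q) + y * divpow (E i j) q"
      unfolding y_def using divpow_even_past_odd[OF assms(2-5), of b a q] ab by simp
    then have "act (divpow (E i j) (Suc q)) (act (E b a) x)
        = act (E b a) (act (divpow (E i j) (Suc q)) x) + act y (act (divpow (E i j) q) x)"
      using Zd odd_Z(2)[OF lower(2)] x yZ
      by (simp add: act_mult[symmetric] act_add_left[symmetric] Z_closed)
    then show ?thesis
      using y odd_span.lower[OF lower.IH lower(2)] Suc by (simp add: addsub_closed[OF odd_span_addsub])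
  qed
next
  case (diff x y)
  then show ?case
    using odd_span_C divpow_Z[OF assms(2-5)] by (auto simp: act_diff_right subset_iff odd_span.diff)
qed

lemma odd_span_even:
  assumes "x \<in> odd_span Y" "i \<in> {1..m + n}" "j \<in> {1..m + n}" "i \<le> m \<longleftrightarrow> j \<le> m"
  shows "act (E i j) x \<in> odd_span Y"
  using odd_span_diag[OF assms(1,2), of 1] odd_span_divpow[OF assms(1-3) _ assms(4), of 1]
  by (cases "i = j") auto

lemma odd_span_sc: "x \<in> odd_span Y \<Longrightarrow> sc c x \<in> odd_span Y"
proof (induction rule: odd_span.induct)
  case (base y)
  then show ?case using even_stableD(4)[OF Y] odd_span.base by blast
next
  case (lower x i j)
  then show ?case
    using act_sc[OF odd_Z(2)] odd_span_C odd_span.lower by (metis subsetD)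
next
  case (diff x y)
  then show ?case
    using odd_span_C by (auto simp: sc_diff_right subset_iff odd_span.diff)
qed

lemma odd_span_raise:
  assumes kill: "Y \<subseteq> killed" and "x \<in> odd_span Y" "(i, j) \<in> I1 m n"
  shows "act (E i j) x \<in> odd_span Y"
  using assms(2)
proof induction
  case (base y)
  then show ?case
    using kill killedD(2)[OF _ assms(3)] addsub_0[OF odd_span_addsub] by (metis subsetD)
next
  case (lower x a b)
  have x: "x \<in> C" using lower odd_span_C by blast
  note ij = I1_D[OF assms(3)] and ab = I1_D[OF lower(2)]
  have "E i j * E b a = - (E b a * E i j) + ((if j = b then E i a else 0) + (if i = a then E b j else 0))"
    using odd_rel[of i j b a] ij ab by simp
  then have "act (E i j) (act (E b a) x) = - act (E b a) (act (E i j) x)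
      + ((if j = b then act (E i a) x else 0) + (if i = a then act (E b j) x else 0))"
    using x odd_Z assms(3) lower(2) E_Z ij ab
    by (simp add: act_mult[symmetric] act_add_left act_diff_left act_minus_left Z_closed)
  moreover have "act (E i a) x \<in> odd_span Y" "act (E b j) x \<in> odd_span Y"
    using odd_span_even[OF lower(1)] ij ab by auto
  ultimately show ?case
    using odd_span.lower[OF lower.IH lower(2)] by (auto simp: addsub_closed[OF odd_span_addsub])
next
  case (diff x y)
  then show ?case
    using odd_span_C odd_Z(1)[OF assms(3)] by (auto simp: act_diff_right subset_iff odd_span.diff)
qed

lemma odd_span_stable:
  assumes "Y \<subseteq> killed"
  shows "stable (odd_span Y)"
proof -
  have "act u x \<in> odd_span Y" if "u \<in> even_gens" "x \<in> odd_span Y" for u x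
    using that(1) by (cases rule: even_gens_cases) (use odd_span_diag odd_span_divpow that(2) in auto)
  then show ?thesis
    unfolding stable_def even_stable_def
    using odd_span_addsub odd_span_C odd_span_sc odd_span_raise[OF assms] odd_span.lower by blast
qed

lemma odd_span_low:
  assumes "Y \<subseteq> low d"
  shows "odd_span Y \<subseteq> low d"
proof
  fix x assume "x \<in> odd_span Y"
  then show "x \<in> low d"
  proof induction
    case (lower x i j)
    then show ?case
      using low_lower[of x d i j 1] I1_D[OF lower(2)] odd_Z(2)[OF lower(2)] by simp
  qed (use assms addsub_diff[OF low_addsub] in auto)
qed

end

end

section \<open>Comparison of simple highest weight modules\<close>

locale highest_pair =
  V0: gl_module m n E Z0 C0 act0 sc0 + V: gl_supermodule m n E Z C act sc
  for m n :: nat and E :: "nat \<Rightarrow> nat \<Rightarrow> 'u::rat_algebra"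
    and Z0 :: "'u set" and C0 :: "'x::ab_group_add set" and act0 :: "'u \<Rightarrow> 'x \<Rightarrow> 'x" and sc0 :: "'f::field \<Rightarrow> 'x \<Rightarrow> 'x"
    and Z :: "'u set" and C :: "'v::ab_group_add set" and act :: "'u \<Rightarrow> 'v \<Rightarrow> 'v" and sc :: "'f \<Rightarrow> 'v \<Rightarrow> 'v" +
  fixes lam :: "nat \<Rightarrow> int" and v0 :: 'x and v :: 'v
  assumes simple0: "\<And>N. V0.even_stable N \<Longrightarrow> N = {0} \<or> N = C0"
    and simple: "\<And>N. V.stable N \<Longrightarrow> N = {0} \<or> N = C"
    and hw0: "V0.highest lam v0" and hw: "V.highest lam v" "v \<in> V.killed"
    and nz: "v0 \<noteq> 0" "v \<noteq> 0"
begin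

definition pact :: "'u \<Rightarrow> 'x \<times> 'v \<Rightarrow> 'x \<times> 'v" where
  "pact u z = (act0 u (fst z), act u (snd z))"

definition psc :: "'f \<Rightarrow> 'x \<times> 'v \<Rightarrow> 'x \<times> 'v" where
  "psc c z = (sc0 c (fst z), sc c (snd z))"

sublocale P: gl_module m n E "Z0 \<inter> Z" "C0 \<times> C" pact psc
proof
  show "subrng (Z0 \<inter> Z)"
    using V0.Z V.Z by (auto simp: subrng_def)
  show "addsub (C0 \<times> C)"
    using V0.C V.C by (auto simp: addsub_def zero_prod_def)
  show "V0.even_gens \<subseteq> Z0 \<inter> Z"
    using V0.even_Z V.even_Z by auto
qed (auto simp: pact_def psc_def V0.act_add_left V.act_add_left V0.act_add_right V.act_add_right
    V0.act_mult V.act_mult V0.act_one V.act_one V0.sc_add_left V.sc_add_left V0.sc_add_right V.sc_add_right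
    V0.sc_mult V.sc_mult V0.sc_one V.sc_one V0.act_sc V.act_sc)

lemma pair_wt: "(x, y) \<in> P.wt mu \<longleftrightarrow> x \<in> V0.wt mu \<and> y \<in> V.wt mu"
  unfolding P.wt_def V0.wt_def V.wt_def pact_def psc_def by auto

lemma pair_low: "z \<in> P.low d \<Longrightarrow> fst z \<in> V0.low d \<and> snd z \<in> V.low d"
proof (induction rule: P.low_induct)
  case (wt mu z)
  then show ?case
    using pair_wt[of "fst z" "snd z" mu] V0.wt_low V.wt_low by (metis prod.collapse)
next
  case zero
  then show ?case
    using addsub_0[OF V0.low_addsub] addsub_0[OF V.low_addsub] by simp
next
  case (diff x y)
  then show ?case
    using addsub_diff[OF V0.low_addsub] addsub_diff[OF V.low_addsub] by simp
qed

lemma pair_highest: "P.highest lam (v0, v)"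
  using hw0 hw(1) pair_wt unfolding P.highest_def V0.highest_def V.highest_def pact_def
  by (auto simp: zero_prod_def)

abbreviation graph :: "('x \<times> 'v) set" where
  "graph \<equiv> P.cyclic (v0, v)"

lemmas graph_addsub = P.cyclic_addsub
lemmas graph_C = P.cyclic_C[OF pair_highest]
lemmas graph_even = P.even_stableD(3)[OF P.cyclic_even_stable[OF pair_highest]]
lemmas graph_sc = P.cyclic_sc[OF pair_highest]
lemmas graph_self = P.cyclic_self[OF pair_highest]
lemmas graph_top = P.cyclic_top[OF pair_highest]

lemma graph_killed: "z \<in> graph \<Longrightarrow> snd z \<in> V.killed"
proof (induction rule: P.cyclic_induct)
  case (word c z)
  then have "snd z \<in> V.killed"
  proof induction
    case start
    then show ?case using hw by simp
  next
    case (lower x i s)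
    then show ?case
      using V.even_stableD(3)[OF V.killed_even_stable V0.even_gensI(2)] by (simp add: pact_def)
  qed
  then show ?case
    using V.even_stableD(4)[OF V.killed_even_stable] by (simp add: psc_def)
next
  case zero
  then show ?case using addsub_0[OF V.killed_addsub] by simp
next
  case (diff x y)
  then show ?case using addsub_diff[OF V.killed_addsub] by simp
qed

text \<open>The fibre of \<open>graph\<close> over \<open>0\<close> consists of elements of height above \<open>lam\<close>, so the submodule it
  generates cannot contain \<open>v\<close>.\<close>

lemma graph_functional:
  assumes "(0, y) \<in> graph"
  shows "y = 0"
proof -
  define Y where "Y = {y. (0, y) \<in> graph}"
  have Y: "V.even_stable Y"
    unfolding V.even_stable_def
  proof (intro conjI ballI allI)
    show "addsub Y"
      using addsub_0[OF graph_addsub] addsub_diff[OF graph_addsub]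
      unfolding addsub_def Y_def by (fastforce simp: zero_prod_def)
    show "Y \<subseteq> C"
      using graph_C by (auto simp: Y_def)
    show "act u y \<in> Y" if "u \<in> V0.even_gens" "y \<in> Y" for u y
      using graph_even[of u "(0, y)"] that V0.even_Z by (auto simp: Y_def pact_def)
    show "sc c y \<in> Y" if "y \<in> Y" for c y
      using graph_sc[of "(0, y)" c] that by (auto simp: Y_def psc_def)
  qed
  have "Y \<subseteq> V.killed"
    using graph_killed by (fastforce simp: Y_def)
  note st = V.odd_span_stable[OF Y this]
  have "Y \<subseteq> V.low (P.height lam)"
  proof
    fix y assume "y \<in> Y"
    then obtain c where "(0, y) - psc c (v0, v) \<in> P.low (P.height lam)"
      using graph_top unfolding Y_def by blast
    then have c: "0 - sc0 c v0 \<in> V0.low (P.height lam)" "y - sc c v \<in> V.low (P.height lam)"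
      using pair_low by (fastforce simp: psc_def)+
    have v0: "v0 \<in> V0.wt lam"
      using hw0 by (simp add: V0.highest_def)
    have "sc0 c v0 \<in> V0.low (P.height lam)"
      using c(1) addsub_minus[OF V0.low_addsub] by fastforce
    then have "sc0 c v0 = 0"
      by (intro V0.wt_inter_low[of _ lam] V0.wt_sc v0)
    then have "c = 0"
      using V0.sc_eq_0[OF V0.wt_C[OF v0]] nz by blast
    then show "y \<in> V.low (P.height lam)"
      using c(2) V.sc_zero_left V.killedD(1)[OF hw(2)] by simp
  qed
  then have low: "V.odd_span Y \<subseteq> V.low (P.height lam)"
    by (rule V.odd_span_low[OF Y])
  have "v \<notin> V.odd_span Y"
    using V.wt_inter_low[of v lam] low nz hw(1) by (auto simp: V.highest_def)
  then have "V.odd_span Y = {0}"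
    using simple[OF st] V.killedD(1)[OF hw(2)] by blast
  then show ?thesis
    using V.odd_span.base[of y Y] assms by (auto simp: Y_def)
qed

lemma graph_total: "x \<in> C0 \<Longrightarrow> \<exists>y. (x, y) \<in> graph"
proof -
  define D where "D = fst ` graph"
  have "V0.even_stable D"
    unfolding V0.even_stable_def
  proof (intro conjI ballI allI)
    show "addsub D"
      unfolding addsub_def D_def
    proof (intro conjI ballI)
      show "0 \<in> fst ` graph"
        by (rule image_eqI[OF _ addsub_0[OF graph_addsub]]) simp
      fix x y assume "x \<in> fst ` graph" "y \<in> fst ` graph"
      then obtain x' y' where "x = fst x'" "x' \<in> graph" "y = fst y'" "y' \<in> graph"
        by blast
      then show "x - y \<in> fst ` graph"
        by (intro image_eqI[of _ _ "x' - y'"] addsub_diff[OF graph_addsub]) auto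
    qed
    show "D \<subseteq> C0"
      using graph_C by (auto simp: D_def)
    show "act0 u x \<in> D" if "u \<in> V0.even_gens" "x \<in> D" for u x
      using graph_even[of u] that by (force simp: D_def pact_def)
    show "sc0 c x \<in> D" if "x \<in> D" for c x
      using graph_sc[of _ c] that by (force simp: D_def psc_def)
  qed
  moreover have "v0 \<in> D"
    using graph_self by (force simp: D_def)
  ultimately have "D = C0"
    using simple0 nz by blast
  then show "x \<in> C0 \<Longrightarrow> \<exists>y. (x, y) \<in> graph"
    by (force simp: D_def)
qed

lemma even_hom_exists:
  "\<exists>g. (\<forall>x\<in>C0. g x \<in> V.killed) \<and> (\<forall>x\<in>C0. \<forall>y\<in>C0. g (x + y) = g x + g y) \<and>
    (\<forall>x\<in>C0. \<forall>u\<in>V0.even_gens. g (act0 u x) = act u (g x)) \<and>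
    (\<forall>x\<in>C0. \<forall>c. g (sc0 c x) = sc c (g x)) \<and> g v0 = v"
proof -
  obtain g where g: "\<And>x. x \<in> C0 \<Longrightarrow> (x, g x) \<in> graph"
    using graph_total by metis
  have uniq: "g x = y" if "(x, y) \<in> graph" for x y
  proof -
    have "(x, g x) - (x, y) \<in> graph"
      using g that graph_C by (intro addsub_diff[OF graph_addsub]) auto
    then show ?thesis
      using graph_functional by fastforce
  qed
  show ?thesis
  proof (intro exI[of _ g] conjI ballI allI uniq)
    show "g x \<in> V.killed" if "x \<in> C0" for x
      using graph_killed[OF g[OF that]] by simp
    show "(x + y, g x + g y) \<in> graph" if "x \<in> C0" "y \<in> C0" for x y
      using addsub_add[OF graph_addsub g[OF that(1)] g[OF that(2)]] by simp
    show "(act0 u x, act u (g x)) \<in> graph" if "x \<in> C0" "u \<in> V0.even_gens" for x u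
      using graph_even[OF that(2) g[OF that(1)]] by (simp add: pact_def)
    show "(sc0 c x, sc c (g x)) \<in> graph" if "x \<in> C0" for x c
      using graph_sc[OF g[OF that]] by (simp add: psc_def)
    show "(v0, v) \<in> graph" by (rule graph_self)
  qed
qed

end

section \<open>Typical induced modules\<close>

context gl_supermodule
begin

text \<open>\<open>good bs\<close>: each initial segment (read from the right) of \<open>bs\<close> is closed under \<open>(a, b) \<mapsto> (a', b')\<close>
  with \<open>a' \<ge> a\<close> and \<open>b' \<le> b\<close>. This is the order in which odd reflections lead from the distinguished
  Borel subalgebra to the opposite one.\<close>

definition order_closed :: "(nat \<times> nat) set \<Rightarrow> bool" where
  "order_closed S \<longleftrightarrow> S \<subseteq> I1 m n \<and> (\<forall>(a, b)\<in>S. \<forall>(a', b')\<in>I1 m n. a \<le> a' \<and> b' \<le> b \<longrightarrow> (a', b') \<in> S)"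

lemma order_closedD: "order_closed S \<Longrightarrow> (a, b) \<in> S \<Longrightarrow> (a', b') \<in> I1 m n \<Longrightarrow> a \<le> a' \<Longrightarrow> b' \<le> b \<Longrightarrow> (a', b') \<in> S"
  unfolding order_closed_def by blast

fun good :: "(nat \<times> nat) list \<Rightarrow> bool" where
  "good [] \<longleftrightarrow> True"
| "good (b # bs) \<longleftrightarrow> good bs \<and> b \<notin> set bs \<and> order_closed (set (b # bs))"

lemma good_order_closed: "good bs \<Longrightarrow> order_closed (set bs)"
  by (cases bs) (auto simp: order_closed_def)

lemma good_I1: "good bs \<Longrightarrow> set bs \<subseteq> I1 m n"
  using good_order_closed by (auto simp: order_closed_def)

lemma finite_I1: "finite (I1 m n)"
  by (rule finite_subset[of _ "{..m + n} \<times> {..m + n}"]) (auto simp: I1_def)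

lemma good_exists: "order_closed S \<Longrightarrow> \<exists>bs. good bs \<and> set bs = S"
proof (induction "card S" arbitrary: S)
  case 0
  then have "S = {}"
    using finite_subset[OF _ finite_I1] by (auto simp: order_closed_def)
  then show ?case by (intro exI[of _ "[]"]) simp
next
  case (Suc k)
  have fin: "finite S"
    using Suc.prems finite_subset[OF _ finite_I1] by (auto simp: order_closed_def)
  define key where "key = (\<lambda>(a, b). int b - int a)"
  have "S \<noteq> {}" using Suc by auto
  then obtain x where x: "x \<in> S" "\<forall>y\<in>S. key y \<le> key x"
    using fin Max_in[of "key ` S"] Max_ge[of "key ` S"] by (metis (no_types, lifting) finite_imageI image_iff image_is_empty)
  obtain i j where ij: "x = (i, j)" by force
  have "(a', b') \<in> S - {x}"
    if "(a, b) \<in> S - {x}" "(a', b') \<in> I1 m n" "a \<le> a'" "b' \<le> b" for a b a' b'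
  proof -
    have "(a', b') \<in> S"
      using order_closedD[OF Suc.prems, of a b a' b'] that by auto
    moreover have "(a', b') \<noteq> x"
      using x(2) that ij by (fastforce simp: key_def)
    ultimately show ?thesis by simp
  qed
  then have "order_closed (S - {x})"
    using Suc.prems unfolding order_closed_def by blast
  moreover have "k = card (S - {x})"
    using Suc(2) x(1) fin by simp
  ultimately obtain bs where "good bs" "set bs = S - {x}"
    using Suc(1) by blast
  then show ?case
    using Suc.prems x(1) by (intro exI[of _ "x # bs"]) (auto simp: insert_absorb)
qed

lemma lower_word_Z: "set bs \<subseteq> I1 m n \<Longrightarrow> lower_word bs \<in> Z"
proof (induction bs)
  case (Cons b bs)
  then show ?case by (cases b) (auto simp: Z_closed odd_Z)
qed (simp add: Z_closed)

definition raise_word :: "(nat \<times> nat) list \<Rightarrow> 'u" where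
  "raise_word bs = prod_list (map (\<lambda>(i, j). E i j) (rev bs))"

lemma raise_word_simps [simp]:
  "raise_word [] = 1"
  "raise_word ((i, j) # bs) = raise_word bs * E i j"
  by (simp_all add: raise_word_def)

lemma raise_word_Z: "set bs \<subseteq> I1 m n \<Longrightarrow> raise_word bs \<in> Z"
proof (induction bs)
  case (Cons b bs)
  then show ?case by (cases b) (auto simp: Z_closed odd_Z)
qed (simp add: Z_closed)

context
  fixes lam v assumes hw: "highest lam v" and vk: "v \<in> killed"
begin

lemma v_C: "v \<in> C"
  using vk by (simp add: killed_def)

lemma good_C: "good bs \<Longrightarrow> act (lower_word bs) v \<in> C"
  using lower_word_Z good_I1 v_C by blast

lemma good_raise_even:
  assumes "good bs" "(i, j) \<in> I0 m n"
  shows "act (E i j) (act (lower_word bs) v) = 0"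
proof -
  note ij = I0_D[OF assms(2)]
  have "E i j * lower_word bs = lower_word bs * E i j"
    using order_closedD[OF good_order_closed[OF assms(1)]] ij
    by (intro lower_word_commute good_I1 assms(1)) fastforce+
  moreover have "act (E i j) v = 0"
    using hw assms(2) unfolding highest_def by (metis (mono_tags, lifting) case_prodD divpow_1 One_nat_def le_refl)
  ultimately show ?thesis
    using E_Z[of i j] lower_word_Z[OF good_I1[OF assms(1)]] ij v_C by (metis act_mult act_zero_right)
qed

lemma good_raise_odd:
  assumes "good bs" "(i, j) \<in> I1 m n" "(i, j) \<notin> set bs"
  shows "act (E i j) (act (lower_word bs) v) = 0"
  using assms(1,3)
proof (induction bs)
  case Nil
  then show ?case using killedD[OF vk] assms(2) by (simp add: act_one)
next
  case (Cons x bs)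
  obtain a b where x: "x = (a, b)" by force
  have good: "good bs" and ab: "(a, b) \<in> I1 m n" and cl: "order_closed (set (x # bs))"
    using Cons.prems good_I1[OF Cons.prems(1)] x by auto
  define w where "w = act (lower_word bs) v"
  have w: "w \<in> C" unfolding w_def by (rule good_C[OF good])
  note ij = I1_D[OF assms(2)] and D = I1_D[OF ab]
  have IH: "act (E i j) w = 0"
    unfolding w_def using Cons by simp
  have "E i j * E b a = - (E b a * E i j) + ((if j = b then E i a else 0) + (if i = a then E b j else 0))"
    using odd_rel[of i j b a] ij D by simp
  then have "act (E i j) (act (E b a) w) = - act (E b a) (act (E i j) w)
      + ((if j = b then act (E i a) w else 0) + (if i = a then act (E b j) w else 0))"
    using w odd_Z assms(2) ab E_Z ij D
    by (simp add: act_mult[symmetric] act_add_left act_diff_left act_minus_left Z_closed)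
  moreover have "act (E i a) w = 0" if "j = b"
  proof -
    have "\<not> a \<le> i"
      using order_closedD[OF cl, of a b i j] Cons.prems(2) assms(2) that x by auto
    then show ?thesis
      unfolding w_def using ij D by (intro good_raise_even[OF good] I0_I) auto
  qed
  moreover have "act (E b j) w = 0" if "i = a"
  proof -
    have "\<not> j \<le> b"
      using order_closedD[OF cl, of a b i j] Cons.prems(2) assms(2) that x by auto
    then show ?thesis
      unfolding w_def using ij D by (intro good_raise_even[OF good] I0_I) auto
  qed
  ultimately have "act (E i j) (act (E b a) w) = 0"
    using IH odd_Z(2)[OF ab] by simp
  then show ?case
    using x w_def odd_Z(2)[OF ab] lower_word_Z[OF good_I1[OF good]] v_C by (simp add: act_mult)
qed

lemma good_wt:
  assumes "good bs"
  shows "act (lower_word bs) v \<in> wt (\<lambda>k. lam k + int (card {x \<in> set bs. snd x = k}) - int (card {x \<in> set bs. fst x = k}))"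
  using assms
proof (induction bs)
  case Nil
  then show ?case
    using hw by (simp add: act_one v_C highest_def)
next
  case (Cons x bs)
  obtain a b where x: "x = (a, b)" by force
  have good: "good bs" and ab: "(a, b) \<in> I1 m n" and nin: "(a, b) \<notin> set bs"
    using Cons.prems good_I1[OF Cons.prems(1)] x by auto
  define mu where "mu = (\<lambda>k. lam k + int (card {x \<in> set bs. snd x = k}) - int (card {x \<in> set bs. fst x = k}))"
  have "act (divpow (E b a) 1) (act (lower_word bs) v)
      \<in> wt (\<lambda>k. mu k + int 1 * (of_bool (k = b) - of_bool (k = a)))"
    using Cons good I1_D[OF ab] odd_Z(2)[OF ab] unfolding mu_def by (intro wt_shift) auto
  moreover have "mu k + int 1 * (of_bool (k = b) - of_bool (k = a))
      = lam k + int (card {y \<in> set (x # bs). snd y = k}) - int (card {y \<in> set (x # bs). fst y = k})" for k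
  proof -
    have "{y \<in> set (x # bs). snd y = k} = (if k = b then insert x else id) {y \<in> set bs. snd y = k}"
      "{y \<in> set (x # bs). fst y = k} = (if k = a then insert x else id) {y \<in> set bs. fst y = k}"
      by (auto simp: x)
    then show ?thesis
      using nin x I1_D[OF ab] by (auto simp: mu_def)
  qed
  ultimately show ?case
    using x odd_Z(2)[OF ab] lower_word_Z[OF good_I1[OF good]] v_C by (simp add: act_mult)
qed

lemma good_step:
  assumes good: "good ((i, j) # bs)"
  shows "act (E i j) (act (E j i) (act (lower_word bs) v))
    = sc (of_int (lam i + lam j + 2 * int m + 1 - int i - int j)) (act (lower_word bs) v)"
proof -
  have g: "good bs" and ij: "(i, j) \<in> I1 m n" and nin: "(i, j) \<notin> set bs" and cl: "order_closed (set ((i, j) # bs))"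
    using assms good_I1[OF assms] by auto
  note D = I1_D[OF ij]
  define w where "w = act (lower_word bs) v"
  define mu where "mu = (\<lambda>k. lam k + int (card {x \<in> set bs. snd x = k}) - int (card {x \<in> set bs. fst x = k}))"
  have w: "w \<in> C" "w \<in> wt mu"
    unfolding w_def mu_def using good_C[OF g] good_wt[OF g] by auto
  have I1: "set bs \<subseteq> I1 m n" by (rule good_I1[OF g])
  have fi: "{x \<in> set bs. fst x = i} = Pair i ` {m + 1..<j}"
  proof (intro equalityI subsetI)
    fix x assume "x \<in> {x \<in> set bs. fst x = i}"
    then obtain b where b: "x = (i, b)" "(i, b) \<in> set bs" by (cases x) auto
    then have "\<not> j \<le> b"
      using order_closedD[OF good_order_closed[OF g], of i b i j] nin ij by auto
    then show "x \<in> Pair i ` {m + 1..<j}"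
      using b I1 by (auto simp: I1_def)
  next
    fix x assume "x \<in> Pair i ` {m + 1..<j}"
    then obtain b where b: "x = (i, b)" "m < b" "b < j" by auto
    then have "(i, b) \<in> set ((i, j) # bs)"
      using order_closedD[OF cl, of i j i b] D by (auto simp: I1_def)
    then show "x \<in> {x \<in> set bs. fst x = i}"
      using b by auto
  qed
  have sj: "{x \<in> set bs. snd x = j} = (\<lambda>a. (a, j)) ` {i + 1..m}"
  proof (intro equalityI subsetI)
    fix x assume "x \<in> {x \<in> set bs. snd x = j}"
    then obtain a where a: "x = (a, j)" "(a, j) \<in> set bs" by (cases x) auto
    then have "\<not> a \<le> i"
      using order_closedD[OF good_order_closed[OF g], of a j i j] nin ij by auto
    then show "x \<in> (\<lambda>a. (a, j)) ` {i + 1..m}"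
      using a I1 by (auto simp: I1_def)
  next
    fix x assume "x \<in> (\<lambda>a. (a, j)) ` {i + 1..m}"
    then obtain a where a: "x = (a, j)" "i < a" "a \<le> m" by auto
    then have "(a, j) \<in> set ((i, j) # bs)"
      using order_closedD[OF cl, of i j a j] D by (auto simp: I1_def)
    then show "x \<in> {x \<in> set bs. snd x = j}"
      using a by auto
  qed
  have si: "{x \<in> set bs. snd x = i} = {}" and fj: "{x \<in> set bs. fst x = j} = {}"
    using I1 D by (auto simp: I1_def)
  have mu: "mu i + mu j = lam i + lam j + 2 * int m + 1 - int i - int j"
    unfolding mu_def fi sj si fj using D
    by (simp add: card_image inj_on_def of_nat_diff)
  have "E i j * E j i = - (E j i * E i j) + (E i i + E j j)"
    using odd_rel[of i j j i] D by simp
  then have "act (E i j) (act (E j i) w) = - act (E j i) (act (E i j) w) + (act (E i i) w + act (E j j) w)"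
    using w odd_Z ij E_Z D
    by (simp add: act_mult[symmetric] act_add_left act_diff_left act_minus_left Z_closed)
  also have "act (E i j) w = 0"
    unfolding w_def by (rule good_raise_odd[OF g ij nin])
  also have "act (E i i) w + act (E j j) w = sc (of_int (mu i + mu j)) w"
    using wt_diag[OF w(2)] D w by (simp add: sc_add_left)
  finally show ?thesis
    unfolding w_def[symmetric] mu using odd_Z(2)[OF ij] by simp
qed

lemma raise_lower_word:
  assumes "good bs"
  shows "act (raise_word bs) (act (lower_word bs) v)
    = sc (of_int (\<Prod>(i, j)\<in>set bs. lam i + lam j + 2 * int m + 1 - int i - int j)) v"
  using assms
proof (induction bs)
  case Nil
  then show ?case by (simp add: act_one sc_one v_C)
next
  case (Cons x bs)
  obtain i j where x: "x = (i, j)" by force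
  have g: "good bs" and ij: "(i, j) \<in> I1 m n" and nin: "x \<notin> set bs"
    using Cons.prems good_I1[OF Cons.prems] x by auto
  note I1 = good_I1[OF g]
  define c where "c = lam i + lam j + 2 * int m + 1 - int i - int j"
  define w where "w = act (lower_word bs) v"
  have w: "w \<in> C" unfolding w_def by (rule good_C[OF g])
  have "act (raise_word (x # bs)) (act (lower_word (x # bs)) v)
      = act (raise_word bs) (act (E i j) (act (E j i) w))"
    unfolding w_def x using raise_word_Z[OF I1] lower_word_Z[OF I1] odd_Z[OF ij] v_C
    by (simp add: act_mult Z_closed act_closed)
  also have "act (E i j) (act (E j i) w) = sc (of_int c) w"
    unfolding w_def c_def using good_step Cons.prems x by blast
  also have "act (raise_word bs) (sc (of_int c) w) = sc (of_int c) (act (raise_word bs) w)"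
    using raise_word_Z[OF I1] w by (rule act_sc)
  also have "\<dots> = sc (of_int (\<Prod>(i, j)\<in>set (x # bs). lam i + lam j + 2 * int m + 1 - int i - int j)) v"
    unfolding w_def using Cons g nin v_C x by (simp add: c_def sc_mult)
  finally show ?case .
qed

end

fun chain :: "'v set \<Rightarrow> (nat \<times> nat) list \<Rightarrow> 'v set" where
  "chain Y [] = Y"
| "chain Y (b # bs) = {x + act (E (snd b) (fst b)) y | x y. x \<in> chain Y bs \<and> y \<in> chain Y bs}"

context
  fixes Y assumes Y: "even_stable Y"
begin

lemma chain_C: "set bs \<subseteq> I1 m n \<Longrightarrow> chain Y bs \<subseteq> C"
proof (induction bs)
  case (Cons b bs)
  then have "chain Y bs \<subseteq> C" "E (snd b) (fst b) \<in> Z"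
    using odd_Z(2)[of "fst b" "snd b"] by auto
  then show ?case
    by (auto intro!: C_closed(2) act_closed)
qed (use even_stableD(2)[OF Y] in simp)

lemma chain_addsub: "set bs \<subseteq> I1 m n \<Longrightarrow> addsub (chain Y bs)"
proof (induction bs)
  case (Cons b bs)
  have b: "E (snd b) (fst b) \<in> Z"
    using Cons.prems odd_Z(2) by (cases b) auto
  have sub: "chain Y bs \<subseteq> C" and add: "addsub (chain Y bs)"
    using chain_C Cons by auto
  show ?case
    unfolding addsub_def
  proof (intro conjI ballI)
    have "0 = 0 + act (E (snd b) (fst b)) 0" using b by simp
    then show "0 \<in> chain Y (b # bs)"
      unfolding chain.simps using addsub_0[OF add] by blast
    fix x y assume "x \<in> chain Y (b # bs)" "y \<in> chain Y (b # bs)"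
    then obtain p q p' q' where pq: "x = p + act (E (snd b) (fst b)) q" "y = p' + act (E (snd b) (fst b)) q'"
      "p \<in> chain Y bs" "q \<in> chain Y bs" "p' \<in> chain Y bs" "q' \<in> chain Y bs" by auto
    then have "x - y = (p - p') + act (E (snd b) (fst b)) (q - q')"
      using b sub by (simp add: act_diff_right subset_iff)
    then show "x - y \<in> chain Y (b # bs)"
      unfolding chain.simps using pq addsub_diff[OF add] by blast
  qed
qed (use even_stableD(1)[OF Y] in simp)

lemma chain_mono: "set bs \<subseteq> I1 m n \<Longrightarrow> x \<in> chain Y bs \<Longrightarrow> x \<in> chain Y (b # bs)"
  if "b \<in> I1 m n"
proof -
  assume *: "set bs \<subseteq> I1 m n" "x \<in> chain Y bs"
  have "x = x + act (E (snd b) (fst b)) 0"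
    using odd_Z(2)[of "fst b" "snd b"] that by simp
  then show ?thesis
    unfolding chain.simps using * addsub_0[OF chain_addsub[OF *(1)]] by blast
qed

lemma chain_base: "set bs \<subseteq> I1 m n \<Longrightarrow> Y \<subseteq> chain Y bs"
proof (induction bs)
  case (Cons b bs)
  then show ?case using chain_mono[of b bs] by auto
qed simp

lemma chain_lower:
  assumes "set bs \<subseteq> I1 m n" "(i, j) \<in> set bs" "x \<in> chain Y bs"
  shows "act (E j i) x \<in> chain Y bs"
  using assms
proof (induction bs arbitrary: x)
  case (Cons b bs)
  obtain k l where b: "b = (k, l)" by force
  then obtain p q where pq: "x = p + act (E l k) q" "p \<in> chain Y bs" "q \<in> chain Y bs"
    using Cons.prems(3) by auto
  have kl: "(k, l) \<in> I1 m n" and ij: "(i, j) \<in> I1 m n" and I1: "set bs \<subseteq> I1 m n"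
    using Cons.prems b by auto
  have C: "p \<in> C" "q \<in> C" using pq chain_C[OF I1] by auto
  note Zs = odd_Z(2)[OF kl] odd_Z(2)[OF ij]
  show ?case
  proof (cases "(i, j) = (k, l)")
    case True
    have "act (E j i) (act (E l k) q) = 0"
      using odd_square[of l k] I1_D[OF kl] True Zs C by (simp add: act_mult[symmetric])
    then have "act (E j i) x = 0 + act (E l k) p"
      using pq Zs C True by (simp add: act_add_right act_closed)
    then show ?thesis
      unfolding chain.simps b fst_conv snd_conv using pq addsub_0[OF chain_addsub[OF I1]] by blast
  next
    case False
    then have ijs: "(i, j) \<in> set bs" using Cons.prems b by auto
    have "act (E j i) (act (E l k) q) = - act (E l k) (act (E j i) q)"
      using lower_anticommute[OF ij kl] Zs C
      by (simp add: act_mult[symmetric] act_minus_left[symmetric] Z_closed)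
    then have "act (E j i) x = act (E j i) p + act (E l k) (- act (E j i) q)"
      using pq Zs C act_diff_right[of "E l k" 0 "act (E j i) q"]
      by (simp add: act_add_right act_closed C_closed)
    moreover have "act (E j i) p \<in> chain Y bs" "- act (E j i) q \<in> chain Y bs"
      using Cons.IH[OF I1 ijs] pq addsub_minus[OF chain_addsub[OF I1]] by auto
    ultimately show ?thesis
      unfolding chain.simps b fst_conv snd_conv by blast
  qed
qed simp

lemma chain_reach_top:
  assumes "set bs \<subseteq> I1 m n" "w \<in> chain Y bs" "w \<noteq> 0"
  shows "\<exists>cs y. set cs \<subseteq> I1 m n \<and> y \<in> Y \<and> y \<noteq> 0 \<and> act (lower_word cs) w = act (lower_word bs) y"
  using assms
proof (induction bs arbitrary: w)
  case Nil
  then show ?case by (intro exI[of _ "[]"] exI[of _ w]) simp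
next
  case (Cons b bs)
  obtain k l where b: "b = (k, l)" by force
  then obtain p q where pq: "w = p + act (E l k) q" "p \<in> chain Y bs" "q \<in> chain Y bs"
    using Cons.prems(2) by auto
  have kl: "(k, l) \<in> I1 m n" and I1: "set bs \<subseteq> I1 m n"
    using Cons.prems b by auto
  have C: "p \<in> C" "q \<in> C" using pq chain_C[OF I1] by auto
  note Zf = odd_Z(2)[OF kl]
  have past: "\<exists>y\<in>Y. y \<noteq> 0 \<and> act (lower_word cs) (act (E l k) z) = act (lower_word (b # bs)) y"
    if cs: "set cs \<subseteq> I1 m n" and y: "y \<in> Y" "y \<noteq> 0" and z: "z \<in> C" "act (lower_word cs) z = act (lower_word bs) y" for cs y z
  proof -
    have yC: "y \<in> C" using y even_stableD(2)[OF Y] by auto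
    note Zs = Zf lower_word_Z[OF cs] lower_word_Z[OF I1]
    have *: "act (E l k) (act (lower_word cs) z) = act (lower_word (b # bs)) y"
      using z yC Zs b by (simp add: act_mult)
    consider "lower_word cs * E l k = E l k * lower_word cs" | "lower_word cs * E l k = - (E l k * lower_word cs)"
      using lower_word_anticommute[OF kl cs] by (metis minus_minus)
    then show ?thesis
    proof cases
      case 1
      then have "act (lower_word cs) (act (E l k) z) = act (lower_word (b # bs)) y"
        using * Zs z(1) by (metis act_mult)
      then show ?thesis using y by blast
    next
      case 2
      then have "act (lower_word cs) (act (E l k) z) = - act (E l k) (act (lower_word cs) z)"
        using Zs z(1) by (simp add: act_mult[symmetric] act_minus_left[symmetric] Z_closed)
      also have "\<dots> = act (lower_word (b # bs)) (- y)"
        using * act_diff_right[of "lower_word (b # bs)" 0 y] yC lower_word_Z[OF Cons.prems(1)] by (simp add: C_closed)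
      finally show ?thesis
        using y addsub_minus[OF even_stableD(1)[OF Y]] by (intro bexI[of _ "- y"]) auto
    qed
  qed
  show ?case
  proof (cases "p = 0")
    case True
    then have "q \<noteq> 0" using pq Cons.prems(3) Zf by auto
    then obtain cs y where cs: "set cs \<subseteq> I1 m n" "y \<in> Y" "y \<noteq> 0" "act (lower_word cs) q = act (lower_word bs) y"
      using Cons.IH[OF I1 pq(3)] by blast
    then show ?thesis
      using past[OF cs(1-3) C(2) cs(4)] True pq(1) by auto
  next
    case False
    then obtain cs y where cs: "set cs \<subseteq> I1 m n" "y \<in> Y" "y \<noteq> 0" "act (lower_word cs) p = act (lower_word bs) y"
      using Cons.IH[OF I1 pq(2)] by blast
    have "act (E l k) (act (E l k) q) = 0"
      using odd_square[of l k] I1_D[OF kl] Zf C by (simp add: act_mult[symmetric])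
    then have "act (E l k) w = act (E l k) p"
      using pq(1) Zf C by (simp add: act_add_right act_closed)
    then have "act (lower_word (cs @ [(k, l)])) w = act (lower_word cs) (act (E l k) p)"
      using Zf lower_word_Z[OF cs(1)] chain_C[OF Cons.prems(1)] Cons.prems(2) by (simp add: act_mult subset_iff)
    then show ?thesis
      using past[OF cs(1-3) C(1) cs(4)] cs(1) kl by (intro exI[of _ "cs @ [(k, l)]"]) auto
  qed
qed

theorem typical_submodule:
  assumes kill: "Y \<subseteq> killed" and gen: "\<And>N. stable N \<Longrightarrow> Y \<subseteq> N \<Longrightarrow> N = C"
    and simple: "\<And>N. even_stable N \<Longrightarrow> N \<subseteq> Y \<Longrightarrow> N = {0} \<or> N = Y"
    and v: "v \<in> Y" "highest lam v"
    and nz: "of_int (\<Prod>(i, j)\<in>I1 m n. lam i + lam j + 2 * int m + 1 - int i - int j) \<noteq> (0 :: 'f)"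
    and N: "stable N" "N \<noteq> {0}"
  shows "v \<in> N"
proof -
  note Ne = stableD(1)[OF N(1)]
  note NC = even_stableD(2)[OF Ne] and Na = even_stableD(1)[OF Ne]
  have "order_closed (I1 m n)" by (auto simp: order_closed_def)
  then obtain bs where bs: "good bs" "set bs = I1 m n"
    using good_exists by blast
  define F where "F = lower_word bs"
  have FZ: "F \<in> Z" unfolding F_def using lower_word_Z bs by simp
  have Fl: "lower_word cs \<in> Z" "x \<in> N \<Longrightarrow> act (lower_word cs) x \<in> N" if "set cs \<subseteq> I1 m n" for cs x
  proof -
    show "lower_word cs \<in> Z" using lower_word_Z that by simp
    show "x \<in> N \<Longrightarrow> act (lower_word cs) x \<in> N"
      using that
    proof (induction cs)
      case (Cons b cs)
      obtain i j where b: "b = (i, j)" by force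
      have "act (lower_word (b # cs)) x = act (E j i) (act (lower_word cs) x)"
        using Cons.prems b lower_word_Z[of cs] odd_Z(2)[of i j] NC by (auto simp: act_mult)
      then show ?case
        using Cons b stableD(3)[OF N(1)] by auto
    qed (use NC act_one in auto)
  qed
  have "odd_span Y = C"
    using gen[OF odd_span_stable[OF Y kill]] odd_span.base by blast
  moreover have "odd_span Y \<subseteq> chain Y bs"
  proof
    fix x assume "x \<in> odd_span Y"
    then show "x \<in> chain Y bs"
    proof induction
      case (base y)
      then show ?case using chain_base bs by auto
    next
      case (lower x i j)
      then show ?case using chain_lower[of bs i j x] bs by auto
    next
      case (diff x y)
      then show ?case using addsub_diff[OF chain_addsub] bs by auto
    qed
  qed
  ultimately have C: "chain Y bs = C"
    using chain_C bs by auto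
  obtain w where w: "w \<in> N" "w \<noteq> 0"
    using N(2) addsub_0[OF Na] by blast
  then have "w \<in> chain Y bs"
    using NC C by auto
  then obtain cs y where y: "set cs \<subseteq> I1 m n" "y \<in> Y" "y \<noteq> 0" "act (lower_word cs) w = act F y"
    using chain_reach_top[OF _ _ w(2), of bs] bs unfolding F_def by auto
  define W where "W = {y \<in> Y. act F y \<in> N}"
  note YC = even_stableD(2)[OF Y]
  have "even_stable W"
    unfolding even_stable_def
  proof (intro conjI ballI allI)
    show "addsub W"
      unfolding addsub_def W_def using FZ YC addsub_closed[OF Na] addsub_closed[OF even_stableD(1)[OF Y]]
      by (auto simp: act_diff_right subset_iff)
    show "W \<subseteq> C" using YC by (auto simp: W_def)
    show "sc c y \<in> W" if "y \<in> W" for c y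
      using that FZ YC even_stableD(4)[OF Y] even_stableD(4)[OF Ne] unfolding W_def
      by (auto simp: act_sc subset_iff)
    fix u y assume u: "u \<in> even_gens" and y: "y \<in> W"
    have yC: "y \<in> C" and yY: "y \<in> Y" and FyN: "act F y \<in> N"
      using y YC by (auto simp: W_def)
    have uZ: "u \<in> Z" using u even_Z by blast
    have "act F (act u y) \<in> N"
      using u
    proof (cases rule: even_gens_cases)
      case (divpow i j r)
      have "E i j * F = F * E i j"
        unfolding F_def using bs by (intro lower_word_commute divpow) auto
      then have "u * F = F * u"
        using commute_divpow divpow by blast
      then have "act F (act u y) = act u (act F y)"
        using uZ FZ yC by (metis act_mult)
      then show ?thesis
        using even_stableD(3)[OF Ne u FyN] by simp
    next
      case (binom s r)
      obtain c where c: "E s s * F = F * (E s s + of_int c)"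
        unfolding F_def using lower_word_diag[of bs s] bs binom by auto
      have "(E s s + of_int (- c)) * F = F * E s s"
        unfolding distrib_right c by (simp add: distrib_left mult_of_int_commute)
      then have "binom (E s s + of_int (- c)) r * F = F * u"
        using commute_binom binom by metis
      then have "act F (act u y) = act (binom (E s s + of_int (- c)) r) (act F y)"
        using uZ FZ yC binom_diag_shift_Z[OF binom(2)] by (metis act_mult)
      moreover have "binom (E s s + of_int (- c)) r \<in> {u \<in> Z. \<forall>x\<in>N. act u x \<in> N}"
        using even_stableD(3)[OF Ne even_gensI(3)[OF binom(2)]] binom_diag_Z[OF binom(2)]
        by (intro binom_plus_of_int_addsub subrng_addsub subrng_stab Na NC) auto
      ultimately show ?thesis
        using FyN by simp
    qed
    then show "act u y \<in> W"
      using even_stableD(3)[OF Y u yY] by (simp add: W_def)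
  qed
  moreover have "y \<in> W"
    using y Fl(2)[OF y(1) w(1)] by (simp add: W_def)
  ultimately have "W = Y"
    using simple[of W] y(3) by (auto simp: W_def)
  then have FvN: "act F v \<in> N"
    using v(1) by (auto simp: W_def)
  have vk: "v \<in> killed" using v kill by auto
  define c where "c = (of_int (\<Prod>(i, j)\<in>I1 m n. lam i + lam j + 2 * int m + 1 - int i - int j) :: 'f)"
  have "act (raise_word cs) x \<in> N" if "set cs \<subseteq> I1 m n" "x \<in> N" for cs x
    using that
  proof (induction cs arbitrary: x)
    case (Cons b cs)
    obtain i j where b: "b = (i, j)" by force
    have "act (raise_word (b # cs)) x = act (raise_word cs) (act (E i j) x)"
      using Cons.prems b raise_word_Z[of cs] odd_Z(1)[of i j] NC
      by (auto simp: act_mult)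
    then show ?case
      using Cons b stableD(2)[OF N(1)] by auto
  qed (use NC act_one in auto)
  then have "sc c v \<in> N"
    using raise_lower_word[OF v(2) vk bs(1)] FvN bs(2) unfolding F_def c_def by (metis order_refl)
  then have "sc (inverse c) (sc c v) \<in> N"
    using even_stableD(4)[OF Ne] by blast
  then show ?thesis
    using sc_inverse[of v c] nz YC v(1) unfolding c_def by auto
qed

end

end

section \<open>Monoid algebras and tensor products of rings\<close>

lemma monoid_algebra_simps [simp]:
  "carrier (monoid_algebra M) = {f. Poly_Mapping.keys f \<subseteq> carrier M}"
  "\<one>\<^bsub>monoid_algebra M\<^esub> = Poly_Mapping.single \<one>\<^bsub>M\<^esub> 1"
  "\<zero>\<^bsub>monoid_algebra M\<^esub> = 0"
  "f \<oplus>\<^bsub>monoid_algebra M\<^esub> g = f + g"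
  by (simp_all add: monoid_algebra_def)

lemma monoid_algebra_mult:
  assumes "finite A" "Poly_Mapping.keys f \<subseteq> A" "finite B" "Poly_Mapping.keys g \<subseteq> B"
  shows "f \<otimes>\<^bsub>monoid_algebra M\<^esub> g = (\<Sum>x\<in>A. \<Sum>y\<in>B.
    Poly_Mapping.single (x \<otimes>\<^bsub>M\<^esub> y) (Poly_Mapping.lookup f x * Poly_Mapping.lookup g y))"
proof -
  have "f \<otimes>\<^bsub>monoid_algebra M\<^esub> g = (\<Sum>x\<in>Poly_Mapping.keys f. \<Sum>y\<in>B.
    Poly_Mapping.single (x \<otimes>\<^bsub>M\<^esub> y) (Poly_Mapping.lookup f x * Poly_Mapping.lookup g y))"
    unfolding monoid_algebra_def monoid.simps using assms
    by (intro sum.cong refl sum.mono_neutral_left) (auto simp: in_keys_iff)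
  also have "\<dots> = (\<Sum>x\<in>A. \<Sum>y\<in>B.
    Poly_Mapping.single (x \<otimes>\<^bsub>M\<^esub> y) (Poly_Mapping.lookup f x * Poly_Mapping.lookup g y))"
    using assms by (intro sum.mono_neutral_left) (auto simp: in_keys_iff)
  finally show ?thesis .
qed

lemma monoid_algebra_mult_single [simp]:
  "Poly_Mapping.single x a \<otimes>\<^bsub>monoid_algebra M\<^esub> Poly_Mapping.single y b
    = Poly_Mapping.single (x \<otimes>\<^bsub>M\<^esub> y) (a * b)"
  by (subst monoid_algebra_mult[of "{x}" _ "{y}"]) auto

lemma monoid_algebra_distrib:
  "(f + g) \<otimes>\<^bsub>monoid_algebra M\<^esub> h = f \<otimes>\<^bsub>monoid_algebra M\<^esub> h + g \<otimes>\<^bsub>monoid_algebra M\<^esub> h"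
  "h \<otimes>\<^bsub>monoid_algebra M\<^esub> (f + g) = h \<otimes>\<^bsub>monoid_algebra M\<^esub> f + h \<otimes>\<^bsub>monoid_algebra M\<^esub> g"
proof -
  define A where "A = Poly_Mapping.keys f \<union> Poly_Mapping.keys g"
  have A: "finite A" "Poly_Mapping.keys f \<subseteq> A" "Poly_Mapping.keys g \<subseteq> A" "Poly_Mapping.keys (f + g) \<subseteq> A"
    using keys_add[of f g] by (auto simp: A_def)
  note mult = monoid_algebra_mult[of A _ "Poly_Mapping.keys h" h M]
    monoid_algebra_mult[of "Poly_Mapping.keys h" h A _ M]
  show "(f + g) \<otimes>\<^bsub>monoid_algebra M\<^esub> h = f \<otimes>\<^bsub>monoid_algebra M\<^esub> h + g \<otimes>\<^bsub>monoid_algebra M\<^esub> h"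
    "h \<otimes>\<^bsub>monoid_algebra M\<^esub> (f + g) = h \<otimes>\<^bsub>monoid_algebra M\<^esub> f + h \<otimes>\<^bsub>monoid_algebra M\<^esub> g"
    using A by (simp_all add: mult lookup_add distrib_left distrib_right single_add sum.distrib)
qed

lemma poly_mapping_induct_keys [consumes 1, case_names zero add]:
  fixes f :: "'a \<Rightarrow>\<^sub>0 'b::comm_monoid_add"
  assumes "Poly_Mapping.keys f \<subseteq> S" and "P 0"
    and "\<And>x a g. x \<in> S \<Longrightarrow> Poly_Mapping.keys g \<subseteq> S \<Longrightarrow> P g \<Longrightarrow> P (Poly_Mapping.single x a + g)"
  shows "P f"
proof -
  have "f = (\<Sum>x\<in>Poly_Mapping.keys f. Poly_Mapping.single x (Poly_Mapping.lookup f x))"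
    by (rule poly_mapping_eqI) (simp add: lookup_sum lookup_single when_def in_keys_iff)
  moreover have "P (\<Sum>x\<in>A. Poly_Mapping.single x (Poly_Mapping.lookup f x)) \<and>
      Poly_Mapping.keys (\<Sum>x\<in>A. Poly_Mapping.single x (Poly_Mapping.lookup f x)) \<subseteq> S"
    if "finite A" "A \<subseteq> Poly_Mapping.keys f" for A
    using that
  proof (induction A)
    case (insert x A)
    have "Poly_Mapping.keys (Poly_Mapping.single x (Poly_Mapping.lookup f x)
        + (\<Sum>x\<in>A. Poly_Mapping.single x (Poly_Mapping.lookup f x))) \<subseteq> S"
      using insert assms(1) by (intro order.trans[OF keys_add]) auto
    then show ?case
      using insert assms(1) by (auto intro!: assms(3))
  qed (simp add: assms)
  ultimately show ?thesis
    by (metis finite_keys order_refl)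
qed

lemma monoid_algebra_mult_zero [simp]:
  "0 \<otimes>\<^bsub>monoid_algebra M\<^esub> f = 0" "f \<otimes>\<^bsub>monoid_algebra M\<^esub> 0 = 0"
  by (simp_all add: monoid_algebra_def)

lemma ring_monoid_algebra:
  assumes "Group.monoid M"
  shows "ring (monoid_algebra M :: ('a \<Rightarrow>\<^sub>0 'k::comm_ring_1) ring)"
proof -
  interpret monoid M by fact
  let ?A = "monoid_algebra M :: ('a \<Rightarrow>\<^sub>0 'k) ring"
  have closed: "Poly_Mapping.keys (f \<otimes>\<^bsub>?A\<^esub> g) \<subseteq> carrier M"
    if "Poly_Mapping.keys f \<subseteq> carrier M" "Poly_Mapping.keys g \<subseteq> carrier M" for f g
    using that(1)
  proof (induction rule: poly_mapping_induct_keys)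
    case (add x a f)
    have "Poly_Mapping.keys (Poly_Mapping.single x a \<otimes>\<^bsub>?A\<^esub> g) \<subseteq> carrier M"
      using that(2)
    proof (induction rule: poly_mapping_induct_keys)
      case (add y b g)
      then show ?case
        unfolding monoid_algebra_distrib using \<open>x \<in> carrier M\<close>
        by (intro order.trans[OF keys_add]) (auto split: if_splits)
    qed simp
    then show ?case
      unfolding monoid_algebra_distrib using add by (intro order.trans[OF keys_add]) auto
  qed simp
  have assoc: "f \<otimes>\<^bsub>?A\<^esub> g \<otimes>\<^bsub>?A\<^esub> h = f \<otimes>\<^bsub>?A\<^esub> (g \<otimes>\<^bsub>?A\<^esub> h)"
    if "Poly_Mapping.keys f \<subseteq> carrier M" "Poly_Mapping.keys g \<subseteq> carrier M" "Poly_Mapping.keys h \<subseteq> carrier M"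
    for f g h
    using that(1)
  proof (induction rule: poly_mapping_induct_keys)
    case (add x a f)
    note x = add(1)
    have "Poly_Mapping.single x a \<otimes>\<^bsub>?A\<^esub> g \<otimes>\<^bsub>?A\<^esub> h = Poly_Mapping.single x a \<otimes>\<^bsub>?A\<^esub> (g \<otimes>\<^bsub>?A\<^esub> h)"
      using that(2)
    proof (induction rule: poly_mapping_induct_keys)
      case (add y b g)
      note y = add(1)
      have "Poly_Mapping.single x a \<otimes>\<^bsub>?A\<^esub> Poly_Mapping.single y b \<otimes>\<^bsub>?A\<^esub> h
          = Poly_Mapping.single x a \<otimes>\<^bsub>?A\<^esub> (Poly_Mapping.single y b \<otimes>\<^bsub>?A\<^esub> h)"
        using that(3) by (induction rule: poly_mapping_induct_keys)
          (simp_all add: monoid_algebra_distrib x y m_assoc mult.assoc)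
      then show ?case
        using add by (simp only: monoid_algebra_distrib)
    qed simp
    then show ?case
      using add by (simp only: monoid_algebra_distrib)
  qed simp
  have one: "Poly_Mapping.single \<one>\<^bsub>M\<^esub> 1 \<otimes>\<^bsub>?A\<^esub> f = f \<and> f \<otimes>\<^bsub>?A\<^esub> Poly_Mapping.single \<one>\<^bsub>M\<^esub> 1 = f"
    if "Poly_Mapping.keys f \<subseteq> carrier M" for f
    using that by (induction rule: poly_mapping_induct_keys) (simp_all add: monoid_algebra_distrib)
  show ?thesis
  proof (rule ringI)
    show "abelian_group ?A"
    proof (rule abelian_groupI)
      show "\<exists>g\<in>carrier ?A. g \<oplus>\<^bsub>?A\<^esub> f = \<zero>\<^bsub>?A\<^esub>" if "f \<in> carrier ?A" for f
        using that by (intro bexI[of _ "- f"]) (auto simp: in_keys_iff)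
    qed (use keys_add in \<open>fastforce simp: algebra_simps\<close>)+
    show "Group.monoid ?A"
      by (rule monoidI) (use closed assoc one in auto)
  qed (simp_all add: monoid_algebra_distrib)
qed

lemma monoid_algebra_uminus:
  fixes f :: "'a \<Rightarrow>\<^sub>0 'k::comm_ring_1"
  assumes "Group.monoid M" "f \<in> carrier (monoid_algebra M)"
  shows "\<ominus>\<^bsub>monoid_algebra M\<^esub> f = - f"
proof -
  interpret ring "monoid_algebra M :: ('a \<Rightarrow>\<^sub>0 'k) ring"
    using assms(1) by (rule ring_monoid_algebra)
  have "- f \<in> carrier (monoid_algebra M)"
    using assms(2) by (auto simp: in_keys_iff)
  then show ?thesis
    using minus_unique[of "- f" f] minus_equality[of "- f" f] assms(2) by simp
qed

lemma (in ideal) coset_eq: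
  assumes "x \<in> carrier R" "y \<in> carrier R" "x \<ominus> y \<in> I"
  shows "I +> x = I +> y"
proof -
  have "x = (x \<ominus> y) \<oplus> y" using assms(1,2) by algebra
  then have "I +> x = (I +> (x \<ominus> y)) \<oplus>\<^bsub>R Quot I\<^esub> (I +> y)"
    using ring_hom_add[OF rcos_ring_hom, of "x \<ominus> y" y] assms by simp
  also have "I +> (x \<ominus> y) = \<zero>\<^bsub>R Quot I\<^esub>"
    using a_rcos_const[OF assms(3)] by (simp add: FactRing_def)
  finally show ?thesis
    using ring.ring_simprules(8)[OF quotient_is_ring] ring_hom_closed[OF rcos_ring_hom assms(2)] by simp
qed

lemma (in ideal) quotient_carrier: "carrier (R Quot I) = (\<lambda>x. I +> x) ` carrier R"
  by (auto simp: FactRing_def A_RCOSETS_def')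

locale tensor_of_rings = R: ring R + S: ring S
  for R :: "('a, 'c) ring_scheme" and S :: "('b, 'd) ring_scheme"
begin

abbreviation "F \<equiv> (monoid_algebra (R \<times>\<times> S) :: ('a \<times> 'b \<Rightarrow>\<^sub>0 int) ring)"

lemma monoid_pairs: "Group.monoid (R \<times>\<times> S)"
  by (intro DirProd_monoid R.monoid_axioms S.monoid_axioms)

sublocale F: ring F
  by (rule ring_monoid_algebra[OF monoid_pairs])

lemma frag_of_F: "x \<in> carrier R \<Longrightarrow> a \<in> carrier S \<Longrightarrow> frag_of (x, a) \<in> carrier F"
  by (simp add: DirProd_def)

lemma F_diff: "f \<in> carrier F \<Longrightarrow> g \<in> carrier F \<Longrightarrow> f \<ominus>\<^bsub>F\<^esub> g = f - g"
  unfolding F.minus_eq by (simp add: monoid_algebra_uminus[OF monoid_pairs])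

lemma F_diff_closed: "f \<in> carrier F \<Longrightarrow> g \<in> carrier F \<Longrightarrow> f - g \<in> carrier F"
  using F_diff F.minus_closed by metis

lemma relators: "tensor_relators R S \<subseteq> carrier F"
  unfolding tensor_relators_def by (auto intro!: F_diff_closed simp only: frag_of_F R.add.m_closed S.add.m_closed)

lemma ideal_tensor_ideal: "ideal (tensor_ideal R S) F"
  unfolding tensor_ideal_def by (rule F.genideal_ideal[OF relators])

sublocale I: ideal "tensor_ideal R S" F
  by (rule ideal_tensor_ideal)

lemma relators_mem: "tensor_relators R S \<subseteq> tensor_ideal R S"
  unfolding tensor_ideal_def by (rule F.genideal_self[OF relators])

sublocale T: ring "ring_tensor R S"
  unfolding ring_tensor_def by (rule I.quotient_is_ring)

lemma coset_hom: "(\<lambda>f. tensor_ideal R S +>\<^bsub>F\<^esub> f) \<in> ring_hom F (ring_tensor R S)"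
  unfolding ring_tensor_def by (rule I.rcos_ring_hom)

lemma pure_closed [simp]: "x \<in> carrier R \<Longrightarrow> a \<in> carrier S \<Longrightarrow> pure_tensor R S x a \<in> carrier (ring_tensor R S)"
  unfolding pure_tensor_def by (intro ring_hom_closed[OF coset_hom] frag_of_F)

lemma pure_mult:
  assumes "x \<in> carrier R" "y \<in> carrier R" "a \<in> carrier S" "b \<in> carrier S"
  shows "pure_tensor R S x a \<otimes>\<^bsub>ring_tensor R S\<^esub> pure_tensor R S y b
    = pure_tensor R S (x \<otimes>\<^bsub>R\<^esub> y) (a \<otimes>\<^bsub>S\<^esub> b)"
  unfolding pure_tensor_def using assms
  by (subst ring_hom_mult[OF coset_hom, symmetric]) (simp_all add: frag_of_F DirProd_def)

lemma pure_one: "\<one>\<^bsub>ring_tensor R S\<^esub> = pure_tensor R S \<one>\<^bsub>R\<^esub> \<one>\<^bsub>S\<^esub>"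
  unfolding pure_tensor_def using ring_hom_one[OF coset_hom] by (simp add: DirProd_def)

lemma pure_add_left:
  assumes "x \<in> carrier R" "y \<in> carrier R" "a \<in> carrier S"
  shows "pure_tensor R S (x \<oplus>\<^bsub>R\<^esub> y) a = pure_tensor R S x a \<oplus>\<^bsub>ring_tensor R S\<^esub> pure_tensor R S y a"
proof -
  have "frag_of (x \<oplus>\<^bsub>R\<^esub> y, a) - frag_of (x, a) - frag_of (y, a) \<in> tensor_relators R S"
    unfolding tensor_relators_def using assms by blast
  then have "frag_of (x \<oplus>\<^bsub>R\<^esub> y, a) - (frag_of (x, a) + frag_of (y, a)) \<in> tensor_ideal R S"
    using relators_mem by (auto simp: algebra_simps)
  moreover have c: "frag_of (x, a) + frag_of (y, a) \<in> carrier F"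
    using F.add.m_closed frag_of_F assms by fastforce
  ultimately have "pure_tensor R S (x \<oplus>\<^bsub>R\<^esub> y) a = tensor_ideal R S +>\<^bsub>F\<^esub> (frag_of (x, a) + frag_of (y, a))"
    unfolding pure_tensor_def using assms frag_of_F
    by (intro I.coset_eq) (simp_all only: F_diff R.add.m_closed)
  then show ?thesis
    unfolding pure_tensor_def using ring_hom_add[OF coset_hom, of "frag_of (x, a)" "frag_of (y, a)"] assms frag_of_F
    by simp
qed

lemma pure_add_right:
  assumes "x \<in> carrier R" "a \<in> carrier S" "b \<in> carrier S"
  shows "pure_tensor R S x (a \<oplus>\<^bsub>S\<^esub> b) = pure_tensor R S x a \<oplus>\<^bsub>ring_tensor R S\<^esub> pure_tensor R S x b"
proof -
  have "frag_of (x, a \<oplus>\<^bsub>S\<^esub> b) - frag_of (x, a) - frag_of (x, b) \<in> tensor_relators R S"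
    unfolding tensor_relators_def using assms by blast
  then have "frag_of (x, a \<oplus>\<^bsub>S\<^esub> b) - (frag_of (x, a) + frag_of (x, b)) \<in> tensor_ideal R S"
    using relators_mem by (auto simp: algebra_simps)
  moreover have c: "frag_of (x, a) + frag_of (x, b) \<in> carrier F"
    using F.add.m_closed frag_of_F assms by fastforce
  ultimately have "pure_tensor R S x (a \<oplus>\<^bsub>S\<^esub> b) = tensor_ideal R S +>\<^bsub>F\<^esub> (frag_of (x, a) + frag_of (x, b))"
    unfolding pure_tensor_def using assms frag_of_F
    by (intro I.coset_eq) (simp_all only: F_diff S.add.m_closed)
  then show ?thesis
    unfolding pure_tensor_def using ring_hom_add[OF coset_hom, of "frag_of (x, a)" "frag_of (x, b)"] assms frag_of_F
    by simp
qed

lemma tensor_induct [consumes 1, case_names pure zero diff]: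
  assumes "t \<in> carrier (ring_tensor R S)"
    and "\<And>x a. x \<in> carrier R \<Longrightarrow> a \<in> carrier S \<Longrightarrow> P (pure_tensor R S x a)"
    and "P \<zero>\<^bsub>ring_tensor R S\<^esub>"
    and "\<And>t u. t \<in> carrier (ring_tensor R S) \<Longrightarrow> u \<in> carrier (ring_tensor R S) \<Longrightarrow> P t \<Longrightarrow> P u \<Longrightarrow> P (t \<ominus>\<^bsub>ring_tensor R S\<^esub> u)"
  shows "P t"
proof -
  obtain f where f: "t = tensor_ideal R S +>\<^bsub>F\<^esub> f" "Poly_Mapping.keys f \<subseteq> carrier R \<times> carrier S"
    using assms(1) I.quotient_carrier unfolding ring_tensor_def by (auto simp: DirProd_def)
  interpret h: ring_hom_ring F "ring_tensor R S" "\<lambda>f. tensor_ideal R S +>\<^bsub>F\<^esub> f"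
    using coset_hom by (intro ring_hom_ringI2 F.ring_axioms T.ring_axioms)
  have "P (tensor_ideal R S +>\<^bsub>F\<^esub> f) \<and> f \<in> carrier F"
    using f(2)
  proof (induction rule: frag_induction)
    case zero
    then show ?case
      using assms(3) h.hom_zero by simp
  next
    case (one x)
    then show ?case
      using assms(2) frag_of_F by (cases x) (auto simp: pure_tensor_def)
  next
    case (diff f g)
    then have "tensor_ideal R S +>\<^bsub>F\<^esub> (f - g)
        = (tensor_ideal R S +>\<^bsub>F\<^esub> f) \<ominus>\<^bsub>ring_tensor R S\<^esub> (tensor_ideal R S +>\<^bsub>F\<^esub> g)"
      using F_diff[of f g] by (simp only: F.minus_eq T.minus_eq h.hom_add h.hom_a_inv F.a_inv_closed flip: F_diff)
    then show ?case
      using diff assms(4) h.hom_closed F_diff_closed by metis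
  qed
  then show ?thesis using f by simp
qed

end

section \<open>The enveloping algebra as a type\<close>

lemma monoid_word_monoid: "Group.monoid (word_monoid S)"
  by (rule monoidI) (auto simp: word_monoid_def)

lemma ring_gl_free: "ring (gl_free m n)"
  unfolding gl_free_def by (rule ring_monoid_algebra[OF monoid_word_monoid])

lemma gl_free_simps [simp]:
  "f \<in> carrier (gl_free m n) \<longleftrightarrow> Poly_Mapping.keys f \<subseteq> lists ({1..m + n} \<times> {1..m + n})"
  "\<one>\<^bsub>gl_free m n\<^esub> = Poly_Mapping.single [] 1"
  "\<zero>\<^bsub>gl_free m n\<^esub> = 0"
  "f \<oplus>\<^bsub>gl_free m n\<^esub> g = f + g"
  "Poly_Mapping.single v a \<otimes>\<^bsub>gl_free m n\<^esub> Poly_Mapping.single w b = Poly_Mapping.single (v @ w) (a * b)"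
  by (simp_all add: gl_free_def) (simp_all add: word_monoid_def)

lemma gl_free_uminus: "f \<in> carrier (gl_free m n) \<Longrightarrow> \<ominus>\<^bsub>gl_free m n\<^esub> f = - f"
  unfolding gl_free_def by (rule monoid_algebra_uminus[OF monoid_word_monoid])

lemma gl_free_diff:
  assumes "f \<in> carrier (gl_free m n)" "g \<in> carrier (gl_free m n)"
  shows "f - g \<in> carrier (gl_free m n)" "f \<ominus>\<^bsub>gl_free m n\<^esub> g = f - g"
proof -
  show "f \<ominus>\<^bsub>gl_free m n\<^esub> g = f - g"
    using ring.ring_simprules(14)[OF ring_gl_free] assms by (simp add: gl_free_uminus a_minus_def)
  then show "f - g \<in> carrier (gl_free m n)"
    using ring.ring_simprules(4)[OF ring_gl_free assms] by simp
qed

lemma ideal_gl_ideal: "ideal (gl_ideal m n) (gl_free m n)"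
  and gl_relator_mem: "{i, j, k, l} \<subseteq> {1..m + n} \<Longrightarrow> gl_relator m i j k l \<in> gl_ideal m n"
proof -
  have "gl_relator m i j k l \<in> carrier (gl_free m n)" if "{i, j, k, l} \<subseteq> {1..m + n}" for i j k l
    unfolding gl_relator_def using that by (intro gl_free_diff) auto
  then have *: "{gl_relator m i j k l | i j k l. {i, j, k, l} \<subseteq> {1..m + n}} \<subseteq> carrier (gl_free m n)"
    by blast
  show "ideal (gl_ideal m n) (gl_free m n)"
    unfolding gl_ideal_def by (rule ring.genideal_ideal[OF ring_gl_free *])
  show "{i, j, k, l} \<subseteq> {1..m + n} \<Longrightarrow> gl_relator m i j k l \<in> gl_ideal m n"
    unfolding gl_ideal_def using ring.genideal_self[OF ring_gl_free *] by blast
qed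

definition gl_coset :: "nat \<Rightarrow> nat \<Rightarrow> ((nat \<times> nat) list \<Rightarrow>\<^sub>0 rat) \<Rightarrow> ((nat \<times> nat) list \<Rightarrow>\<^sub>0 rat) set" where
  "gl_coset m n f = gl_ideal m n +>\<^bsub>gl_free m n\<^esub> f"

lemma ring_UQ: "ring (UQ m n)"
  unfolding UQ_def by (rule ideal.quotient_is_ring[OF ideal_gl_ideal])

lemma gl_coset_hom: "gl_coset m n \<in> ring_hom (gl_free m n) (UQ m n)"
  using ideal.rcos_ring_hom[OF ideal_gl_ideal] unfolding UQ_def gl_coset_def[abs_def] .

lemma gl_coset_surj: "x \<in> carrier (UQ m n) \<Longrightarrow> \<exists>f\<in>carrier (gl_free m n). x = gl_coset m n f"
  using ideal.quotient_carrier[OF ideal_gl_ideal] unfolding UQ_def gl_coset_def by auto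

lemma gl_coset_eq:
  "\<lbrakk>f \<in> carrier (gl_free m n); g \<in> carrier (gl_free m n); f - g \<in> gl_ideal m n\<rbrakk>
    \<Longrightarrow> gl_coset m n f = gl_coset m n g"
  unfolding gl_coset_def using ideal.coset_eq[OF ideal_gl_ideal] gl_free_diff by metis

lemma gl_coset_scalar_commute:
  assumes "x \<in> carrier (UQ m n)"
  shows "gl_coset m n (Poly_Mapping.single [] q) \<otimes>\<^bsub>UQ m n\<^esub> x = x \<otimes>\<^bsub>UQ m n\<^esub> gl_coset m n (Poly_Mapping.single [] q)"
proof -
  obtain f where f: "f \<in> carrier (gl_free m n)" "x = gl_coset m n f"
    using gl_coset_surj assms by blast
  have "Poly_Mapping.single [] q \<otimes>\<^bsub>gl_free m n\<^esub> f = f \<otimes>\<^bsub>gl_free m n\<^esub> Poly_Mapping.single [] q"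
    using f(1)[unfolded gl_free_simps]
    by (induction rule: poly_mapping_induct_keys)
      (simp_all add: gl_free_def monoid_algebra_distrib, simp_all add: word_monoid_def mult.commute)
  then show ?thesis
    unfolding f(2) using f(1) by (subst (1 2) ring_hom_mult[OF gl_coset_hom, symmetric]) auto
qed

text \<open>The product of the algebras \<^const>\<open>UQ\<close> over all \<open>m, n\<close>: a type on which type class algebra is
  available. The factor \<^typ>\<open>rat\<close> makes it nontrivial without a proof that \<open>UQ m n\<close> is.\<close>

typedef uq = "{x :: (nat \<Rightarrow> nat \<Rightarrow> ((nat \<times> nat) list \<Rightarrow>\<^sub>0 rat) set) \<times> rat. \<forall>m n. fst x m n \<in> carrier (UQ m n)}"
  by (rule exI[of _ "(\<lambda>m n. \<zero>\<^bsub>UQ m n\<^esub>, 0)"]) (simp add: ring.ring_simprules(2)[OF ring_UQ])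

setup_lifting type_definition_uq

instantiation uq :: rat_algebra
begin

lift_definition zero_uq :: uq is "(\<lambda>m n. \<zero>\<^bsub>UQ m n\<^esub>, 0)"
  by (simp add: ring.ring_simprules(2)[OF ring_UQ])
lift_definition one_uq :: uq is "(\<lambda>m n. \<one>\<^bsub>UQ m n\<^esub>, 1)"
  by (simp add: ring.ring_simprules(6)[OF ring_UQ])
lift_definition plus_uq :: "uq \<Rightarrow> uq \<Rightarrow> uq" is
  "\<lambda>x y. (\<lambda>m n. fst x m n \<oplus>\<^bsub>UQ m n\<^esub> fst y m n, snd x + snd y)"
  by (simp add: ring.ring_simprules(1)[OF ring_UQ])
lift_definition uminus_uq :: "uq \<Rightarrow> uq" is "\<lambda>x. (\<lambda>m n. \<ominus>\<^bsub>UQ m n\<^esub> fst x m n, - snd x)"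
  by (simp add: ring.ring_simprules(3)[OF ring_UQ])
lift_definition minus_uq :: "uq \<Rightarrow> uq \<Rightarrow> uq" is
  "\<lambda>x y. (\<lambda>m n. fst x m n \<ominus>\<^bsub>UQ m n\<^esub> fst y m n, snd x - snd y)"
  by (simp add: ring.ring_simprules(4)[OF ring_UQ])
lift_definition times_uq :: "uq \<Rightarrow> uq \<Rightarrow> uq" is
  "\<lambda>x y. (\<lambda>m n. fst x m n \<otimes>\<^bsub>UQ m n\<^esub> fst y m n, snd x * snd y)"
  by (simp add: ring.ring_simprules(5)[OF ring_UQ])
lift_definition of_q_uq :: "rat \<Rightarrow> uq" is
  "\<lambda>q. (\<lambda>m n. gl_coset m n (Poly_Mapping.single [] q), q)"
  by (simp add: ring_hom_closed[OF gl_coset_hom])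

instance
proof
  fix x y z :: uq and p q :: rat
  show "x + y + z = x + (y + z)"
    by transfer (auto simp: ring.ring_simprules(7)[OF ring_UQ])
  show "x + y = y + x"
    by transfer (auto simp: ring.ring_simprules(10)[OF ring_UQ])
  show "0 + x = x"
    by transfer (auto simp: ring.ring_simprules(8)[OF ring_UQ] intro!: prod_eqI)
  show "- x + x = 0"
    by transfer (auto simp: ring.ring_simprules(9)[OF ring_UQ])
  show "x - y = x + - y"
    by transfer (auto simp: a_minus_def)
  show "x * y * z = x * (y * z)"
    by transfer (auto simp: ring.ring_simprules(11)[OF ring_UQ])
  show "1 * x = x"
    by transfer (auto simp: ring.ring_simprules(12)[OF ring_UQ] intro!: prod_eqI)
  show "x * 1 = x"
    by transfer (auto simp: monoid.r_one[OF ring.is_monoid[OF ring_UQ]] intro!: prod_eqI)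
  show "(x + y) * z = x * z + y * z"
    by transfer (auto simp: ring.ring_simprules(13)[OF ring_UQ] algebra_simps)
  show "x * (y + z) = x * y + x * z"
    by transfer (auto simp: ring.ring_simprules(23)[OF ring_UQ] algebra_simps)
  show "(0 :: uq) \<noteq> 1"
    by transfer auto
  show "of_q (p + q) = (of_q p + of_q q :: uq)"
    by transfer (auto simp: single_add ring_hom_add[OF gl_coset_hom, symmetric])
  show "of_q (p * q) = (of_q p * of_q q :: uq)"
    by transfer (auto simp: ring_hom_mult[OF gl_coset_hom, symmetric])
  show "of_q 1 = (1 :: uq)"
    by transfer (use ring_hom_one[OF gl_coset_hom] in auto)
  show "of_q p * x = x * of_q p"
    by transfer (auto simp: gl_coset_scalar_commute)
qed

end

definition uq_component :: "nat \<Rightarrow> nat \<Rightarrow> uq \<Rightarrow> ((nat \<times> nat) list \<Rightarrow>\<^sub>0 rat) set" where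
  "uq_component m n x = fst (Rep_uq x) m n"

definition uq_embed :: "nat \<Rightarrow> nat \<Rightarrow> ((nat \<times> nat) list \<Rightarrow>\<^sub>0 rat) set \<Rightarrow> uq" where
  "uq_embed m n x = Abs_uq (\<lambda>m' n'. if m' = m \<and> n' = n then x else \<zero>\<^bsub>UQ m' n'\<^esub>, 0)"

lemma Rep_uq_embed:
  assumes "x \<in> carrier (UQ m n)"
  shows "Rep_uq (uq_embed m n x) = (\<lambda>m' n'. if m' = m \<and> n' = n then x else \<zero>\<^bsub>UQ m' n'\<^esub>, 0)"
  unfolding uq_embed_def using assms by (intro Abs_uq_inverse) (simp add: ring.ring_simprules(2)[OF ring_UQ])

lemma uq_component_simps [simp]:
  "uq_component m n x \<in> carrier (UQ m n)"
  "uq_component m n 0 = \<zero>\<^bsub>UQ m n\<^esub>"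
  "uq_component m n 1 = \<one>\<^bsub>UQ m n\<^esub>"
  "uq_component m n (x + y) = uq_component m n x \<oplus>\<^bsub>UQ m n\<^esub> uq_component m n y"
  "uq_component m n (x - y) = uq_component m n x \<ominus>\<^bsub>UQ m n\<^esub> uq_component m n y"
  "uq_component m n (- x) = \<ominus>\<^bsub>UQ m n\<^esub> uq_component m n x"
  "uq_component m n (x * y) = uq_component m n x \<otimes>\<^bsub>UQ m n\<^esub> uq_component m n y"
  "uq_component m n (of_q q) = gl_coset m n (Poly_Mapping.single [] q)"
  using Rep_uq[of x] by (simp_all add: uq_component_def zero_uq.rep_eq one_uq.rep_eq plus_uq.rep_eq
    minus_uq.rep_eq uminus_uq.rep_eq times_uq.rep_eq of_q_uq.rep_eq)

lemma uq_component_embed [simp]: "x \<in> carrier (UQ m n) \<Longrightarrow> uq_component m n (uq_embed m n x) = x"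
  by (simp add: uq_component_def Rep_uq_embed)

lemma uq_embed_mult:
  assumes "x \<in> carrier (UQ m n)" "y \<in> carrier (UQ m n)"
  shows "uq_embed m n x * uq_embed m n y = uq_embed m n (x \<otimes>\<^bsub>UQ m n\<^esub> y)"
  using assms unfolding Rep_uq_inject[symmetric]
  by (simp add: times_uq.rep_eq Rep_uq_embed fun_eq_iff ring.ring_simprules(5)[OF ring_UQ]
      ring.ring_simprules(24)[OF ring_UQ] ring.ring_simprules(2)[OF ring_UQ])

lemma uq_embed_add:
  assumes "x \<in> carrier (UQ m n)" "y \<in> carrier (UQ m n)"
  shows "uq_embed m n x + uq_embed m n y = uq_embed m n (x \<oplus>\<^bsub>UQ m n\<^esub> y)"
  using assms unfolding Rep_uq_inject[symmetric]
  by (simp add: plus_uq.rep_eq Rep_uq_embed fun_eq_iff ring.ring_simprules(1)[OF ring_UQ]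
      ring.ring_simprules(8)[OF ring_UQ] ring.ring_simprules(2)[OF ring_UQ])

definition uq_free :: "nat \<Rightarrow> nat \<Rightarrow> ((nat \<times> nat) list \<Rightarrow>\<^sub>0 rat) \<Rightarrow> uq" where
  "uq_free m n f = uq_embed m n (gl_coset m n f)"

definition uq_unit :: "nat \<Rightarrow> nat \<Rightarrow> nat \<Rightarrow> nat \<Rightarrow> uq" where
  "uq_unit m n i j = uq_free m n (Poly_Mapping.single [(i, j)] 1)"

lemma uq_free_add: "f \<in> carrier (gl_free m n) \<Longrightarrow> g \<in> carrier (gl_free m n) \<Longrightarrow>
    uq_free m n (f + g) = uq_free m n f + uq_free m n g"
  unfolding uq_free_def using ring_hom_add[OF gl_coset_hom, of f m n g]
  by (simp add: uq_embed_add ring_hom_closed[OF gl_coset_hom])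

lemma uq_free_mult: "f \<in> carrier (gl_free m n) \<Longrightarrow> g \<in> carrier (gl_free m n) \<Longrightarrow>
    uq_free m n (f \<otimes>\<^bsub>gl_free m n\<^esub> g) = uq_free m n f * uq_free m n g"
  unfolding uq_free_def using ring_hom_mult[OF gl_coset_hom, of f m n g]
  by (simp add: uq_embed_mult ring_hom_closed[OF gl_coset_hom])

lemma uq_free_0 [simp]: "uq_free m n 0 = 0"
  using uq_free_add[of 0 m n 0] by simp

lemma uq_free_diff: "f \<in> carrier (gl_free m n) \<Longrightarrow> g \<in> carrier (gl_free m n) \<Longrightarrow>
    uq_free m n (f - g) = uq_free m n f - uq_free m n g"
  using uq_free_add[of "f - g" m n g] gl_free_diff(1)[of f m n g] by simp

lemma uq_free_neg:
  assumes "Poly_Mapping.single w 1 \<in> carrier (gl_free m n)"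
  shows "uq_free m n (Poly_Mapping.single w (- 1)) = - uq_free m n (Poly_Mapping.single w 1)"
proof -
  have "Poly_Mapping.single w (- 1 :: rat) = 0 - Poly_Mapping.single w 1"
    by (simp add: single_uminus)
  then show ?thesis
    using uq_free_diff[of 0 m n "Poly_Mapping.single w 1"] assms by simp
qed

lemma uq_unit_mult:
  assumes "i \<in> {1..m + n}" "j \<in> {1..m + n}" "k \<in> {1..m + n}" "l \<in> {1..m + n}"
  shows "uq_unit m n i j * uq_unit m n k l = uq_free m n (Poly_Mapping.single [(i, j), (k, l)] 1)"
  unfolding uq_unit_def using assms by (subst uq_free_mult[symmetric]) auto

lemma uq_relator:
  assumes "i \<in> {1..m + n}" "j \<in> {1..m + n}" "k \<in> {1..m + n}" "l \<in> {1..m + n}"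
  shows "uq_free m n (Poly_Mapping.single [(i, j), (k, l)] 1)
      - uq_free m n (Poly_Mapping.single [(k, l), (i, j)] (supersign m (i, j) (k, l)))
    = (if j = k then uq_free m n (Poly_Mapping.single [(i, l)] 1) else 0)
      - (if i = l then uq_free m n (Poly_Mapping.single [(k, j)] (supersign m (i, j) (k, l))) else 0)"
proof -
  define c where "c = supersign m (i, j) (k, l)"
  define A where "A = Poly_Mapping.single [(i, j), (k, l)] 1 - Poly_Mapping.single [(k, l), (i, j)] c"
  define B where "B = (if j = k then Poly_Mapping.single [(i, l)] 1 else 0)
       - (if i = l then Poly_Mapping.single [(k, j)] c else 0)"
  have carr: "Poly_Mapping.single [(i, j), (k, l)] 1 \<in> carrier (gl_free m n)"
    "Poly_Mapping.single [(k, l), (i, j)] c \<in> carrier (gl_free m n)"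
    "(if j = k then Poly_Mapping.single [(i, l)] 1 else 0) \<in> carrier (gl_free m n)"
    "(if i = l then Poly_Mapping.single [(k, j)] c else 0) \<in> carrier (gl_free m n)"
    using assms by auto
  then have AB: "A \<in> carrier (gl_free m n)" "B \<in> carrier (gl_free m n)"
    unfolding A_def B_def using gl_free_diff(1) by blast+
  have "A - B \<in> gl_ideal m n"
    using gl_relator_mem[of i j k l m n] assms unfolding gl_relator_def A_def B_def c_def by simp
  then have "uq_free m n A = uq_free m n B"
    unfolding uq_free_def using gl_coset_eq AB by metis
  then show ?thesis
    using uq_free_diff carr unfolding A_def B_def c_def by (auto split: if_splits)
qed

interpretation uq: gl_relations m n "uq_unit m n" for m n
proof
  fix i j k l
  assume ijkl: "i \<in> {1..m + n}" "j \<in> {1..m + n}" "k \<in> {1..m + n}" "l \<in> {1..m + n}"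
  note rel = uq_relator[OF ijkl]
  show "uq_unit m n i j * uq_unit m n k l = uq_unit m n k l * uq_unit m n i j
      + ((if j = k then uq_unit m n i l else 0) - (if i = l then uq_unit m n k j else 0))"
    if "(i \<le> m \<longleftrightarrow> j \<le> m) \<or> (k \<le> m \<longleftrightarrow> l \<le> m)"
  proof -
    have s: "supersign m (i, j) (k, l) = 1"
      using that by (auto simp: supersign_def)
    show ?thesis
      using rel unfolding s uq_unit_mult[OF ijkl] uq_unit_mult[OF ijkl(3,4,1,2)]
      unfolding uq_unit_def by (simp add: diff_eq_eq add.commute split: if_splits)
  qed
  show "uq_unit m n i j * uq_unit m n k l = - (uq_unit m n k l * uq_unit m n i j)
      + ((if j = k then uq_unit m n i l else 0) + (if i = l then uq_unit m n k j else 0))"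
    if "\<not> (i \<le> m \<longleftrightarrow> j \<le> m)" "\<not> (k \<le> m \<longleftrightarrow> l \<le> m)"
  proof -
    have s: "supersign m (i, j) (k, l) = - 1"
      using that by (auto simp: supersign_def)
    have neg: "uq_free m n (Poly_Mapping.single [(k, l), (i, j)] (- 1))
        = - uq_free m n (Poly_Mapping.single [(k, l), (i, j)] 1)"
      "uq_free m n (Poly_Mapping.single [(k, j)] (- 1)) = - uq_free m n (Poly_Mapping.single [(k, j)] 1)"
      using ijkl by (intro uq_free_neg; simp)+
    show ?thesis
      using rel unfolding s neg uq_unit_mult[OF ijkl] uq_unit_mult[OF ijkl(3,4,1,2)]
      unfolding uq_unit_def by (simp add: algebra_simps split: if_splits)
  qed
qed

lemma uq_component_free: "f \<in> carrier (gl_free m n) \<Longrightarrow> uq_component m n (uq_free m n f) = gl_coset m n f"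
  unfolding uq_free_def by (simp add: ring_hom_closed[OF gl_coset_hom])

lemma uq_component_unit:
  "i \<in> {1..m + n} \<Longrightarrow> j \<in> {1..m + n} \<Longrightarrow> uq_component m n (uq_unit m n i j) = gl_coset m n (Poly_Mapping.single [(i, j)] 1)"
  unfolding uq_unit_def by (rule uq_component_free) auto

lemma UQ_monomial_coset: "UQ_monomial m n w c = gl_coset m n (Poly_Mapping.single w c)"
  by (simp add: UQ_monomial_def gl_coset_def)

lemma uq_component_divpow:
  assumes "i \<in> {1..m + n}" "j \<in> {1..m + n}"
  shows "uq_component m n (divpow (uq_unit m n i j) r) = e_divpow m n i j r"
proof -
  have "uq_component m n (uq_unit m n i j ^ r) = gl_coset m n (Poly_Mapping.single (replicate r (i, j)) 1)"
  proof (induction r)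
    case 0
    then show ?case using ring_hom_one[OF gl_coset_hom, of m n] by simp
  next
    case (Suc r)
    then show ?case
      using assms by (simp add: uq_component_unit) (subst ring_hom_mult[OF gl_coset_hom, symmetric], auto)
  qed
  then show ?thesis
    unfolding divpow_def e_divpow_def UQ_monomial_coset using assms
    by simp (subst ring_hom_mult[OF gl_coset_hom, symmetric], auto)
qed

lemma uq_component_of_nat: "uq_component m n (of_nat k) = [k] \<cdot>\<^bsub>UQ m n\<^esub> \<one>\<^bsub>UQ m n\<^esub>"
proof (induction k)
  case 0
  then show ?case by (simp add: add_pow_def nat_pow_def)
next
  case (Suc k)
  have "[Suc k] \<cdot>\<^bsub>UQ m n\<^esub> \<one>\<^bsub>UQ m n\<^esub> = [k] \<cdot>\<^bsub>UQ m n\<^esub> \<one>\<^bsub>UQ m n\<^esub> \<oplus>\<^bsub>UQ m n\<^esub> \<one>\<^bsub>UQ m n\<^esub>"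
    by (simp add: add_pow_def nat_pow_def)
  moreover have "of_nat (Suc k) = (of_nat k + 1 :: uq)"
    by simp
  ultimately show ?case
    using Suc by (simp only: uq_component_simps)
qed

lemma uq_component_falling: "uq_component m n (falling x r) = falling_power (UQ m n) (uq_component m n x) r"
  by (induction r) (simp_all add: uq_component_of_nat)

lemma uq_component_binom:
  assumes "s \<in> {1..m + n}"
  shows "uq_component m n (binom (uq_unit m n s s) r) = h_binom m n s r"
proof -
  have "uq_component m n (uq_unit m n s s) = e_divpow m n s s 1"
    using uq_component_divpow[OF assms assms, of 1] by simp
  then show ?thesis
    unfolding binom_def h_binom_def UQ_monomial_coset by (simp add: uq_component_falling)
qed

lemma even_generators_component: "even_generators m n = uq_component m n ` uq.even_gens m n"
proof -
  have "e_divpow m n i j r = uq_component m n (divpow (uq_unit m n i j) r)"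
    "e_divpow m n j i r = uq_component m n (divpow (uq_unit m n j i) r)"
    if "(i, j) \<in> I0 m n" for i j r
    using I0_D[OF that] by (simp_all add: uq_component_divpow)
  moreover have "h_binom m n s r = uq_component m n (binom (uq_unit m n s s) r)" if "s \<in> {1..m + n}" for s r
    using uq_component_binom that by simp
  ultimately show ?thesis
    unfolding even_generators_def uq.even_gens_def image_Un setcompr_eq_image image_image
    by (intro arg_cong2[where f = "(\<union>)"]; (intro equalityI subsetI; clarsimp simp: image_iff; metis))
qed

section \<open>Extension of scalars\<close>

locale scalar_extension = A: ring A + M: abelian_group M
  for A :: "'a ring" and M :: "('a, 'v) module" +
  fixes B :: "'a set"
  assumes B: "B \<subseteq> carrier A"
    and B_smult: "\<And>b x. b \<in> B \<Longrightarrow> x \<in> carrier M \<Longrightarrow> b \<odot>\<^bsub>M\<^esub> x \<in> carrier M"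
begin

abbreviation "F \<equiv> free_Abelian_group (carrier A \<times> carrier M)"
abbreviation "R \<equiv> balanced_relators A B M"
abbreviation "K \<equiv> generate F R"
abbreviation "Ext \<equiv> extension_of_scalars A B M"

definition tens :: "'a \<Rightarrow> 'v \<Rightarrow> ('a \<times> 'v \<Rightarrow>\<^sub>0 int) set" where
  "tens a x = K #>\<^bsub>F\<^esub> frag_of (a, x)"

definition translate :: "'a \<Rightarrow> ('a \<times> 'v \<Rightarrow>\<^sub>0 int) \<Rightarrow> ('a \<times> 'v \<Rightarrow>\<^sub>0 int)" where
  "translate a = frag_extend (\<lambda>(x, v). frag_of (a \<otimes>\<^bsub>A\<^esub> x, v))"

sublocale F: comm_group F
  by (rule abelian_free_Abelian_group)

lemma frag_of_F: "a \<in> carrier A \<Longrightarrow> x \<in> carrier M \<Longrightarrow> frag_of (a, x) \<in> carrier F"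
  by simp

lemma F_diff_closed: "f \<in> carrier F \<Longrightarrow> g \<in> carrier F \<Longrightarrow> f - g \<in> carrier F"
  using keys_diff[of f g] by auto

lemma F_inv: "f \<in> carrier F \<Longrightarrow> inv\<^bsub>F\<^esub> f = - f"
  by simp

lemma R_F: "R \<subseteq> carrier F"
proof -
  have "frag_of (a, x) \<in> carrier F \<longleftrightarrow> a \<in> carrier A \<and> x \<in> carrier M" for a x
    by simp
  then show ?thesis
    unfolding balanced_relators_def tensor_relators_def using B B_smult
    by (auto intro!: F_diff_closed simp del: carrier_free_Abelian_group_iff)
qed

lemma K_subgroup: "subgroup K F"
  by (rule F.generate_is_subgroup[OF R_F])

sublocale K: normal K F
  by (rule F.subgroup_imp_normal[OF K_subgroup])

sublocale Q: comm_group "F Mod K"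
  by (rule F.abelian_FactGroup[OF K_subgroup])

lemma coset_add: "f \<in> carrier F \<Longrightarrow> g \<in> carrier F \<Longrightarrow>
    K #>\<^bsub>F\<^esub> (f + g) = (K #>\<^bsub>F\<^esub> f) \<otimes>\<^bsub>F Mod K\<^esub> (K #>\<^bsub>F\<^esub> g)"
  using K.rcos_sum[of f g] by simp

lemma coset_of_K: "k \<in> K \<Longrightarrow> K #>\<^bsub>F\<^esub> k = \<one>\<^bsub>F Mod K\<^esub>"
  using subgroup.rcos_const[OF K_subgroup F.is_group] by simp

lemma coset_eq: "f \<in> carrier F \<Longrightarrow> g \<in> carrier F \<Longrightarrow> f - g \<in> K \<Longrightarrow> K #>\<^bsub>F\<^esub> f = K #>\<^bsub>F\<^esub> g"
proof -
  assume fg: "f \<in> carrier F" "g \<in> carrier F" and K: "f - g \<in> K"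
  have "K #>\<^bsub>F\<^esub> ((f - g) + g) = (K #>\<^bsub>F\<^esub> (f - g)) \<otimes>\<^bsub>F Mod K\<^esub> (K #>\<^bsub>F\<^esub> g)"
    by (rule coset_add[OF F_diff_closed[OF fg] fg(2)])
  also have "\<dots> = K #>\<^bsub>F\<^esub> g"
    unfolding coset_of_K[OF K] using fg(2) carrier_FactGroup[of F K] by (intro Q.l_one) blast
  finally show "K #>\<^bsub>F\<^esub> f = K #>\<^bsub>F\<^esub> g" by simp
qed

lemma coset_eqD: "f \<in> carrier F \<Longrightarrow> g \<in> carrier F \<Longrightarrow> K #>\<^bsub>F\<^esub> f = K #>\<^bsub>F\<^esub> g \<Longrightarrow> f - g \<in> K"
proof -
  assume fg: "f \<in> carrier F" "g \<in> carrier F" and eq: "K #>\<^bsub>F\<^esub> f = K #>\<^bsub>F\<^esub> g"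
  have "f \<in> K #>\<^bsub>F\<^esub> g"
    using F.rcos_self[OF fg(1) K_subgroup] eq by simp
  then have "f \<otimes>\<^bsub>F\<^esub> inv\<^bsub>F\<^esub> g \<in> K"
    using subgroup.rcos_module_imp[OF K_subgroup F.is_group fg(2)] by blast
  then show "f - g \<in> K"
    using F_inv[OF fg(2)] by simp
qed

lemma translate_simps [simp]:
  "translate a 0 = 0"
  "translate a (frag_of (b, x)) = frag_of (a \<otimes>\<^bsub>A\<^esub> b, x)"
  "translate a (f + g) = translate a f + translate a g"
  "translate a (f - g) = translate a f - translate a g"
  "translate a (- f) = - translate a f"
  by (simp_all add: translate_def frag_extend_add frag_extend_diff frag_extend_minus)

lemma F_induct [consumes 1, case_names zero one diff]:
  assumes "f \<in> carrier F" "P 0"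
    and "\<And>a x. a \<in> carrier A \<Longrightarrow> x \<in> carrier M \<Longrightarrow> P (frag_of (a, x))"
    and "\<And>f g. f \<in> carrier F \<Longrightarrow> g \<in> carrier F \<Longrightarrow> P f \<Longrightarrow> P g \<Longrightarrow> P (f - g)"
  shows "P f"
proof -
  have "Poly_Mapping.keys f \<subseteq> carrier A \<times> carrier M"
    using assms(1) by simp
  then have "P f \<and> f \<in> carrier F"
  proof (induction rule: frag_induction)
    case (diff f g)
    then show ?case using assms(4) F_diff_closed by blast
  qed (use assms in auto)
  then show ?thesis ..
qed

lemma translate_closed: "a \<in> carrier A \<Longrightarrow> f \<in> carrier F \<Longrightarrow> translate a f \<in> carrier F"
proof -
  assume a: "a \<in> carrier A" and "f \<in> carrier F"
  from this(2) show "translate a f \<in> carrier F"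
  proof (induction rule: F_induct)
    case (diff f g)
    then show ?case using F_diff_closed[of "translate a f" "translate a g"] by simp
  qed (use a in auto)
qed

lemma R_intros:
  "\<lbrakk>x \<in> carrier A; y \<in> carrier A; v \<in> carrier M\<rbrakk> \<Longrightarrow> frag_of (x \<oplus>\<^bsub>A\<^esub> y, v) - frag_of (x, v) - frag_of (y, v) \<in> R"
  "\<lbrakk>x \<in> carrier A; v \<in> carrier M; w \<in> carrier M\<rbrakk> \<Longrightarrow> frag_of (x, v \<oplus>\<^bsub>M\<^esub> w) - frag_of (x, v) - frag_of (x, w) \<in> R"
  "\<lbrakk>x \<in> carrier A; b \<in> B; v \<in> carrier M\<rbrakk> \<Longrightarrow> frag_of (x \<otimes>\<^bsub>A\<^esub> b, v) - frag_of (x, b \<odot>\<^bsub>M\<^esub> v) \<in> R"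
  unfolding balanced_relators_def tensor_relators_def by blast+

lemma translate_relator:
  assumes a: "a \<in> carrier A" and r: "r \<in> R"
  shows "translate a r \<in> R"
proof -
  consider (left) x y v where "r = frag_of (x \<oplus>\<^bsub>A\<^esub> y, v) - frag_of (x, v) - frag_of (y, v)"
      "x \<in> carrier A" "y \<in> carrier A" "v \<in> carrier M"
    | (right) x v w where "r = frag_of (x, v \<oplus>\<^bsub>M\<^esub> w) - frag_of (x, v) - frag_of (x, w)"
      "x \<in> carrier A" "v \<in> carrier M" "w \<in> carrier M"
    | (bal) x b v where "r = frag_of (x \<otimes>\<^bsub>A\<^esub> b, v) - frag_of (x, b \<odot>\<^bsub>M\<^esub> v)"
      "x \<in> carrier A" "b \<in> B" "v \<in> carrier M"
    using r unfolding balanced_relators_def tensor_relators_def by blast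
  then show ?thesis
  proof cases
    case left
    then show ?thesis
      using R_intros(1)[of "a \<otimes>\<^bsub>A\<^esub> x" "a \<otimes>\<^bsub>A\<^esub> y" v] a by (simp add: A.r_distr)
  next
    case right
    then show ?thesis
      using R_intros(2)[of "a \<otimes>\<^bsub>A\<^esub> x" v w] a by simp
  next
    case bal
    then show ?thesis
      using R_intros(3)[of "a \<otimes>\<^bsub>A\<^esub> x" b v] a B by (simp add: A.m_assoc subset_iff)
  qed
qed

lemma translate_K:
  assumes a: "a \<in> carrier A" and k: "k \<in> K"
  shows "translate a k \<in> K"
  using k
proof induction
  case one
  then show ?case using generate.one[of F R] by simp
next
  case (incl h)
  then show ?case using translate_relator[OF a] generate.incl by metis
next
  case (inv h)
  then show ?case
  proof -
    have "inv\<^bsub>F\<^esub> h = - h" "inv\<^bsub>F\<^esub> translate a h = - translate a h"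
      using inv translate_relator[OF a inv] R_F by (simp_all add: subset_iff)
    then show ?thesis
      using generate.inv[OF translate_relator[OF a inv], of F] by simp
  qed
next
  case (eng h1 h2)
  then show ?case using generate.eng by fastforce
qed

lemma K_F: "K \<subseteq> carrier F"
  by (rule subgroup.subset[OF K_subgroup])

lemma Ext_simps [simp]:
  "carrier Ext = carrier (F Mod K)"
  "\<zero>\<^bsub>Ext\<^esub> = \<one>\<^bsub>F Mod K\<^esub>"
  "u \<oplus>\<^bsub>Ext\<^esub> v = u \<otimes>\<^bsub>F Mod K\<^esub> v"
  by (simp_all add: extension_of_scalars_def Let_def)

lemma Ext_smult:
  assumes a: "a \<in> carrier A" and f: "f \<in> carrier F"
  shows "a \<odot>\<^bsub>Ext\<^esub> (K #>\<^bsub>F\<^esub> f) = K #>\<^bsub>F\<^esub> translate a f"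
proof -
  have *: "K #>\<^bsub>F\<^esub> translate a c = K #>\<^bsub>F\<^esub> translate a f" if "c \<in> K #>\<^bsub>F\<^esub> f" for c
  proof -
    obtain k where k: "k \<in> K" "c = k + f"
      using \<open>c \<in> K #>\<^bsub>F\<^esub> f\<close> unfolding r_coset_def by auto
    have kF: "k \<in> carrier F" using k K_F by blast
    show ?thesis
    proof (rule coset_eq)
      show "translate a c - translate a f \<in> K"
        using translate_K[OF a k(1)] k(2) by simp
      show "translate a c \<in> carrier F"
        unfolding k(2) using F.m_closed[OF kF f] by (intro translate_closed a) simp
    qed (intro translate_closed a f)
  qed
  have "a \<odot>\<^bsub>Ext\<^esub> (K #>\<^bsub>F\<^esub> f) = (\<Union>c\<in>K #>\<^bsub>F\<^esub> f. K #>\<^bsub>F\<^esub> translate a c)"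
    by (simp add: extension_of_scalars_def Let_def translate_def)
  also have "\<dots> = (\<Union>c\<in>K #>\<^bsub>F\<^esub> f. K #>\<^bsub>F\<^esub> translate a f)"
    by (simp only: * cong: SUP_cong)
  also have "\<dots> = K #>\<^bsub>F\<^esub> translate a f"
    using F.rcos_self[OF f K_subgroup] by blast
  finally show ?thesis .
qed

lemma coset_carrier: "f \<in> carrier F \<Longrightarrow> K #>\<^bsub>F\<^esub> f \<in> carrier Ext"
  using carrier_FactGroup[of F K] by auto

lemma Ext_cases:
  assumes "z \<in> carrier Ext"
  obtains f where "f \<in> carrier F" "z = K #>\<^bsub>F\<^esub> f"
  using assms carrier_FactGroup[of F K] by auto

lemma abelian_group_Ext: "abelian_group Ext"
proof (rule abelian_groupI)
  show "u \<oplus>\<^bsub>Ext\<^esub> v \<oplus>\<^bsub>Ext\<^esub> w = u \<oplus>\<^bsub>Ext\<^esub> (v \<oplus>\<^bsub>Ext\<^esub> w)"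
    if "u \<in> carrier Ext" "v \<in> carrier Ext" "w \<in> carrier Ext" for u v w
    using Q.m_assoc that unfolding Ext_simps .
  show "u \<oplus>\<^bsub>Ext\<^esub> v = v \<oplus>\<^bsub>Ext\<^esub> u" if "u \<in> carrier Ext" "v \<in> carrier Ext" for u v
    using Q.m_comm that unfolding Ext_simps .
  show "\<exists>v\<in>carrier Ext. v \<oplus>\<^bsub>Ext\<^esub> u = \<zero>\<^bsub>Ext\<^esub>" if "u \<in> carrier Ext" for u
    using Q.l_inv Q.inv_closed that unfolding Ext_simps by blast
  show "u \<oplus>\<^bsub>Ext\<^esub> v \<in> carrier Ext" if "u \<in> carrier Ext" "v \<in> carrier Ext" for u v
    using Q.m_closed that unfolding Ext_simps .
  show "\<zero>\<^bsub>Ext\<^esub> \<in> carrier Ext"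
    using Q.one_closed unfolding Ext_simps .
  show "\<zero>\<^bsub>Ext\<^esub> \<oplus>\<^bsub>Ext\<^esub> u = u" if "u \<in> carrier Ext" for u
    using Q.l_one that unfolding Ext_simps .
qed

sublocale Ext: abelian_group Ext
  by (rule abelian_group_Ext)

lemma coset_add_Ext: "f \<in> carrier F \<Longrightarrow> g \<in> carrier F \<Longrightarrow>
    K #>\<^bsub>F\<^esub> (f + g) = (K #>\<^bsub>F\<^esub> f) \<oplus>\<^bsub>Ext\<^esub> (K #>\<^bsub>F\<^esub> g)"
  using coset_add by simp

lemma F_add_closed: "f \<in> carrier F \<Longrightarrow> g \<in> carrier F \<Longrightarrow> f + g \<in> carrier F"
  using F.m_closed by simp

lemma left_module_Ext: "left_module A Ext"
  unfolding left_module_def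
proof (intro conjI A.ring_axioms abelian_group_Ext module_axioms.intro)
  fix a z assume a: "a \<in> carrier A" and z: "z \<in> carrier Ext"
  obtain f where f: "f \<in> carrier F" "z = K #>\<^bsub>F\<^esub> f"
    using z by (rule Ext_cases)
  show "a \<odot>\<^bsub>Ext\<^esub> z \<in> carrier Ext"
    unfolding f(2) Ext_smult[OF a f(1)] by (intro coset_carrier translate_closed a f)
  show "a \<odot>\<^bsub>Ext\<^esub> (z \<oplus>\<^bsub>Ext\<^esub> z') = a \<odot>\<^bsub>Ext\<^esub> z \<oplus>\<^bsub>Ext\<^esub> a \<odot>\<^bsub>Ext\<^esub> z'" if z': "z' \<in> carrier Ext" for z'
  proof -
    obtain g where g: "g \<in> carrier F" "z' = K #>\<^bsub>F\<^esub> g"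
      using z' by (rule Ext_cases)
    show ?thesis
      unfolding f(2) g(2) coset_add_Ext[OF f(1) g(1), symmetric] Ext_smult[OF a f(1)] Ext_smult[OF a g(1)]
        Ext_smult[OF a F_add_closed[OF f(1) g(1)]] translate_simps
      by (intro coset_add_Ext translate_closed a f g)
  qed
  fix b assume b: "b \<in> carrier A"
  have "translate (a \<otimes>\<^bsub>A\<^esub> b) f = translate a (translate b f)"
    using f(1) by (induction rule: F_induct) (simp_all add: a b A.m_assoc)
  then show "(a \<otimes>\<^bsub>A\<^esub> b) \<odot>\<^bsub>Ext\<^esub> z = a \<odot>\<^bsub>Ext\<^esub> (b \<odot>\<^bsub>Ext\<^esub> z)"
    unfolding f(2) using a b f(1) by (simp only: Ext_smult A.m_closed translate_closed)
  have "translate (a \<oplus>\<^bsub>A\<^esub> b) f - (translate a f + translate b f) \<in> K"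
    using f(1)
  proof (induction rule: F_induct)
    case zero
    then show ?case using generate.one[of F R] by simp
  next
    case (one c x)
    then have "frag_of ((a \<otimes>\<^bsub>A\<^esub> c) \<oplus>\<^bsub>A\<^esub> (b \<otimes>\<^bsub>A\<^esub> c), x) - frag_of (a \<otimes>\<^bsub>A\<^esub> c, x) - frag_of (b \<otimes>\<^bsub>A\<^esub> c, x) \<in> R"
      using a b by (intro R_intros A.m_closed)
    then show ?case
      using generate.incl[of _ R F] one a b by (simp add: A.l_distr diff_diff_eq)
  next
    case (diff f g)
    have "(translate (a \<oplus>\<^bsub>A\<^esub> b) f - (translate a f + translate b f))
        \<otimes>\<^bsub>F\<^esub> inv\<^bsub>F\<^esub> (translate (a \<oplus>\<^bsub>A\<^esub> b) g - (translate a g + translate b g)) \<in> K"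
      using diff by (intro subgroup.m_closed[OF K_subgroup] subgroup.m_inv_closed[OF K_subgroup])
    moreover have "translate (a \<oplus>\<^bsub>A\<^esub> b) g - (translate a g + translate b g) \<in> carrier F"
      using diff K_F by blast
    ultimately show ?case
      by (simp only: F_inv mult_free_Abelian_group translate_simps) (simp add: algebra_simps)
  qed
  then have "K #>\<^bsub>F\<^esub> translate (a \<oplus>\<^bsub>A\<^esub> b) f = K #>\<^bsub>F\<^esub> (translate a f + translate b f)"
    by (intro coset_eq F_add_closed translate_closed A.add.m_closed a b f)
  then show "(a \<oplus>\<^bsub>A\<^esub> b) \<odot>\<^bsub>Ext\<^esub> z = a \<odot>\<^bsub>Ext\<^esub> z \<oplus>\<^bsub>Ext\<^esub> b \<odot>\<^bsub>Ext\<^esub> z"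
    unfolding f(2) using a b f(1)
    by (simp only: Ext_smult A.add.m_closed coset_add_Ext translate_closed)
next
  fix z assume "z \<in> carrier Ext"
  then obtain f where f: "f \<in> carrier F" "z = K #>\<^bsub>F\<^esub> f"
    by (rule Ext_cases)
  have "translate \<one>\<^bsub>A\<^esub> f = f"
    using f(1) by (induction rule: F_induct) simp_all
  then show "\<one>\<^bsub>A\<^esub> \<odot>\<^bsub>Ext\<^esub> z = z"
    unfolding f(2) Ext_smult[OF A.one_closed f(1)] by simp
qed

lemma tens_closed: "a \<in> carrier A \<Longrightarrow> x \<in> carrier M \<Longrightarrow> tens a x \<in> carrier Ext"
  unfolding tens_def by (intro coset_carrier frag_of_F)

lemma smult_tens:
  "a \<in> carrier A \<Longrightarrow> b \<in> carrier A \<Longrightarrow> x \<in> carrier M \<Longrightarrow> a \<odot>\<^bsub>Ext\<^esub> tens b x = tens (a \<otimes>\<^bsub>A\<^esub> b) x"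
  unfolding tens_def by (simp only: Ext_smult frag_of_F translate_simps)

lemma tens_add_right:
  assumes "a \<in> carrier A" "x \<in> carrier M" "y \<in> carrier M"
  shows "tens a (x \<oplus>\<^bsub>M\<^esub> y) = tens a x \<oplus>\<^bsub>Ext\<^esub> tens a y"
proof -
  have "frag_of (a, x \<oplus>\<^bsub>M\<^esub> y) - frag_of (a, x) - frag_of (a, y) \<in> R"
    using assms by (intro R_intros)
  then have "frag_of (a, x \<oplus>\<^bsub>M\<^esub> y) - (frag_of (a, x) + frag_of (a, y)) \<in> K"
    using generate.incl[of _ R F] by (simp add: diff_diff_eq)
  then show ?thesis
    unfolding tens_def coset_add_Ext[OF frag_of_F[OF assms(1,2)] frag_of_F[OF assms(1,3)], symmetric]
    using assms by (intro coset_eq F_add_closed frag_of_F M.a_closed)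
qed

lemma tens_balanced:
  assumes "a \<in> carrier A" "b \<in> B" "x \<in> carrier M"
  shows "tens (a \<otimes>\<^bsub>A\<^esub> b) x = tens a (b \<odot>\<^bsub>M\<^esub> x)"
proof -
  have "frag_of (a \<otimes>\<^bsub>A\<^esub> b, x) - frag_of (a, b \<odot>\<^bsub>M\<^esub> x) \<in> K"
    using assms by (intro generate.incl R_intros)
  then show ?thesis
    unfolding tens_def using assms B B_smult
    by (intro coset_eq frag_of_F A.m_closed) auto
qed

lemma Ext_induct [consumes 1, case_names zero tens diff]:
  assumes "z \<in> carrier Ext" "P \<zero>\<^bsub>Ext\<^esub>"
    and "\<And>a x. a \<in> carrier A \<Longrightarrow> x \<in> carrier M \<Longrightarrow> P (tens a x)"
    and "\<And>u v. u \<in> carrier Ext \<Longrightarrow> v \<in> carrier Ext \<Longrightarrow> P u \<Longrightarrow> P v \<Longrightarrow> P (u \<ominus>\<^bsub>Ext\<^esub> v)"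
  shows "P z"
proof -
  obtain f where f: "f \<in> carrier F" "z = K #>\<^bsub>F\<^esub> f"
    using assms(1) by (rule Ext_cases)
  have "P (K #>\<^bsub>F\<^esub> f)"
    using f(1)
  proof (induction rule: F_induct)
    case zero
    then show ?case using assms(2) coset_of_K[OF generate.one] by simp
  next
    case (one a x)
    then show ?case using assms(3) by (simp add: tens_def)
  next
    case (diff f g)
    have "(K #>\<^bsub>F\<^esub> (f - g)) \<oplus>\<^bsub>Ext\<^esub> (K #>\<^bsub>F\<^esub> g) = K #>\<^bsub>F\<^esub> f"
      using coset_add_Ext[OF F_diff_closed[OF diff(1,2)] diff(2)] by simp
    then have "K #>\<^bsub>F\<^esub> (f - g) = (K #>\<^bsub>F\<^esub> f) \<ominus>\<^bsub>Ext\<^esub> (K #>\<^bsub>F\<^esub> g)"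
      using coset_carrier[OF F_diff_closed[OF diff(1,2)]] coset_carrier[OF diff(2)]
      by (metis Ext.add.inv_solve_right Ext.minus_eq Ext.a_closed)
    then show ?case
      using assms(4)[OF coset_carrier[OF diff(1)] coset_carrier[OF diff(2)]] diff by simp
  qed
  then show ?thesis using f by simp
qed

theorem universal:
  assumes N: "left_module A N"
    and g: "\<And>x. x \<in> carrier M \<Longrightarrow> g x \<in> carrier N"
      "\<And>x y. x \<in> carrier M \<Longrightarrow> y \<in> carrier M \<Longrightarrow> g (x \<oplus>\<^bsub>M\<^esub> y) = g x \<oplus>\<^bsub>N\<^esub> g y"
      "\<And>b x. b \<in> B \<Longrightarrow> x \<in> carrier M \<Longrightarrow> g (b \<odot>\<^bsub>M\<^esub> x) = b \<odot>\<^bsub>N\<^esub> g x"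
  shows "\<exists>h\<in>hom (add_monoid Ext) (add_monoid N).
    (\<forall>a\<in>carrier A. \<forall>x\<in>carrier M. h (tens a x) = a \<odot>\<^bsub>N\<^esub> g x) \<and>
    (\<forall>a\<in>carrier A. \<forall>z\<in>carrier Ext. h (a \<odot>\<^bsub>Ext\<^esub> z) = a \<odot>\<^bsub>N\<^esub> h z)"
proof -
  interpret N: abelian_group N
    using N by (simp add: left_module_def)
  note Nax = module_axioms_def[of A N]
  have N_closed: "\<And>a x. a \<in> carrier A \<Longrightarrow> x \<in> carrier N \<Longrightarrow> a \<odot>\<^bsub>N\<^esub> x \<in> carrier N"
    and N_l: "\<And>a b x. a \<in> carrier A \<Longrightarrow> b \<in> carrier A \<Longrightarrow> x \<in> carrier N \<Longrightarrow>
      (a \<oplus>\<^bsub>A\<^esub> b) \<odot>\<^bsub>N\<^esub> x = a \<odot>\<^bsub>N\<^esub> x \<oplus>\<^bsub>N\<^esub> b \<odot>\<^bsub>N\<^esub> x"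
    and N_r: "\<And>a x y. a \<in> carrier A \<Longrightarrow> x \<in> carrier N \<Longrightarrow> y \<in> carrier N \<Longrightarrow>
      a \<odot>\<^bsub>N\<^esub> (x \<oplus>\<^bsub>N\<^esub> y) = a \<odot>\<^bsub>N\<^esub> x \<oplus>\<^bsub>N\<^esub> a \<odot>\<^bsub>N\<^esub> y"
    and N_m: "\<And>a b x. a \<in> carrier A \<Longrightarrow> b \<in> carrier A \<Longrightarrow> x \<in> carrier N \<Longrightarrow>
      (a \<otimes>\<^bsub>A\<^esub> b) \<odot>\<^bsub>N\<^esub> x = a \<odot>\<^bsub>N\<^esub> (b \<odot>\<^bsub>N\<^esub> x)"
    using N unfolding left_module_def Nax by simp_all
  let ?N = "add_monoid N"
  have "(\<lambda>(a, x). a \<odot>\<^bsub>N\<^esub> g x) ` (carrier A \<times> carrier M) \<subseteq> carrier ?N"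
    using N_closed g(1) by auto
  then obtain \<phi> where \<phi>: "\<phi> \<in> hom F ?N"
      "\<And>z. z \<in> carrier A \<times> carrier M \<Longrightarrow> \<phi> (frag_of z) = (\<lambda>(a, x). a \<odot>\<^bsub>N\<^esub> g x) z"
    by (rule comm_group.free_Abelian_group_universal[OF N.a_comm_group]) blast
  interpret \<phi>: group_hom F ?N \<phi>
    using \<phi>(1) by (intro group_hom.intro group_hom_axioms.intro F.is_group N.a_group)
  have \<phi>f: "\<phi> (frag_of (a, x)) = a \<odot>\<^bsub>N\<^esub> g x" if "a \<in> carrier A" "x \<in> carrier M" for a x
    using \<phi>(2)[of "(a, x)"] that by simp
  have \<phi>_closed: "\<phi> f \<in> carrier N" if "f \<in> carrier F" for f
    using \<phi>.hom_closed[OF that] by simp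
  have \<phi>_add: "\<phi> (f + f') = \<phi> f \<oplus>\<^bsub>N\<^esub> \<phi> f'" if "f \<in> carrier F" "f' \<in> carrier F" for f f'
    using \<phi>.hom_mult[OF that] by simp
  have \<phi>_diff: "\<phi> (f - f') = \<zero>\<^bsub>N\<^esub> \<longleftrightarrow> \<phi> f = \<phi> f'" if "f \<in> carrier F" "f' \<in> carrier F" for f f'
  proof -
    have "\<phi> f = \<phi> (f - f') \<oplus>\<^bsub>N\<^esub> \<phi> f'"
      using \<phi>_add[OF F_diff_closed[OF that] that(2)] by simp
    then show ?thesis
      using \<phi>_closed[OF that(1)] \<phi>_closed[OF that(2)] \<phi>_closed[OF F_diff_closed[OF that]]
      by (metis N.l_zero N.add.r_cancel_one')
  qed
  have R0: "\<phi> r = \<zero>\<^bsub>N\<^esub>" if r: "r \<in> R" for r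
  proof -
    consider (left) x y v where "r = frag_of (x \<oplus>\<^bsub>A\<^esub> y, v) - (frag_of (x, v) + frag_of (y, v))"
        "x \<in> carrier A" "y \<in> carrier A" "v \<in> carrier M"
      | (right) x v w where "r = frag_of (x, v \<oplus>\<^bsub>M\<^esub> w) - (frag_of (x, v) + frag_of (x, w))"
        "x \<in> carrier A" "v \<in> carrier M" "w \<in> carrier M"
      | (bal) x b v where "r = frag_of (x \<otimes>\<^bsub>A\<^esub> b, v) - frag_of (x, b \<odot>\<^bsub>M\<^esub> v)"
        "x \<in> carrier A" "b \<in> B" "v \<in> carrier M"
      using r unfolding balanced_relators_def tensor_relators_def diff_diff_eq by blast
    then show ?thesis
    proof cases
      case left
      then show ?thesis
        unfolding left(1)
        by (subst \<phi>_diff; (intro frag_of_F F_add_closed)?)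
          (simp_all add: \<phi>_add \<phi>f N_l g(1) del: carrier_free_Abelian_group_iff)
    next
      case right
      then show ?thesis
        unfolding right(1)
        by (subst \<phi>_diff; (intro frag_of_F F_add_closed)?)
          (simp_all add: \<phi>_add \<phi>f N_r g del: carrier_free_Abelian_group_iff)
    next
      case bal
      then have "b \<in> carrier A" "b \<odot>\<^bsub>M\<^esub> v \<in> carrier M"
        using B B_smult by auto
      then show ?thesis
        unfolding bal(1) using bal
        by (subst \<phi>_diff; (intro frag_of_F)?) (simp_all add: \<phi>f N_m g del: carrier_free_Abelian_group_iff)
    qed
  qed
  have K0: "\<phi> k = \<zero>\<^bsub>N\<^esub>" if "k \<in> K" for k
    using that
  proof induction
    case (inv h)
    have "\<phi> (inv\<^bsub>F\<^esub> h) = inv\<^bsub>?N\<^esub> \<phi> h"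
      using \<phi>.hom_inv inv R_F by blast
    then show ?case
      unfolding R0[OF inv] N.add.inv_one .
  next
    case (eng h1 h2)
    have "\<phi> (h1 \<otimes>\<^bsub>F\<^esub> h2) = \<phi> h1 \<otimes>\<^bsub>?N\<^esub> \<phi> h2"
      using eng(1,2) K_F by (intro \<phi>.hom_mult) blast+
    then show ?case
      unfolding eng.IH by simp
  next
    case one
    show ?case using \<phi>.hom_one by simp
  next
    case (incl h)
    then show ?case by (rule R0)
  qed
  have wd: "\<phi> f = \<phi> f'" if "f \<in> carrier F" "f' \<in> carrier F" "K #>\<^bsub>F\<^esub> f = K #>\<^bsub>F\<^esub> f'" for f f'
    using \<phi>_diff[OF that(1,2)] K0[OF coset_eqD[OF that]] by simp
  obtain h where h: "h \<in> hom (F Mod K) ?N" "\<And>f. f \<in> carrier F \<Longrightarrow> h (K #>\<^bsub>F\<^esub> f) = \<phi> f"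
    using FactGroup_universal[OF \<phi>(1) K.normal_axioms wd] by blast
  have hE: "h \<in> hom (add_monoid Ext) ?N"
    using h(1) unfolding hom_def by simp
  have \<phi>_translate: "\<phi> (translate a f) = a \<odot>\<^bsub>N\<^esub> \<phi> f" if a: "a \<in> carrier A" and "f \<in> carrier F" for a f
    using that(2)
  proof (induction rule: F_induct)
    case zero
    have "a \<odot>\<^bsub>N\<^esub> \<zero>\<^bsub>N\<^esub> = \<zero>\<^bsub>N\<^esub>"
      using N_r[OF a, of "\<zero>\<^bsub>N\<^esub>" "\<zero>\<^bsub>N\<^esub>"] N_closed[OF a, of "\<zero>\<^bsub>N\<^esub>"] N.add.r_cancel_one' by fastforce
    then show ?case using \<phi>.hom_one by simp
  next
    case (one b x)
    then show ?case
      using a g(1) N_m by (simp add: \<phi>f)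
  next
    case (diff f f')
    note d = F_diff_closed[OF diff(1,2)]
    have "\<phi> (translate a (f - f')) \<oplus>\<^bsub>N\<^esub> \<phi> (translate a f') = \<phi> (translate a f)"
      using \<phi>_add[OF translate_closed[OF a d] translate_closed[OF a diff(2)]] by simp
    moreover have "a \<odot>\<^bsub>N\<^esub> \<phi> (f - f') \<oplus>\<^bsub>N\<^esub> a \<odot>\<^bsub>N\<^esub> \<phi> f' = a \<odot>\<^bsub>N\<^esub> \<phi> f"
      using N_r[OF a \<phi>_closed[OF d] \<phi>_closed[OF diff(2)]] \<phi>_add[OF d diff(2)] by simp
    ultimately show ?case
      using diff N_closed[OF a \<phi>_closed[OF d]] N_closed[OF a \<phi>_closed[OF diff(2)]]
        \<phi>_closed[OF translate_closed[OF a d]]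
      by (metis N.add.r_cancel)
  qed
  show ?thesis
  proof (intro bexI[OF _ hE] conjI ballI)
    show "h (tens a x) = a \<odot>\<^bsub>N\<^esub> g x" if "a \<in> carrier A" "x \<in> carrier M" for a x
      unfolding tens_def using h(2)[OF frag_of_F[OF that]] \<phi>f[OF that] by simp
    show "h (a \<odot>\<^bsub>Ext\<^esub> z) = a \<odot>\<^bsub>N\<^esub> h z" if a: "a \<in> carrier A" and z: "z \<in> carrier Ext" for a z
    proof -
      obtain f where f: "f \<in> carrier F" "z = K #>\<^bsub>F\<^esub> f"
        using z by (rule Ext_cases)
      show ?thesis
        unfolding f(2) Ext_smult[OF a f(1)] h(2)[OF f(1)] h(2)[OF translate_closed[OF a f(1)]]
        by (rule \<phi>_translate[OF a f(1)])
    qed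
  qed
qed

end

section \<open>Abelian groups as a type\<close>

text \<open>As for \<^typ>\<open>uq\<close>, the product of all abelian groups on the type \<open>'a\<close> makes the type class
  \<^class>\<open>ab_group_add\<close> available for the carrier of any of them.\<close>

typedef 'a grp_prod = "{f :: 'a monoid \<Rightarrow> 'a. \<forall>G. (comm_group G \<longrightarrow> f G \<in> carrier G) \<and> (\<not> comm_group G \<longrightarrow> f G = undefined)}"
  by (rule exI[of _ "\<lambda>G. if comm_group G then \<one>\<^bsub>G\<^esub> else undefined"])
    (simp add: monoid.one_closed[OF comm_monoid.axioms(1)[OF comm_group.axioms(1)]])

setup_lifting type_definition_grp_prod

lemma comm_group_laws:
  assumes "comm_group G"
  shows "\<one>\<^bsub>G\<^esub> \<in> carrier G" "x \<in> carrier G \<Longrightarrow> inv\<^bsub>G\<^esub> x \<in> carrier G"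
    "x \<in> carrier G \<Longrightarrow> y \<in> carrier G \<Longrightarrow> x \<otimes>\<^bsub>G\<^esub> y \<in> carrier G"
    "x \<in> carrier G \<Longrightarrow> y \<in> carrier G \<Longrightarrow> z \<in> carrier G \<Longrightarrow> x \<otimes>\<^bsub>G\<^esub> y \<otimes>\<^bsub>G\<^esub> z = x \<otimes>\<^bsub>G\<^esub> (y \<otimes>\<^bsub>G\<^esub> z)"
    "x \<in> carrier G \<Longrightarrow> y \<in> carrier G \<Longrightarrow> x \<otimes>\<^bsub>G\<^esub> y = y \<otimes>\<^bsub>G\<^esub> x"
    "x \<in> carrier G \<Longrightarrow> \<one>\<^bsub>G\<^esub> \<otimes>\<^bsub>G\<^esub> x = x"
    "x \<in> carrier G \<Longrightarrow> inv\<^bsub>G\<^esub> x \<otimes>\<^bsub>G\<^esub> x = \<one>\<^bsub>G\<^esub>"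
proof -
  interpret comm_group G by fact
  show "\<one>\<^bsub>G\<^esub> \<in> carrier G" "x \<in> carrier G \<Longrightarrow> inv\<^bsub>G\<^esub> x \<in> carrier G"
    "x \<in> carrier G \<Longrightarrow> y \<in> carrier G \<Longrightarrow> x \<otimes>\<^bsub>G\<^esub> y \<in> carrier G"
    "x \<in> carrier G \<Longrightarrow> y \<in> carrier G \<Longrightarrow> z \<in> carrier G \<Longrightarrow> x \<otimes>\<^bsub>G\<^esub> y \<otimes>\<^bsub>G\<^esub> z = x \<otimes>\<^bsub>G\<^esub> (y \<otimes>\<^bsub>G\<^esub> z)"
    "x \<in> carrier G \<Longrightarrow> y \<in> carrier G \<Longrightarrow> x \<otimes>\<^bsub>G\<^esub> y = y \<otimes>\<^bsub>G\<^esub> x"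
    "x \<in> carrier G \<Longrightarrow> \<one>\<^bsub>G\<^esub> \<otimes>\<^bsub>G\<^esub> x = x"
    "x \<in> carrier G \<Longrightarrow> inv\<^bsub>G\<^esub> x \<otimes>\<^bsub>G\<^esub> x = \<one>\<^bsub>G\<^esub>"
    by (auto simp: m_assoc) (rule m_comm)
qed

instantiation grp_prod :: (type) ab_group_add
begin

lift_definition zero_grp_prod :: "'a grp_prod" is "\<lambda>G. if comm_group G then \<one>\<^bsub>G\<^esub> else undefined"
  by (simp add: comm_group_laws)
lift_definition plus_grp_prod :: "'a grp_prod \<Rightarrow> 'a grp_prod \<Rightarrow> 'a grp_prod" is
  "\<lambda>f g G. if comm_group G then f G \<otimes>\<^bsub>G\<^esub> g G else undefined"
  by (simp add: comm_group_laws)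
lift_definition uminus_grp_prod :: "'a grp_prod \<Rightarrow> 'a grp_prod" is
  "\<lambda>f G. if comm_group G then inv\<^bsub>G\<^esub> f G else undefined"
  by (simp add: comm_group_laws)
lift_definition minus_grp_prod :: "'a grp_prod \<Rightarrow> 'a grp_prod \<Rightarrow> 'a grp_prod" is
  "\<lambda>f g G. if comm_group G then f G \<otimes>\<^bsub>G\<^esub> inv\<^bsub>G\<^esub> g G else undefined"
  by (simp add: comm_group_laws)

instance
proof
  fix a b c :: "'a grp_prod"
  show "a + b + c = a + (b + c)"
    by transfer (auto simp: fun_eq_iff comm_group_laws(4))
  show "a + b = b + a"
    by transfer (auto simp: fun_eq_iff comm_group_laws(5))
  show "0 + a = a"
    by transfer (auto simp: fun_eq_iff comm_group_laws(6) split: if_splits)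
  show "- a + a = 0"
    by transfer (auto simp: fun_eq_iff comm_group_laws(7) split: if_splits)
  show "a - b = a + - b"
    by transfer (auto simp: fun_eq_iff)
qed

end

lift_definition grp_at :: "'a monoid \<Rightarrow> 'a grp_prod \<Rightarrow> 'a" is "\<lambda>G f. f G" .

lift_definition grp_embed :: "'a monoid \<Rightarrow> 'a \<Rightarrow> 'a grp_prod" is
  "\<lambda>G x H. if comm_group H then if H = G \<and> x \<in> carrier G then x else \<one>\<^bsub>H\<^esub> else undefined"
  by (simp add: comm_group_laws)

lemma grp_at_embed: "comm_group G \<Longrightarrow> x \<in> carrier G \<Longrightarrow> grp_at G (grp_embed G x) = x"
  by transfer simp

lemma grp_embed_mult:
  assumes "comm_group G" "x \<in> carrier G" "y \<in> carrier G"
  shows "grp_embed G (x \<otimes>\<^bsub>G\<^esub> y) = grp_embed G x + grp_embed G y"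
  using assms by transfer (auto simp: fun_eq_iff comm_group_laws)

locale additive_type = M: abelian_group M for M :: "('a, 'v) module"
begin

definition grp :: "'v monoid" where
  "grp = \<lparr>carrier = carrier M, monoid.mult = add M, one = \<zero>\<^bsub>M\<^esub>\<rparr>"

definition el :: "'v \<Rightarrow> 'v grp_prod" where "el = grp_embed grp"

definition un :: "'v grp_prod \<Rightarrow> 'v" where "un = grp_at grp"

lemma comm_group_grp: "comm_group grp"
proof (rule comm_groupI)
  show "\<exists>y\<in>carrier grp. y \<otimes>\<^bsub>grp\<^esub> x = \<one>\<^bsub>grp\<^esub>" if "x \<in> carrier grp" for x
    using that by (intro bexI[of _ "\<ominus>\<^bsub>M\<^esub> x"]) (auto simp: grp_def M.l_neg)
qed (auto simp: grp_def M.a_assoc intro: M.a_comm)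

lemma un_el [simp]: "x \<in> carrier M \<Longrightarrow> un (el x) = x"
  unfolding un_def el_def by (rule grp_at_embed[OF comm_group_grp]) (simp add: grp_def)

lemma el_inj: "x \<in> carrier M \<Longrightarrow> y \<in> carrier M \<Longrightarrow> el x = el y \<longleftrightarrow> x = y"
  using un_el by metis

lemma el_add: "x \<in> carrier M \<Longrightarrow> y \<in> carrier M \<Longrightarrow> el (x \<oplus>\<^bsub>M\<^esub> y) = el x + el y"
  unfolding el_def using grp_embed_mult[OF comm_group_grp, of x y] by (simp add: grp_def)

lemma el_zero: "el \<zero>\<^bsub>M\<^esub> = 0"
  using el_add[of "\<zero>\<^bsub>M\<^esub>" "\<zero>\<^bsub>M\<^esub>"] by simp

lemma el_eq_0: "x \<in> carrier M \<Longrightarrow> el x = 0 \<longleftrightarrow> x = \<zero>\<^bsub>M\<^esub>"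
  using el_inj[of x "\<zero>\<^bsub>M\<^esub>"] el_zero by simp

lemma el_neg: "x \<in> carrier M \<Longrightarrow> el (\<ominus>\<^bsub>M\<^esub> x) = - el x"
  using el_add[of "\<ominus>\<^bsub>M\<^esub> x" x] el_zero M.l_neg[of x] by (simp add: eq_neg_iff_add_eq_0)

lemma el_diff: "x \<in> carrier M \<Longrightarrow> y \<in> carrier M \<Longrightarrow> el (x \<ominus>\<^bsub>M\<^esub> y) = el x - el y"
  by (simp add: M.minus_eq el_add el_neg)

lemma addsub_image:
  assumes "\<zero>\<^bsub>M\<^esub> \<in> N" "N \<subseteq> carrier M" "\<And>x y. x \<in> N \<Longrightarrow> y \<in> N \<Longrightarrow> x \<ominus>\<^bsub>M\<^esub> y \<in> N"
  shows "addsub (el ` N)"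
  unfolding addsub_def
proof (intro conjI ballI)
  show "0 \<in> el ` N" using assms(1) el_zero by force
  fix x y assume "x \<in> el ` N" "y \<in> el ` N"
  then show "x - y \<in> el ` N" using assms el_diff by (smt (verit) image_iff subsetD)
qed

lemma subgroup_of_addsub:
  assumes "addsub N"
  shows "subgroup {x \<in> carrier M. el x \<in> N} (add_monoid M)"
proof (intro M.add.subgroupI)
  show "\<ominus>\<^bsub>M\<^esub> x \<in> {x \<in> carrier M. el x \<in> N}" if "x \<in> {x \<in> carrier M. el x \<in> N}" for x
    using that el_neg addsub_minus[OF assms] by simp
qed (use assms el_add el_zero addsub_closed[OF assms] in auto)

end

section \<open>Distribution algebras and their modules\<close>

definition odd_units :: "nat \<Rightarrow> nat \<Rightarrow> uq set" where
  "odd_units m n = {uq_unit m n i j | i j. (i, j) \<in> I1 m n} \<union> {uq_unit m n j i | i j. (i, j) \<in> I1 m n}"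

lemma UZ_generators: "even_generators m n \<union> {e_divpow m n i j 1 | i j. (i, j) \<in> I1 m n} \<union>
    {e_divpow m n j i 1 | i j. (i, j) \<in> I1 m n} = uq_component m n ` (uq.even_gens m n \<union> odd_units m n)"
proof -
  have "e_divpow m n i j 1 = uq_component m n (uq_unit m n i j)"
    "e_divpow m n j i 1 = uq_component m n (uq_unit m n j i)" if "(i, j) \<in> I1 m n" for i j
    using I1_D[OF that] uq_component_divpow[of i m n j 1] uq_component_divpow[of j m n i 1] by simp_all
  then show ?thesis
    unfolding odd_units_def image_Un even_generators_component Un_assoc setcompr_eq_image image_image
    by (intro arg_cong2[where f = "(\<union>)"] refl; (intro equalityI subsetI; clarsimp simp: image_iff; metis))
qed

lemma UZ_eq: "UZ m n = (UQ m n)\<lparr>carrier := generate_ring (UQ m n) (uq_component m n ` (uq.even_gens m n \<union> odd_units m n))\<rparr>"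
  unfolding UZ_def UZ_generators ..

lemma UZ_simps [simp]:
  "u \<otimes>\<^bsub>UZ m n\<^esub> v = u \<otimes>\<^bsub>UQ m n\<^esub> v" "u \<oplus>\<^bsub>UZ m n\<^esub> v = u \<oplus>\<^bsub>UQ m n\<^esub> v"
  "\<one>\<^bsub>UZ m n\<^esub> = \<one>\<^bsub>UQ m n\<^esub>" "\<zero>\<^bsub>UZ m n\<^esub> = \<zero>\<^bsub>UQ m n\<^esub>"
  by (simp_all add: UZ_eq)

lemma UZ_carrier: "carrier (UZ m n) = generate_ring (UQ m n) (uq_component m n ` (uq.even_gens m n \<union> odd_units m n))"
  by (simp add: UZ_eq)

lemma ring_UZ: "ring (UZ m n)"
  unfolding UZ_eq by (intro ring.generate_ring_is_ring[OF ring_UQ]) auto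

definition uz :: "nat \<Rightarrow> nat \<Rightarrow> uq set" where
  "uz m n = {u. uq_component m n u \<in> carrier (UZ m n)}"

lemma subrng_uz: "subrng (uz m n)"
  unfolding subrng_def uz_def UZ_carrier
  by (auto simp: a_minus_def intro: generate_ring.intros)

lemma uz_gens: "uq.even_gens m n \<union> odd_units m n \<subseteq> uz m n"
  unfolding uz_def UZ_carrier by (auto intro!: generate_ring.incl)

lemma ring_type_simps [simp]:
  "carrier (ring_of_type_algebra :: 'f::comm_ring_1 ring) = UNIV"
  "\<one>\<^bsub>ring_of_type_algebra\<^esub> = (1 :: 'f)" "\<zero>\<^bsub>ring_of_type_algebra\<^esub> = (0 :: 'f)"
  "a \<otimes>\<^bsub>ring_of_type_algebra\<^esub> b = (a * b :: 'f)" "a \<oplus>\<^bsub>ring_of_type_algebra\<^esub> b = (a + b :: 'f)"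
  by (simp_all add: ring_of_type_algebra_def)

lemma tensor_UZ: "tensor_of_rings (UZ m n) (ring_of_type_algebra :: 'f::field ring)"
  by (intro tensor_of_rings.intro ring_UZ ring_from_type_algebra)

text \<open>\<open>u \<otimes> c\<close>, for \<open>u\<close> in the integral form.\<close>

definition dtens :: "nat \<Rightarrow> nat \<Rightarrow> uq \<Rightarrow> 'f::field \<Rightarrow> 'f dist" where
  "dtens m n u c = pure_tensor (UZ m n) ring_of_type_algebra (uq_component m n u) c"

lemma ring_Dist_G: "ring (Dist_G m n :: 'f::field dist ring)"
  unfolding Dist_G_def ring_tensor_def
  by (intro ideal.quotient_is_ring tensor_of_rings.ideal_tensor_ideal tensor_UZ)

lemma dtens_closed: "u \<in> uz m n \<Longrightarrow> dtens m n u c \<in> carrier (Dist_G m n)"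
  unfolding dtens_def Dist_G_def uz_def by (simp add: tensor_of_rings.pure_closed[OF tensor_UZ])

lemma dtens_mult: "u \<in> uz m n \<Longrightarrow> v \<in> uz m n \<Longrightarrow>
    dtens m n u c \<otimes>\<^bsub>Dist_G m n\<^esub> dtens m n v d = dtens m n (u * v) (c * d)"
  unfolding dtens_def Dist_G_def uz_def by (simp add: tensor_of_rings.pure_mult[OF tensor_UZ])

lemma dtens_one: "\<one>\<^bsub>Dist_G m n\<^esub> = dtens m n 1 1"
  unfolding dtens_def Dist_G_def by (simp add: tensor_of_rings.pure_one[OF tensor_UZ])

lemma dtens_add_left: "u \<in> uz m n \<Longrightarrow> v \<in> uz m n \<Longrightarrow>
    dtens m n (u + v) c = dtens m n u c \<oplus>\<^bsub>Dist_G m n\<^esub> dtens m n v c"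
  unfolding dtens_def Dist_G_def uz_def using tensor_of_rings.pure_add_left[OF tensor_UZ, of "uq_component m n u" m n "uq_component m n v" c] by simp

lemma dtens_add_right: "u \<in> uz m n \<Longrightarrow>
    dtens m n u (c + d) = dtens m n u c \<oplus>\<^bsub>Dist_G m n\<^esub> dtens m n u d"
  unfolding dtens_def Dist_G_def uz_def using tensor_of_rings.pure_add_right[OF tensor_UZ, of "uq_component m n u" m n c d] by simp

lemma dist_of_dtens: "dist_of m n (uq_component m n u) = dtens m n u 1"
  by (simp add: dist_of_def dtens_def)

lemma dist_scalar_dtens: "dist_scalar m n c = dtens m n 1 c"
  by (simp add: dist_scalar_def dtens_def)

lemma dtens_split: "u \<in> uz m n \<Longrightarrow>
    dtens m n u c = dtens m n u 1 \<otimes>\<^bsub>Dist_G m n\<^esub> dtens m n 1 c"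
  using dtens_mult[of u m n 1 1 c] subrng_1[OF subrng_uz] by simp

lemma dtens_diff:
  assumes "u \<in> uz m n" "v \<in> uz m n"
  shows "dtens m n (u - v) c = dtens m n u c \<ominus>\<^bsub>Dist_G m n\<^esub> dtens m n v c"
proof -
  interpret ring "Dist_G m n :: 'a dist ring" by (rule ring_Dist_G)
  have uv: "u - v \<in> uz m n"
    using subrng_diff[OF subrng_uz] assms by blast
  have "dtens m n u c = dtens m n (u - v) c \<oplus>\<^bsub>Dist_G m n\<^esub> dtens m n v c"
    using dtens_add_left[OF uv assms(2), of c] by simp
  then show ?thesis
    using dtens_closed[OF assms(1), of c] dtens_closed[OF assms(2), of c] dtens_closed[OF uv, of c] by algebra
qed

definition ev_gens :: "nat \<Rightarrow> nat \<Rightarrow> ('f::field) dist set" where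
  "ev_gens m n = range (dist_scalar m n) \<union> (\<lambda>u. dtens m n u 1) ` uq.even_gens m n"

definition all_gens :: "nat \<Rightarrow> nat \<Rightarrow> ('f::field) dist set" where
  "all_gens m n = range (dist_scalar m n) \<union> (\<lambda>u. dtens m n u 1) ` (uq.even_gens m n \<union> odd_units m n)"

lemma gens_closed: "ev_gens m n \<subseteq> carrier (Dist_G m n)" "all_gens m n \<subseteq> carrier (Dist_G m n)"
  unfolding ev_gens_def all_gens_def dist_scalar_dtens
  using dtens_closed subrng_1[OF subrng_uz] uz_gens by blast+

lemma Dist_Gev_eq: "Dist_Gev m n = (Dist_G m n)\<lparr>carrier := generate_ring (Dist_G m n) (ev_gens m n)\<rparr>"
  unfolding Dist_Gev_def ev_gens_def even_generators_component image_image dist_of_dtens ..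

lemma carrier_Dist_G: "carrier (Dist_G m n) = generate_ring (Dist_G m n) (all_gens m n :: 'f::field dist set)"
proof
  interpret ring "Dist_G m n :: 'f dist ring" by (rule ring_Dist_G)
  let ?G = "generate_ring (Dist_G m n) (all_gens m n :: 'f dist set)"
  show "?G \<subseteq> carrier (Dist_G m n)"
    by (rule generate_ring_incl[OF gens_closed(2)])
  have S: "subring ?G (Dist_G m n)"
    by (rule generate_ring_is_subring[OF gens_closed(2)])
  have gens: "dtens m n u 1 \<in> ?G" if "u \<in> uq.even_gens m n \<union> odd_units m n" for u
    using that by (intro generate_ring.incl) (auto simp: all_gens_def)
  have *: "\<exists>w. w \<in> uz m n \<and> uq_component m n w = u \<and> dtens m n w 1 \<in> ?G" if "u \<in> carrier (UZ m n)" for u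
    using that unfolding UZ_carrier
  proof induction
    case one
    have "dtens m n 1 1 \<in> ?G"
      unfolding dtens_one[symmetric] by (rule generate_ring.one)
    then show ?case
      using subrng_1[OF subrng_uz] by (intro exI[of _ 1]) simp
  next
    case (incl h)
    then show ?case using gens uz_gens by blast
  next
    case (a_inv h)
    then obtain w where w: "w \<in> uz m n" "uq_component m n w = h" "dtens m n w 1 \<in> ?G" by blast
    have diff: "dtens m n (x - y) 1 \<in> ?G"
      if "x \<in> uz m n" "y \<in> uz m n" "dtens m n x 1 \<in> ?G" "dtens m n y 1 \<in> ?G" for x y
      unfolding dtens_diff[OF that(1,2)] a_minus_def using that
      by (intro generate_ring.eng_add generate_ring.a_inv)
    have 1: "1 \<in> uz m n" "dtens m n 1 1 \<in> ?G"
      unfolding dtens_one[symmetric] using subrng_1[OF subrng_uz] generate_ring.one by blast+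
    have "dtens m n (1 - 1 - w) 1 \<in> ?G"
      by (intro diff 1 w subrng_diff[OF subrng_uz])
    then show ?case
      using w subrng_minus[OF subrng_uz] by (intro exI[of _ "- w"]) simp
  next
    case (eng_add h k)
    then obtain w x where w: "w \<in> uz m n" "uq_component m n w = h" "dtens m n w 1 \<in> ?G"
      "x \<in> uz m n" "uq_component m n x = k" "dtens m n x 1 \<in> ?G" by blast
    then show ?case
      using subrng_add[OF subrng_uz] by (intro exI[of _ "w + x"]) (simp add: dtens_add_left generate_ring.eng_add)
  next
    case (eng_mult h k)
    then obtain w x where w: "w \<in> uz m n" "uq_component m n w = h" "dtens m n w 1 \<in> ?G"
      "x \<in> uz m n" "uq_component m n x = k" "dtens m n x 1 \<in> ?G" by blast
    have "dtens m n (w * x) (1 * 1) \<in> ?G"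
      unfolding dtens_mult[OF w(1,4), symmetric] using w by (intro generate_ring.eng_mult)
    then show ?case
      using w subrng_mult[OF subrng_uz] by (intro exI[of _ "w * x"]) simp
  qed
  show "carrier (Dist_G m n) \<subseteq> ?G"
  proof
    fix t :: "'f dist" assume "t \<in> carrier (Dist_G m n)"
    then have "t \<in> carrier (ring_tensor (UZ m n) ring_of_type_algebra)"
      by (simp add: Dist_G_def)
    then show "t \<in> ?G"
    proof (induction rule: tensor_of_rings.tensor_induct[OF tensor_UZ, consumes 1, case_names pure zero diff])
      case (pure u c)
      obtain w where w: "w \<in> uz m n" "uq_component m n w = u" "dtens m n w (1 :: 'f) \<in> ?G"
        using *[OF pure(1)] by blast
      have "dtens m n w 1 \<otimes>\<^bsub>Dist_G m n\<^esub> dist_scalar m n c \<in> ?G"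
        by (rule generate_ring.eng_mult[OF w(3) generate_ring.incl]) (simp add: all_gens_def)
      then show ?case
        using dtens_split[OF w(1), of c] w(2) unfolding dist_scalar_dtens dtens_def by simp
    next
      case zero
      then show ?case using zero_in_generate by (simp add: Dist_G_def)
    next
      case (diff t u)
      then show ?case
        unfolding a_minus_def Dist_G_def[symmetric] by (intro generate_ring.eng_add generate_ring.a_inv)
    qed
  qed
qed

lemma Dist_G_eq: "Dist_G m n = (Dist_G m n)\<lparr>carrier := generate_ring (Dist_G m n) (all_gens m n)\<rparr>"
  unfolding carrier_Dist_G[symmetric] by simp

locale dist_module = additive_type M
  for m n :: nat and Gs :: "('f::field) dist set" and M :: "('f dist, 'v) module" +
  assumes Gs: "ev_gens m n \<subseteq> Gs" "Gs \<subseteq> carrier (Dist_G m n)"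
    and left: "left_module ((Dist_G m n)\<lparr>carrier := generate_ring (Dist_G m n) Gs\<rparr>) M"
begin

definition K :: "'f dist set" where "K = generate_ring (Dist_G m n) Gs"

definition Z :: "uq set" where "Z = {u \<in> uz m n. dtens m n u 1 \<in> K}"

definition act :: "uq \<Rightarrow> 'v grp_prod \<Rightarrow> 'v grp_prod" where
  "act u x = el (dtens m n u 1 \<odot>\<^bsub>M\<^esub> un x)"

definition sc :: "'f \<Rightarrow> 'v grp_prod \<Rightarrow> 'v grp_prod" where
  "sc c x = el (dist_scalar m n c \<odot>\<^bsub>M\<^esub> un x)"

lemma smult_closed: "a \<in> K \<Longrightarrow> x \<in> carrier M \<Longrightarrow> a \<odot>\<^bsub>M\<^esub> x \<in> carrier M"
  and smult_add_left: "a \<in> K \<Longrightarrow> b \<in> K \<Longrightarrow> x \<in> carrier M \<Longrightarrow>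
    (a \<oplus>\<^bsub>Dist_G m n\<^esub> b) \<odot>\<^bsub>M\<^esub> x = a \<odot>\<^bsub>M\<^esub> x \<oplus>\<^bsub>M\<^esub> b \<odot>\<^bsub>M\<^esub> x"
  and smult_add_right: "a \<in> K \<Longrightarrow> x \<in> carrier M \<Longrightarrow> y \<in> carrier M \<Longrightarrow>
    a \<odot>\<^bsub>M\<^esub> (x \<oplus>\<^bsub>M\<^esub> y) = a \<odot>\<^bsub>M\<^esub> x \<oplus>\<^bsub>M\<^esub> a \<odot>\<^bsub>M\<^esub> y"
  and smult_mult: "a \<in> K \<Longrightarrow> b \<in> K \<Longrightarrow> x \<in> carrier M \<Longrightarrow>
    (a \<otimes>\<^bsub>Dist_G m n\<^esub> b) \<odot>\<^bsub>M\<^esub> x = a \<odot>\<^bsub>M\<^esub> (b \<odot>\<^bsub>M\<^esub> x)"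
  and smult_one: "x \<in> carrier M \<Longrightarrow> \<one>\<^bsub>Dist_G m n\<^esub> \<odot>\<^bsub>M\<^esub> x = x"
  using left unfolding left_module_def module_axioms_def K_def by simp_all

lemma scalar_K: "dist_scalar m n c \<in> K"
  unfolding K_def using Gs(1) by (intro generate_ring.incl) (auto simp: ev_gens_def)

lemma even_Z: "uq.even_gens m n \<subseteq> Z"
  unfolding Z_def K_def using Gs(1) uz_gens by (auto intro!: generate_ring.incl simp: ev_gens_def)

lemma one_K: "\<one>\<^bsub>Dist_G m n\<^esub> \<in> K"
  and neg_K: "a \<in> K \<Longrightarrow> \<ominus>\<^bsub>Dist_G m n\<^esub> a \<in> K"
  and add_K: "a \<in> K \<Longrightarrow> b \<in> K \<Longrightarrow> a \<oplus>\<^bsub>Dist_G m n\<^esub> b \<in> K"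
  and mult_K: "a \<in> K \<Longrightarrow> b \<in> K \<Longrightarrow> a \<otimes>\<^bsub>Dist_G m n\<^esub> b \<in> K"
  unfolding K_def by (auto intro: generate_ring.intros)

lemma subrng_Z: "subrng Z"
  unfolding subrng_def
proof (intro conjI ballI)
  show "1 \<in> Z"
    using subrng_1[OF subrng_uz] one_K unfolding Z_def dtens_one by simp
  fix u w assume uw: "u \<in> Z" "w \<in> Z"
  then have uz: "u \<in> uz m n" "w \<in> uz m n" and K: "dtens m n u 1 \<in> K" "dtens m n w 1 \<in> K"
    by (auto simp: Z_def)
  have "dtens m n (u - w) 1 \<in> K"
    unfolding dtens_diff[OF uz] a_minus_def using K by (intro add_K neg_K)
  then show "u - w \<in> Z"
    using subrng_diff[OF subrng_uz uz] by (simp add: Z_def)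
  have "dtens m n (u * w) (1 * 1) \<in> K"
    unfolding dtens_mult[OF uz, symmetric] using K by (intro mult_K)
  then show "u * w \<in> Z"
    using subrng_mult[OF subrng_uz uz] by (simp add: Z_def)
qed

lemma K_carrier: "K \<subseteq> carrier (Dist_G m n)"
  unfolding K_def by (rule ring.generate_ring_incl[OF ring_Dist_G Gs(2)])

sublocale V: gl_module m n "uq_unit m n" Z "el ` carrier M" act sc
proof
  show "addsub (el ` carrier M)"
    by (rule addsub_image) auto
  fix u w :: uq and x y :: "'v grp_prod" and c d :: 'f
  show "act u x \<in> el ` carrier M" if "u \<in> Z" "x \<in> el ` carrier M"
    using that smult_closed by (auto simp: act_def Z_def)
  show "act (u + w) x = act u x + act w x" if "u \<in> Z" "w \<in> Z" "x \<in> el ` carrier M"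
    using that by (auto simp: act_def Z_def dtens_add_left smult_add_left smult_closed el_add)
  show "act u (x + y) = act u x + act u y" if "u \<in> Z" "x \<in> el ` carrier M" "y \<in> el ` carrier M"
    using that by (auto simp: act_def Z_def smult_add_right smult_closed el_add[symmetric])
  show "act (u * w) x = act u (act w x)" if "u \<in> Z" "w \<in> Z" "x \<in> el ` carrier M"
  proof -
    have "dtens m n (u * w) 1 = dtens m n u 1 \<otimes>\<^bsub>Dist_G m n\<^esub> dtens m n w (1 :: 'f)"
      using that by (simp add: Z_def dtens_mult)
    then show ?thesis
      using that by (auto simp: act_def Z_def smult_mult smult_closed)
  qed
  show "act 1 x = x" if "x \<in> el ` carrier M"
    using that by (auto simp: act_def dtens_one[symmetric] smult_one)
  show "sc c x \<in> el ` carrier M" if "x \<in> el ` carrier M"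
    using that smult_closed[OF scalar_K] by (auto simp: sc_def)
  have 1: "1 \<in> uz m n" by (rule subrng_1[OF subrng_uz])
  show "sc (c + d) x = sc c x + sc d x" if "x \<in> el ` carrier M"
  proof -
    have "dist_scalar m n (c + d) = dist_scalar m n c \<oplus>\<^bsub>Dist_G m n\<^esub> dist_scalar m n d"
      by (simp add: dist_scalar_dtens dtens_add_right[OF 1])
    then show ?thesis
      using that scalar_K by (auto simp: sc_def smult_add_left smult_closed el_add)
  qed
  show "sc c (x + y) = sc c x + sc c y" if "x \<in> el ` carrier M" "y \<in> el ` carrier M"
    using that scalar_K by (auto simp: sc_def smult_add_right smult_closed el_add[symmetric])
  show "sc (c * d) x = sc c (sc d x)" if "x \<in> el ` carrier M"
  proof -
    have "dist_scalar m n (c * d) = dist_scalar m n c \<otimes>\<^bsub>Dist_G m n\<^esub> dist_scalar m n d"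
      using dtens_mult[OF 1 1, of c d] by (simp add: dist_scalar_dtens)
    then show ?thesis
      using that scalar_K by (auto simp: sc_def smult_mult smult_closed)
  qed
  show "sc 1 x = x" if "x \<in> el ` carrier M"
    using that by (auto simp: sc_def dist_scalar_dtens dtens_one[symmetric] smult_one)
  show "act u (sc c x) = sc c (act u x)" if "u \<in> Z" "x \<in> el ` carrier M"
  proof -
    have u: "u \<in> uz m n" "dtens m n u 1 \<in> K"
      using that by (auto simp: Z_def)
    have "dtens m n u 1 \<otimes>\<^bsub>Dist_G m n\<^esub> dist_scalar m n c = dist_scalar m n c \<otimes>\<^bsub>Dist_G m n\<^esub> dtens m n u 1"
      using dtens_mult[OF u(1) 1, of 1 c] dtens_mult[OF 1 u(1), of c 1] by (simp add: dist_scalar_dtens)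
    then show ?thesis
      using that u scalar_K by (auto simp: act_def sc_def smult_closed smult_mult[symmetric])
  qed
qed (use subrng_Z even_Z in auto)

lemma act_el: "x \<in> carrier M \<Longrightarrow> act u (el x) = el (dtens m n u 1 \<odot>\<^bsub>M\<^esub> x)"
  and sc_el: "x \<in> carrier M \<Longrightarrow> sc c (el x) = el (dist_scalar m n c \<odot>\<^bsub>M\<^esub> x)"
  by (simp_all add: act_def sc_def)

lemma wt_eq: "V.wt mu = el ` weight_space m n M mu"
proof -
  have "el x \<in> V.wt mu \<longleftrightarrow> x \<in> weight_space m n M mu" if x: "x \<in> carrier M" for x
  proof -
    have "act (binom (uq_unit m n i i) r) (el x) = sc (of_int (int_binomial (mu i) r)) (el x)
      \<longleftrightarrow> dist_of m n (h_binom m n i r) \<odot>\<^bsub>M\<^esub> x = dist_scalar m n (of_int (int_binomial (mu i) r)) \<odot>\<^bsub>M\<^esub> x"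
      if i: "i \<in> {1..m + n}" for i r
    proof -
      have "dtens m n (binom (uq_unit m n i i) r) 1 \<in> K"
        using V.binom_diag_Z[OF i, of r] by (simp add: Z_def)
      then show ?thesis
        unfolding uq_component_binom[OF i, symmetric] dist_of_dtens using x scalar_K
        by (simp add: act_el sc_el el_inj smult_closed)
    qed
    then show ?thesis
      using x unfolding V.wt_def weight_space_def by auto
  qed
  moreover have "weight_space m n M mu \<subseteq> carrier M" "V.wt mu \<subseteq> el ` carrier M"
    by (auto simp: weight_space_def V.wt_def)
  ultimately show ?thesis by blast
qed

lemma smult_neg:
  assumes h: "h \<in> K" and x: "x \<in> carrier M"
  shows "(\<ominus>\<^bsub>Dist_G m n\<^esub> h) \<odot>\<^bsub>M\<^esub> x = \<ominus>\<^bsub>M\<^esub> (h \<odot>\<^bsub>M\<^esub> x)"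
proof -
  interpret D: ring "Dist_G m n :: 'f dist ring" by (rule ring_Dist_G)
  have h': "h \<in> carrier (Dist_G m n)" using h K_carrier by blast
  have 0: "\<zero>\<^bsub>Dist_G m n\<^esub> \<in> K"
    unfolding K_def by (rule D.zero_in_generate)
  have "\<zero>\<^bsub>Dist_G m n\<^esub> \<odot>\<^bsub>M\<^esub> x = \<zero>\<^bsub>M\<^esub>"
    using smult_add_left[OF 0 0 x] smult_closed[OF 0 x] M.add.r_cancel_one' by fastforce
  then have "(\<ominus>\<^bsub>Dist_G m n\<^esub> h) \<odot>\<^bsub>M\<^esub> x \<oplus>\<^bsub>M\<^esub> h \<odot>\<^bsub>M\<^esub> x = \<zero>\<^bsub>M\<^esub>"
    using smult_add_left[OF neg_K[OF h] h x] D.l_neg[OF h'] by simp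
  then show ?thesis
    using smult_closed[OF h x] smult_closed[OF neg_K[OF h] x] M.minus_equality by metis
qed

lemma submodule_of_stable:
  assumes N: "addsub N" and stab: "\<And>g x. g \<in> Gs \<Longrightarrow> x \<in> carrier M \<Longrightarrow> el x \<in> N \<Longrightarrow> el (g \<odot>\<^bsub>M\<^esub> x) \<in> N"
  shows "submodule {x \<in> carrier M. el x \<in> N} ((Dist_G m n)\<lparr>carrier := generate_ring (Dist_G m n) Gs\<rparr>) M"
proof (intro submodule.intro subgroup_of_addsub[OF N] submodule_axioms.intro)
  fix a x
  assume "a \<in> carrier ((Dist_G m n)\<lparr>carrier := generate_ring (Dist_G m n) Gs\<rparr>)" and x: "x \<in> {x \<in> carrier M. el x \<in> N}"
  then have "a \<in> generate_ring (Dist_G m n) Gs" by simp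
  then have "\<forall>x \<in> carrier M. el x \<in> N \<longrightarrow> el (a \<odot>\<^bsub>M\<^esub> x) \<in> N"
  proof induction
    case one
    then show ?case by (simp add: smult_one)
  next
    case (incl h)
    then show ?case using stab by blast
  next
    case (a_inv h)
    have h: "h \<in> K" using a_inv(1) by (simp add: K_def)
    then show ?case
      using a_inv addsub_minus[OF N] by (simp add: smult_neg el_neg smult_closed)
  next
    case (eng_add h k)
    then have "h \<in> K" "k \<in> K" by (simp_all add: K_def)
    then show ?case
      using eng_add addsub_add[OF N] by (simp add: smult_add_left el_add smult_closed)
  next
    case (eng_mult h k)
    then have "h \<in> K" "k \<in> K" by (simp_all add: K_def)
    then show ?case
      using eng_mult by (simp add: smult_mult smult_closed)
  qed
  then show "a \<odot>\<^bsub>M\<^esub> x \<in> {x \<in> carrier M. el x \<in> N}"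
    using x smult_closed \<open>a \<in> generate_ring (Dist_G m n) Gs\<close> by (simp add: K_def)
qed

lemma smult_zero_right: "a \<in> K \<Longrightarrow> a \<odot>\<^bsub>M\<^esub> \<zero>\<^bsub>M\<^esub> = \<zero>\<^bsub>M\<^esub>"
  using smult_add_right[of a "\<zero>\<^bsub>M\<^esub>" "\<zero>\<^bsub>M\<^esub>"] smult_closed[of a "\<zero>\<^bsub>M\<^esub>"] M.add.r_cancel_one' by fastforce

end

section \<open>The typicality condition\<close>

lemma sum_eps:
  assumes "finite S"
  shows "(\<Sum>(a, b)\<in>S. eps a i - eps b i) = of_nat (card {x \<in> S. fst x = i}) - of_nat (card {x \<in> S. snd x = i})"
proof -
  have "of_nat (card {x \<in> S. P x}) = (\<Sum>x\<in>S. if P x then 1 else (0 :: rat))" for P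
    using assms by (simp add: sum.If_cases Int_def)
  then have "of_nat (card {x \<in> S. fst x = i}) - of_nat (card {x \<in> S. snd x = i})
      = (\<Sum>x\<in>S. (if fst x = i then 1 else 0) - (if snd x = i then 1 else (0 :: rat)))"
    by (simp add: sum_subtractf)
  also have "\<dots> = (\<Sum>(a, b)\<in>S. eps a i - eps b i)"
    by (intro sum.cong) (auto simp: eps_def)
  finally show ?thesis ..
qed

lemma rho_left:
  assumes "i \<in> {1..m}"
  shows "rho m n i = (of_nat m + 1 - 2 * of_nat i - of_nat n) / 2"
proof -
  have f0: "finite (I0 m n)" and f1: "finite (I1 m n)"
    by (rule finite_subset[of _ "{..m + n} \<times> {..m + n}"]; auto simp: I0_def I1_def)+
  have eqs: "{x \<in> I0 m n. fst x = i} = Pair i ` {i + 1..m}" "{x \<in> I0 m n. snd x = i} = (\<lambda>a. (a, i)) ` {1..<i}"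
    "{x \<in> I1 m n. fst x = i} = Pair i ` {m + 1..m + n}" "{x \<in> I1 m n. snd x = i} = {}"
    using assms by (auto simp: I0_def I1_def)
  have card: "card {x \<in> I0 m n. fst x = i} = m - i" "card {x \<in> I0 m n. snd x = i} = i - 1"
    "card {x \<in> I1 m n. fst x = i} = n" "card {x \<in> I1 m n. snd x = i} = 0"
    unfolding eqs by (simp_all add: card_image inj_on_def)
  show ?thesis
    unfolding rho_def sum_eps[OF f0] sum_eps[OF f1] card using assms by (simp add: of_nat_diff field_simps)
qed

lemma rho_right:
  assumes "j \<in> {m + 1..m + n}"
  shows "rho m n j = (3 * of_nat m + 1 - 2 * of_nat j + of_nat n) / 2"
proof -
  have f0: "finite (I0 m n)" and f1: "finite (I1 m n)"
    by (rule finite_subset[of _ "{..m + n} \<times> {..m + n}"]; auto simp: I0_def I1_def)+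
  have eqs: "{x \<in> I0 m n. fst x = j} = Pair j ` {j + 1..m + n}" "{x \<in> I0 m n. snd x = j} = (\<lambda>a. (a, j)) ` {m + 1..<j}"
    "{x \<in> I1 m n. fst x = j} = {}" "{x \<in> I1 m n. snd x = j} = (\<lambda>a. (a, j)) ` {1..m}"
    using assms by (auto simp: I0_def I1_def)
  have card: "card {x \<in> I0 m n. fst x = j} = m + n - j" "card {x \<in> I0 m n. snd x = j} = j - (m + 1)"
    "card {x \<in> I1 m n. fst x = j} = 0" "card {x \<in> I1 m n. snd x = j} = m"
    unfolding eqs by (simp_all add: card_image inj_on_def)
  have "of_nat (m + n - j) = (of_nat m + of_nat n - of_nat j :: rat)"
    "of_nat (j - (m + 1)) = (of_nat j - of_nat m - 1 :: rat)"
    using assms by (simp_all add: of_nat_diff)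
  then show ?thesis
    unfolding rho_def sum_eps[OF f0] sum_eps[OF f1] card by (simp add: field_simps)
qed

lemma weight_form_eps:
  assumes "(i, j) \<in> I1 m n"
  shows "weight_form m n x (\<lambda>t. eps i t - eps j t) = x i + x j"
proof -
  have "(\<Sum>t\<in>{1..m}. x t * (eps i t - eps j t)) = (\<Sum>t\<in>{1..m}. if t = i then x i else 0)"
    using assms by (intro sum.cong) (auto simp: eps_def I1_def)
  moreover have "(\<Sum>t\<in>{m + 1..m + n}. x t * (eps i t - eps j t)) = (\<Sum>t\<in>{m + 1..m + n}. if t = j then - x j else 0)"
    using assms by (intro sum.cong) (auto simp: eps_def I1_def)
  ultimately show ?thesis
    using assms by (simp add: weight_form_def I1_def)
qed

lemma p_typical_nonzero:
  assumes "p_typical (CHAR('f)) m n lam"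
  shows "of_int (\<Prod>(i, j)\<in>I1 m n. lam i + lam j + 2 * int m + 1 - int i - int j) \<noteq> (0 :: 'f::field)"
proof
  let ?c = "\<Prod>(i, j)\<in>I1 m n. lam i + lam j + 2 * int m + 1 - int i - int j"
  assume "of_int ?c = (0 :: 'f)"
  then have "int (CHAR('f)) dvd ?c"
    by (simp only: of_int_eq_0_iff_char_dvd)
  then obtain k where k: "?c = int (CHAR('f)) * k"
    by (rule dvdE)
  have "(\<Prod>(i, j)\<in>I1 m n. weight_form m n (\<lambda>t. of_int (lam t) + rho m n t) (\<lambda>t. eps i t - eps j t)) = of_int ?c"
    unfolding of_int_prod
  proof (intro prod.cong refl, clarify)
    fix i j assume ij: "(i, j) \<in> I1 m n"
    then have "i \<in> {1..m}" "j \<in> {m + 1..m + n}" by (auto simp: I1_def)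
    then show "weight_form m n (\<lambda>t. of_int (lam t) + rho m n t) (\<lambda>t. eps i t - eps j t)
        = of_int (lam i + lam j + 2 * int m + 1 - int i - int j)"
      unfolding weight_form_eps[OF ij] by (simp add: rho_left rho_right field_simps)
  qed
  then show False
    using assms k unfolding p_typical_def by metis
qed

section \<open>Induced modules\<close>

context dist_module
begin

lemma even_stable_gens:
  assumes "V.even_stable N" "g \<in> ev_gens m n" "x \<in> carrier M" "el x \<in> N"
  shows "el (g \<odot>\<^bsub>M\<^esub> x) \<in> N"
  using assms(2) V.even_stableD(3)[OF assms(1) _ assms(4)] V.even_stableD(4)[OF assms(1,4)] assms(3)
  unfolding ev_gens_def by (auto simp: act_el sc_el)

lemma preimage_cases:
  assumes "N \<subseteq> el ` carrier M"
    and "{x \<in> carrier M. el x \<in> N} = {\<zero>\<^bsub>M\<^esub>} \<or> {x \<in> carrier M. el x \<in> N} = carrier M"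
  shows "N = {0} \<or> N = el ` carrier M"
proof -
  have N: "N = el ` {x \<in> carrier M. el x \<in> N}"
    using assms(1) by auto
  from assms(2) show ?thesis
  proof
    assume "{x \<in> carrier M. el x \<in> N} = {\<zero>\<^bsub>M\<^esub>}"
    then show ?thesis using N el_zero by simp
  next
    assume "{x \<in> carrier M. el x \<in> N} = carrier M"
    then show ?thesis using N by simp
  qed
qed

lemma even_simple:
  assumes gens: "Gs = ev_gens m n"
    and simple: "simple_module ((Dist_G m n)\<lparr>carrier := generate_ring (Dist_G m n) Gs\<rparr>) M"
    and N: "V.even_stable N"
  shows "N = {0} \<or> N = el ` carrier M"
proof -
  have "submodule {x \<in> carrier M. el x \<in> N} ((Dist_G m n)\<lparr>carrier := generate_ring (Dist_G m n) Gs\<rparr>) M"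
    using even_stable_gens[OF N] V.even_stableD(1)[OF N] unfolding gens
    by (intro submodule_of_stable[unfolded gens]) auto
  then have "{x \<in> carrier M. el x \<in> N} = {\<zero>\<^bsub>M\<^esub>} \<or> {x \<in> carrier M. el x \<in> N} = carrier M"
    using simple unfolding simple_module_def by blast
  then show ?thesis
    by (rule preimage_cases[OF V.even_stableD(2)[OF N]])
qed

end

locale full_dist_module = dist_module m n "all_gens m n" M
  for m n :: nat and M :: "('f::field dist, 'v) module"
begin

lemma K_all: "K = carrier (Dist_G m n)"
  unfolding K_def carrier_Dist_G ..

lemma Z_all: "Z = uz m n"
  unfolding Z_def K_all using dtens_closed by auto

sublocale V: gl_supermodule m n "uq_unit m n" Z "el ` carrier M" act sc
proof
  fix i j assume "(i, j) \<in> I1 m n"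
  then have "uq_unit m n i j \<in> odd_units m n" "uq_unit m n j i \<in> odd_units m n"
    unfolding odd_units_def by blast+
  then show "uq_unit m n i j \<in> Z" "uq_unit m n j i \<in> Z"
    unfolding Z_all using uz_gens[of m n] by blast+
qed

lemma stable_submodule:
  assumes N: "V.stable N"
  shows "submodule {x \<in> carrier M. el x \<in> N} (Dist_G m n) M"
proof -
  note Ne = V.stableD(1)[OF N]
  have "el (g \<odot>\<^bsub>M\<^esub> x) \<in> N" if g: "g \<in> all_gens m n" and x: "x \<in> carrier M" "el x \<in> N" for g x
  proof -
    consider "g \<in> ev_gens m n" | u where "u \<in> odd_units m n" "g = dtens m n u 1"
      using g unfolding all_gens_def ev_gens_def by blast
    then show ?thesis
    proof cases
      case 1
      then show ?thesis using even_stable_gens[OF Ne] x by blast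
    next
      case 2
      then have "act u (el x) \<in> N"
        using V.stableD(2,3)[OF N _ x(2)] unfolding odd_units_def by auto
      then show ?thesis
        using 2 x by (simp add: act_el)
    qed
  qed
  then have "submodule {x \<in> carrier M. el x \<in> N} ((Dist_G m n)\<lparr>carrier := generate_ring (Dist_G m n) (all_gens m n)\<rparr>) M"
    by (intro submodule_of_stable V.even_stableD(1)[OF Ne])
  then show ?thesis
    unfolding Dist_G_eq[symmetric] .
qed

lemma stable_simple:
  assumes "simple_module (Dist_G m n) M" and N: "V.stable N"
  shows "N = {0} \<or> N = el ` carrier M"
proof -
  have "{x \<in> carrier M. el x \<in> N} = {\<zero>\<^bsub>M\<^esub>} \<or> {x \<in> carrier M. el x \<in> N} = carrier M"
    using stable_submodule[OF N] assms(1) unfolding simple_module_def by blast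
  then show ?thesis
    by (rule preimage_cases[OF V.even_stableD(2)[OF V.stableD(1)[OF N]]])
qed

lemma submodule_stable:
  assumes "submodule N (Dist_G m n) M"
  shows "V.stable (el ` N)"
proof -
  have sub: "subgroup N (add_monoid M)" and cl: "\<And>a x. a \<in> carrier (Dist_G m n) \<Longrightarrow> x \<in> N \<Longrightarrow> a \<odot>\<^bsub>M\<^esub> x \<in> N"
    using assms unfolding submodule_def submodule_axioms_def by auto
  have N: "N \<subseteq> carrier M"
    using subgroup.subset[OF sub] by simp
  have d: "dtens m n u 1 \<in> carrier (Dist_G m n)" if "u \<in> Z" for u
    using that dtens_closed Z_all by blast
  have actN: "act u x \<in> el ` N" if "u \<in> Z" "x \<in> el ` N" for u x
    using that cl[OF d] N by (auto simp: act_el subset_iff)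
  show ?thesis
    unfolding V.stable_def V.even_stable_def
  proof (intro conjI ballI allI)
    show "addsub (el ` N)"
    proof (rule addsub_image[OF _ N])
      show "\<zero>\<^bsub>M\<^esub> \<in> N" using subgroup.one_closed[OF sub] by simp
      show "x \<ominus>\<^bsub>M\<^esub> y \<in> N" if "x \<in> N" "y \<in> N" for x y
        using subgroup.m_closed[OF sub that(1) subgroup.m_inv_closed[OF sub that(2)]]
        by (simp add: a_minus_def a_inv_def)
    qed
    show "el ` N \<subseteq> el ` carrier M" using N by blast
    show "sc c x \<in> el ` N" if "x \<in> el ` N" for c x
      using that cl scalar_K K_all N by (auto simp: sc_el subset_iff)
    show "act u x \<in> el ` N" if "u \<in> uq.even_gens m n" "x \<in> el ` N" for u x
      using actN even_Z that by blast
    show "case z of (i, j) \<Rightarrow> \<forall>x\<in>el ` N. act (uq_unit m n i j) x \<in> el ` N \<and> act (uq_unit m n j i) x \<in> el ` N"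
      if "z \<in> I1 m n" for z
      using that actN V.odd_Z by auto
  qed
qed

end

context dist_module
begin

lemma highestI:
  assumes v: "v \<in> weight_space m n M lam"
    and kill: "\<forall>(i, j)\<in>I0 m n. \<forall>r\<ge>1. dist_of m n (e_divpow m n i j r) \<odot>\<^bsub>M\<^esub> v = \<zero>\<^bsub>M\<^esub>"
  shows "V.highest lam (el v)"
proof -
  have vM: "v \<in> carrier M" using v by (simp add: weight_space_def)
  have "act (divpow (uq_unit m n i j) r) (el v) = 0" if ij: "(i, j) \<in> I0 m n" and "r \<ge> 1" for i j r
  proof -
    have "dtens m n (divpow (uq_unit m n i j) r) 1 \<odot>\<^bsub>M\<^esub> v = \<zero>\<^bsub>M\<^esub>"
      using kill that I0_D[OF ij] unfolding dist_of_dtens[symmetric] by (auto simp: uq_component_divpow)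
    then show ?thesis
      using vM by (simp add: act_el el_zero)
  qed
  then show ?thesis
    using v unfolding V.highest_def wt_eq by blast
qed

end

lemma (in full_dist_module) killedI:
  assumes v: "v \<in> carrier M"
    and kill: "\<forall>(i, j)\<in>I1 m n. dist_of m n (e_divpow m n i j 1) \<odot>\<^bsub>M\<^esub> v = \<zero>\<^bsub>M\<^esub>"
  shows "el v \<in> V.killed"
proof -
  have "act (uq_unit m n i j) (el v) = 0" if ij: "(i, j) \<in> I1 m n" for i j
  proof -
    have "(dist_of m n (e_divpow m n i j 1) :: 'f dist) = dtens m n (uq_unit m n i j) 1"
      using uq_component_divpow[of i m n j 1] I1_D[OF ij] unfolding dist_of_dtens[symmetric] by simp
    moreover have "dist_of m n (e_divpow m n i j 1) \<odot>\<^bsub>M\<^esub> v = \<zero>\<^bsub>M\<^esub>"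
      using kill ij by blast
    ultimately show ?thesis
      using v by (simp add: act_el el_zero)
  qed
  then show ?thesis
    using v unfolding V.killed_def by auto
qed

lemma linear_on_generated:
  assumes "dist_module m n Gs M" "dist_module m n Hs N" and sub: "Gs \<subseteq> dist_module.K m n Hs"
    and f: "\<And>x. x \<in> carrier M \<Longrightarrow> f x \<in> carrier N"
      "\<And>x y. x \<in> carrier M \<Longrightarrow> y \<in> carrier M \<Longrightarrow> f (x \<oplus>\<^bsub>M\<^esub> y) = f x \<oplus>\<^bsub>N\<^esub> f y"
      "\<And>g x. g \<in> Gs \<Longrightarrow> x \<in> carrier M \<Longrightarrow> f (g \<odot>\<^bsub>M\<^esub> x) = g \<odot>\<^bsub>N\<^esub> f x"
    and a: "a \<in> generate_ring (Dist_G m n) Gs" and x: "x \<in> carrier M"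
  shows "f (a \<odot>\<^bsub>M\<^esub> x) = a \<odot>\<^bsub>N\<^esub> f x"
proof -
  interpret M: dist_module m n Gs M by fact
  interpret N: dist_module m n Hs N by fact
  have neg: "f (\<ominus>\<^bsub>M\<^esub> y) = \<ominus>\<^bsub>N\<^esub> f y" if y: "y \<in> carrier M" for y
  proof -
    have 0: "f \<zero>\<^bsub>M\<^esub> = \<zero>\<^bsub>N\<^esub>"
      using f(2)[of "\<zero>\<^bsub>M\<^esub>" "\<zero>\<^bsub>M\<^esub>"] f(1)[of "\<zero>\<^bsub>M\<^esub>"] N.M.add.r_cancel_one' by fastforce
    have "f (\<ominus>\<^bsub>M\<^esub> y) \<oplus>\<^bsub>N\<^esub> f y = \<zero>\<^bsub>N\<^esub>"
      using f(2)[of "\<ominus>\<^bsub>M\<^esub> y" y] y 0 M.M.l_neg[OF y] by simp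
    then show ?thesis
      using f(1) y N.M.minus_equality M.M.a_inv_closed by metis
  qed
  have "a \<in> M.K \<and> a \<in> N.K \<and> (\<forall>x\<in>carrier M. f (a \<odot>\<^bsub>M\<^esub> x) = a \<odot>\<^bsub>N\<^esub> f x)"
    using a
  proof induction
    case one
    then show ?case using M.one_K N.one_K f(1) by (simp add: M.smult_one N.smult_one)
  next
    case (incl h)
    then show ?case using sub f(3) by (auto simp: M.K_def intro: generate_ring.incl)
  next
    case (a_inv h)
    then show ?case
      using M.neg_K N.neg_K f(1) by (simp add: M.smult_neg N.smult_neg neg M.smult_closed)
  next
    case (eng_add h k)
    then show ?case
      using M.add_K N.add_K f(1) by (simp add: M.smult_add_left N.smult_add_left f(2) M.smult_closed)
  next
    case (eng_mult h k)
    then show ?case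
      using M.mult_K N.mult_K f(1) by (simp add: M.smult_mult N.smult_mult M.smult_closed)
  qed
  then show ?thesis using x by blast
qed

definition P_gens :: "nat \<Rightarrow> nat \<Rightarrow> ('f::field) dist set" where
  "P_gens m n = carrier (Dist_Gev m n) \<union> {dist_of m n (e_divpow m n i j 1) | i j. (i, j) \<in> I1 m n}"

lemma Dist_P_eq: "Dist_P m n = (Dist_G m n)\<lparr>carrier := generate_ring (Dist_G m n) (P_gens m n)\<rparr>"
  unfolding Dist_P_def P_gens_def ..

lemma odd_e_divpow:
  assumes "(i, j) \<in> I1 m n"
  shows "dist_of m n (e_divpow m n i j 1) = dtens m n (uq_unit m n i j) 1" "uq_unit m n i j \<in> odd_units m n"
  using uq_component_divpow[of i m n j 1] I1_D[OF assms] assms unfolding dist_of_dtens[symmetric] odd_units_def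
  by auto

lemma P_gens_closed: "ev_gens m n \<subseteq> (P_gens m n :: 'f::field dist set)"
  "P_gens m n \<subseteq> carrier (Dist_G m n :: 'f dist ring)"
proof -
  show "ev_gens m n \<subseteq> (P_gens m n :: 'f dist set)"
    unfolding P_gens_def Dist_Gev_eq by (auto intro: generate_ring.incl)
  have "dist_of m n (e_divpow m n i j 1) \<in> carrier (Dist_G m n :: 'f dist ring)" if "(i, j) \<in> I1 m n" for i j
    unfolding odd_e_divpow(1)[OF that] using odd_e_divpow(2)[OF that] uz_gens[of m n] by (intro dtens_closed) blast
  moreover have "carrier (Dist_Gev m n) \<subseteq> carrier (Dist_G m n :: 'f dist ring)"
    unfolding Dist_Gev_eq using ring.generate_ring_incl[OF ring_Dist_G gens_closed(1)] by simp
  ultimately show "P_gens m n \<subseteq> carrier (Dist_G m n :: 'f dist ring)"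
    unfolding P_gens_def by blast
qed

locale induced_pair =
  fixes m n :: nat and lam :: "nat \<Rightarrow> int"
    and L0 :: "(('f::field) dist, 'v) module" and L :: "('f dist, 'w) module"
    and v0 :: 'v and v :: 'w
  assumes left_P: "left_module (Dist_P m n) L0" and left_Gev: "left_module (Dist_Gev m n) L0"
    and simple_Gev: "simple_module (Dist_Gev m n) L0"
    and odd_zero: "\<forall>(i, j)\<in>I1 m n. \<forall>v\<in>carrier L0. dist_of m n (e_divpow m n i j 1) \<odot>\<^bsub>L0\<^esub> v = \<zero>\<^bsub>L0\<^esub>"
    and v0: "v0 \<in> weight_space m n L0 lam" "v0 \<noteq> \<zero>\<^bsub>L0\<^esub>"
      "\<forall>(i, j)\<in>I0 m n. \<forall>r\<ge>1. dist_of m n (e_divpow m n i j r) \<odot>\<^bsub>L0\<^esub> v0 = \<zero>\<^bsub>L0\<^esub>"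
    and left_G: "left_module (Dist_G m n) L" and simple_G: "simple_module (Dist_G m n) L"
    and v: "v \<in> weight_space m n L lam" "v \<noteq> \<zero>\<^bsub>L\<^esub>"
      "\<forall>(i, j)\<in>I0 m n. \<forall>r\<ge>1. dist_of m n (e_divpow m n i j r) \<odot>\<^bsub>L\<^esub> v = \<zero>\<^bsub>L\<^esub>"
      "\<forall>(i, j)\<in>I1 m n. dist_of m n (e_divpow m n i j 1) \<odot>\<^bsub>L\<^esub> v = \<zero>\<^bsub>L\<^esub>"
    and nonzero: "of_int (\<Prod>(i, j)\<in>I1 m n. lam i + lam j + 2 * int m + 1 - int i - int j) \<noteq> (0 :: 'f)"
begin

sublocale V0: dist_module m n "ev_gens m n" L0
  using left_Gev gens_closed(1) unfolding Dist_Gev_eq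
  by (intro dist_module.intro dist_module_axioms.intro additive_type.intro) (auto simp: left_module_def)

sublocale P0: dist_module m n "P_gens m n" L0
  using left_P unfolding Dist_P_eq
  by (intro dist_module.intro dist_module_axioms.intro additive_type.intro P_gens_closed) (simp_all add: left_module_def)

sublocale VL: full_dist_module m n L
proof (intro full_dist_module.intro dist_module.intro dist_module_axioms.intro additive_type.intro)
  show "abelian_group L" using left_G by (simp add: left_module_def)
  show "ev_gens m n \<subseteq> all_gens m n" by (auto simp: ev_gens_def all_gens_def)
  show "left_module ((Dist_G m n)\<lparr>carrier := generate_ring (Dist_G m n) (all_gens m n)\<rparr>) L"
    unfolding Dist_G_eq[symmetric] by (rule left_G)
qed (rule gens_closed)

lemma v0_L0: "v0 \<in> carrier L0" and v_L: "v \<in> carrier L"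
  using v0 v by (auto simp: weight_space_def)

sublocale HP: highest_pair m n "uq_unit m n" V0.Z "V0.el ` carrier L0" V0.act V0.sc
    VL.Z "VL.el ` carrier L" VL.act VL.sc lam "V0.el v0" "VL.el v"
proof
  show "N = {0} \<or> N = V0.el ` carrier L0" if "V0.V.even_stable N" for N
    using V0.even_simple[OF refl _ that] simple_Gev unfolding Dist_Gev_eq by blast
  show "N = {0} \<or> N = VL.el ` carrier L" if "VL.V.stable N" for N
    using VL.stable_simple[OF simple_G that] .
  show "V0.V.highest lam (V0.el v0)"
    using V0.highestI v0 by blast
  show "VL.V.highest lam (VL.el v)"
    using VL.highestI v by blast
  show "VL.el v \<in> VL.V.killed"
    using VL.killedI v_L v by blast
  show "V0.el v0 \<noteq> 0" "VL.el v \<noteq> 0"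
    using V0.el_eq_0 VL.el_eq_0 v0_L0 v_L v0 v by auto
qed

lemma P_hom_exists:
  "\<exists>f. (\<forall>x\<in>carrier L0. f x \<in> carrier L) \<and> (\<forall>x\<in>carrier L0. \<forall>y\<in>carrier L0. f (x \<oplus>\<^bsub>L0\<^esub> y) = f x \<oplus>\<^bsub>L\<^esub> f y) \<and>
    (\<forall>b\<in>carrier (Dist_P m n). \<forall>x\<in>carrier L0. f (b \<odot>\<^bsub>L0\<^esub> x) = b \<odot>\<^bsub>L\<^esub> f x) \<and> f v0 = v"
proof -
  obtain g where g: "\<And>x. x \<in> V0.el ` carrier L0 \<Longrightarrow> g x \<in> VL.V.killed"
    "\<And>x y. x \<in> V0.el ` carrier L0 \<Longrightarrow> y \<in> V0.el ` carrier L0 \<Longrightarrow> g (x + y) = g x + g y"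
    "\<And>x u. x \<in> V0.el ` carrier L0 \<Longrightarrow> u \<in> uq.even_gens m n \<Longrightarrow> g (V0.act u x) = VL.act u (g x)"
    "\<And>x c. x \<in> V0.el ` carrier L0 \<Longrightarrow> g (V0.sc c x) = VL.sc c (g x)" "g (V0.el v0) = VL.el v"
    using HP.even_hom_exists by blast
  define f where "f x = VL.un (g (V0.el x))" for x
  have f: "f x \<in> carrier L" "g (V0.el x) = VL.el (f x)" if "x \<in> carrier L0" for x
  proof -
    obtain y where "y \<in> carrier L" "g (V0.el x) = VL.el y"
      using VL.V.killedD(1)[OF g(1)] \<open>x \<in> carrier L0\<close> by blast
    then show "f x \<in> carrier L" "g (V0.el x) = VL.el (f x)"
      by (simp_all add: f_def)
  qed
  have f_add: "f (x \<oplus>\<^bsub>L0\<^esub> y) = f x \<oplus>\<^bsub>L\<^esub> f y" if "x \<in> carrier L0" "y \<in> carrier L0" for x y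
    using g(2)[of "V0.el x" "V0.el y"] that f[OF that(1)] f[OF that(2)] f[of "x \<oplus>\<^bsub>L0\<^esub> y"]
    by (simp add: V0.el_add VL.el_add[symmetric] VL.el_inj)
  have f_gen: "f (a \<odot>\<^bsub>L0\<^esub> x) = a \<odot>\<^bsub>L\<^esub> f x" if a: "a \<in> ev_gens m n" and x: "x \<in> carrier L0" for a x
  proof -
    have aK: "a \<in> V0.K" "a \<in> VL.K"
      using a V0.Gs VL.Gs unfolding V0.K_def VL.K_def by (auto intro: generate_ring.incl)
    consider u where "u \<in> uq.even_gens m n" "a = dtens m n u 1" | c where "a = dist_scalar m n c"
      using a unfolding ev_gens_def by blast
    then have "g (V0.el (a \<odot>\<^bsub>L0\<^esub> x)) = VL.el (a \<odot>\<^bsub>L\<^esub> f x)"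
    proof cases
      case 1
      then show ?thesis
        using g(3)[of "V0.el x" u] x f[OF x] by (simp add: V0.act_el VL.act_el)
    next
      case 2
      then show ?thesis
        using g(4)[of "V0.el x" c] x f[OF x] by (simp add: V0.sc_el VL.sc_el)
    qed
    then show ?thesis
      using f[OF V0.smult_closed[OF aK(1) x]] VL.smult_closed[OF aK(2) f(1)[OF x]] by (simp add: VL.el_inj)
  qed
  have ev_K: "ev_gens m n \<subseteq> VL.K"
    using VL.Gs unfolding VL.K_def by (auto intro: generate_ring.incl)
  have f_ev: "f (a \<odot>\<^bsub>L0\<^esub> x) = a \<odot>\<^bsub>L\<^esub> f x" if "a \<in> carrier (Dist_Gev m n)" "x \<in> carrier L0" for a x
  proof (rule linear_on_generated[OF V0.dist_module_axioms VL.dist_module_axioms ev_K])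
    show "a \<in> generate_ring (Dist_G m n) (ev_gens m n)"
      using that unfolding Dist_Gev_eq by simp
  qed (use f f_add f_gen that in blast)+
  have f_P: "f (a \<odot>\<^bsub>L0\<^esub> x) = a \<odot>\<^bsub>L\<^esub> f x" if a: "a \<in> P_gens m n" and x: "x \<in> carrier L0" for a x
  proof (cases "a \<in> carrier (Dist_Gev m n)")
    case True
    then show ?thesis using f_ev x by blast
  next
    case False
    then obtain i j where ij: "(i, j) \<in> I1 m n" "a = dist_of m n (e_divpow m n i j 1)"
      using a unfolding P_gens_def by blast
    have "VL.act (uq_unit m n i j) (VL.el (f x)) = 0"
      using VL.V.killedD(2)[OF g(1)[of "V0.el x"] ij(1)] x f(2)[OF x] by simp
    then have "VL.el (a \<odot>\<^bsub>L\<^esub> f x) = 0"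
      unfolding ij(2) odd_e_divpow(1)[OF ij(1)] using f(1)[OF x] by (simp add: VL.act_el)
    moreover have "a \<in> VL.K"
      using a P_gens_closed(2) VL.K_all by blast
    ultimately have "a \<odot>\<^bsub>L\<^esub> f x = \<zero>\<^bsub>L\<^esub>"
      using VL.el_eq_0 VL.smult_closed f(1)[OF x] by blast
    moreover have "f \<zero>\<^bsub>L0\<^esub> = \<zero>\<^bsub>L\<^esub>"
      using f_add[of "\<zero>\<^bsub>L0\<^esub>" "\<zero>\<^bsub>L0\<^esub>"] f(1)[of "\<zero>\<^bsub>L0\<^esub>"] VL.M.add.r_cancel_one' by fastforce
    moreover have "a \<odot>\<^bsub>L0\<^esub> x = \<zero>\<^bsub>L0\<^esub>"
      using odd_zero ij x by blast
    ultimately show ?thesis by simp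
  qed
  have P_K: "P_gens m n \<subseteq> VL.K"
    using P_gens_closed(2) VL.K_all by blast
  have "f (a \<odot>\<^bsub>L0\<^esub> x) = a \<odot>\<^bsub>L\<^esub> f x" if "a \<in> carrier (Dist_P m n)" "x \<in> carrier L0" for a x
  proof (rule linear_on_generated[OF P0.dist_module_axioms VL.dist_module_axioms P_K])
    show "a \<in> generate_ring (Dist_G m n) (P_gens m n)"
      using that unfolding Dist_P_eq by simp
  qed (use f f_add f_P that in blast)+
  moreover have "f v0 = v"
    using g(5) v_L by (simp add: f_def)
  ultimately show ?thesis
    using f(1) f_add by blast
qed

sublocale X: scalar_extension "Dist_G m n" L0 "carrier (Dist_P m n)"
proof (intro scalar_extension.intro scalar_extension_axioms.intro)
  show "ring (Dist_G m n :: 'f dist ring)" by (rule ring_Dist_G)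
  show "abelian_group L0" by (rule V0.M.abelian_group_axioms)
  show "carrier (Dist_P m n) \<subseteq> carrier (Dist_G m n)"
    unfolding Dist_P_eq using ring.generate_ring_incl[OF ring_Dist_G P_gens_closed(2)] by simp
  show "b \<odot>\<^bsub>L0\<^esub> x \<in> carrier L0" if "b \<in> carrier (Dist_P m n)" "x \<in> carrier L0" for b x
    using P0.smult_closed that unfolding Dist_P_eq P0.K_def by simp
qed

sublocale W: full_dist_module m n X.Ext
proof (intro full_dist_module.intro dist_module.intro dist_module_axioms.intro additive_type.intro)
  show "abelian_group X.Ext" by (rule X.abelian_group_Ext)
  show "ev_gens m n \<subseteq> all_gens m n" by (auto simp: ev_gens_def all_gens_def)
  show "left_module ((Dist_G m n)\<lparr>carrier := generate_ring (Dist_G m n) (all_gens m n)\<rparr>) X.Ext"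
    unfolding Dist_G_eq[symmetric] by (rule X.left_module_Ext)
qed (rule gens_closed)

definition top :: "'v \<Rightarrow> ('f dist \<times> 'v \<Rightarrow>\<^sub>0 int) set" where
  "top x = X.tens \<one>\<^bsub>Dist_G m n\<^esub> x"

lemma top_closed: "x \<in> carrier L0 \<Longrightarrow> top x \<in> carrier X.Ext"
  unfolding top_def by (intro X.tens_closed) simp_all

lemma top_add: "x \<in> carrier L0 \<Longrightarrow> y \<in> carrier L0 \<Longrightarrow> top (x \<oplus>\<^bsub>L0\<^esub> y) = top x \<oplus>\<^bsub>X.Ext\<^esub> top y"
  unfolding top_def by (intro X.tens_add_right) simp_all

lemma top_zero: "top \<zero>\<^bsub>L0\<^esub> = \<zero>\<^bsub>X.Ext\<^esub>"
  using top_add[of "\<zero>\<^bsub>L0\<^esub>" "\<zero>\<^bsub>L0\<^esub>"] top_closed[of "\<zero>\<^bsub>L0\<^esub>"] X.Ext.add.r_cancel_one'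
  by (metis V0.M.l_zero V0.M.zero_closed)

lemma smult_top:
  assumes "a \<in> carrier (Dist_G m n)" "x \<in> carrier L0"
  shows "a \<odot>\<^bsub>X.Ext\<^esub> top x = X.tens a x"
  unfolding top_def using X.smult_tens[of a "\<one>\<^bsub>Dist_G m n\<^esub>" x] assms by simp

lemma P_smult_top:
  assumes "b \<in> carrier (Dist_P m n)" "x \<in> carrier L0"
  shows "b \<odot>\<^bsub>X.Ext\<^esub> top x = top (b \<odot>\<^bsub>L0\<^esub> x)"
proof -
  have b: "b \<in> carrier (Dist_G m n)" using X.B assms(1) by blast
  then show ?thesis
    using smult_top[OF b assms(2)] X.tens_balanced[of "\<one>\<^bsub>Dist_G m n\<^esub>" b x] assms unfolding top_def by simp
qed

lemma ev_gens_P: "ev_gens m n \<subseteq> carrier (Dist_P m n)"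
  unfolding Dist_P_eq using P_gens_closed(1) by (auto intro: generate_ring.incl)

lemma even_act_top:
  assumes "u \<in> uq.even_gens m n" "x \<in> carrier L0"
  shows "W.act u (W.el (top x)) = W.el (top (dtens m n u 1 \<odot>\<^bsub>L0\<^esub> x))"
    "dtens m n u 1 \<odot>\<^bsub>L0\<^esub> x \<in> carrier L0"
proof -
  have "(dtens m n u 1 :: 'f dist) \<in> ev_gens m n"
    using assms by (auto simp: ev_gens_def)
  then have P: "(dtens m n u 1 :: 'f dist) \<in> carrier (Dist_P m n)"
    using ev_gens_P by blast
  then show "W.act u (W.el (top x)) = W.el (top (dtens m n u 1 \<odot>\<^bsub>L0\<^esub> x))"
    using assms by (simp only: W.act_el top_closed P_smult_top)
  show "dtens m n u 1 \<odot>\<^bsub>L0\<^esub> x \<in> carrier L0"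
    using X.B_smult P assms(2) by blast
qed

lemma sc_top:
  assumes "x \<in> carrier L0"
  shows "W.sc c (W.el (top x)) = W.el (top (dist_scalar m n c \<odot>\<^bsub>L0\<^esub> x))"
    "dist_scalar m n c \<odot>\<^bsub>L0\<^esub> x \<in> carrier L0"
proof -
  have P: "dist_scalar m n c \<in> carrier (Dist_P m n)"
    using ev_gens_P by (auto simp: ev_gens_def)
  then show "W.sc c (W.el (top x)) = W.el (top (dist_scalar m n c \<odot>\<^bsub>L0\<^esub> x))"
    using assms by (simp only: W.sc_el top_closed P_smult_top)
  show "dist_scalar m n c \<odot>\<^bsub>L0\<^esub> x \<in> carrier L0"
    using X.B_smult P assms by blast
qed

abbreviation "Y \<equiv> W.el ` top ` carrier L0"

lemma el_top_diff:
  assumes "x \<in> carrier L0" "y \<in> carrier L0"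
  shows "W.el (top x) - W.el (top y) = W.el (top (x \<ominus>\<^bsub>L0\<^esub> y))"
proof -
  have "x = (x \<ominus>\<^bsub>L0\<^esub> y) \<oplus>\<^bsub>L0\<^esub> y"
    using assms by (simp add: V0.M.minus_eq V0.M.a_assoc V0.M.l_neg)
  then have "W.el (top x) = W.el (top (x \<ominus>\<^bsub>L0\<^esub> y)) + W.el (top y)"
    using top_add[of "x \<ominus>\<^bsub>L0\<^esub> y" y] assms top_closed W.el_add by (metis V0.M.minus_closed)
  then show ?thesis by simp
qed

lemma Y_even_stable: "W.V.even_stable Y"
  unfolding W.V.even_stable_def
proof (intro conjI ballI allI)
  show "addsub Y"
    unfolding addsub_def
  proof (intro conjI ballI)
    show "0 \<in> Y"
      using top_zero W.el_zero by (metis V0.M.zero_closed imageI)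
    show "a - b \<in> Y" if "a \<in> Y" "b \<in> Y" for a b
      using that el_top_diff by auto
  qed
  show "Y \<subseteq> W.el ` carrier X.Ext" using top_closed by auto
  show "W.act u y \<in> Y" if "u \<in> uq.even_gens m n" "y \<in> Y" for u y
    using that even_act_top by auto
  show "W.sc c y \<in> Y" if "y \<in> Y" for c y
    using that sc_top by auto
qed

lemma Y_killed: "Y \<subseteq> W.V.killed"
proof (clarify)
  fix x assume x: "x \<in> carrier L0"
  have "dist_of m n (e_divpow m n i j 1) \<odot>\<^bsub>X.Ext\<^esub> top x = \<zero>\<^bsub>X.Ext\<^esub>" if ij: "(i, j) \<in> I1 m n" for i j
  proof -
    have "dist_of m n (e_divpow m n i j 1) \<in> carrier (Dist_P m n)"
      unfolding Dist_P_eq using ij by (auto intro!: generate_ring.incl simp: P_gens_def)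
    then show ?thesis
      using P_smult_top x odd_zero ij top_zero by fastforce
  qed
  then show "W.el (top x) \<in> W.V.killed"
    using W.killedI top_closed[OF x] by blast
qed

lemma Y_generates:
  assumes N: "W.V.stable N" and Y: "Y \<subseteq> N"
  shows "N = W.el ` carrier X.Ext"
proof
  show "N \<subseteq> W.el ` carrier X.Ext"
    using W.V.even_stableD(2)[OF W.V.stableD(1)[OF N]] .
  have Na: "addsub N"
    using W.V.even_stableD(1)[OF W.V.stableD(1)[OF N]] .
  have sub: "submodule {z \<in> carrier X.Ext. W.el z \<in> N} (Dist_G m n) X.Ext"
    by (rule W.stable_submodule[OF N])
  have "W.el z \<in> N" if "z \<in> carrier X.Ext" for z
    using that
  proof (induction rule: X.Ext_induct)
    case zero
    then show ?case using W.el_zero addsub_0[OF Na] by simp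
  next
    case (tens a x)
    have "top x \<in> {z \<in> carrier X.Ext. W.el z \<in> N}"
      using Y tens top_closed by blast
    then show ?case
      using submodule.smult_closed[OF sub tens(1), of "top x"] smult_top[OF tens] by simp
  next
    case (diff u w)
    then show ?case using W.el_diff addsub_diff[OF Na] by simp
  qed
  then show "W.el ` carrier X.Ext \<subseteq> N" by blast
qed

lemma Y_simple:
  assumes N: "W.V.even_stable N" and NY: "N \<subseteq> Y"
  shows "N = {0} \<or> N = Y"
proof -
  define S where "S = V0.el ` {x \<in> carrier L0. W.el (top x) \<in> N}"
  note Na = W.V.even_stableD(1)[OF N]
  have "V0.V.even_stable S"
    unfolding V0.V.even_stable_def
  proof (intro conjI ballI allI)
    show "addsub S"
      unfolding S_def
    proof (rule V0.addsub_image)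
      show "\<zero>\<^bsub>L0\<^esub> \<in> {x \<in> carrier L0. W.el (top x) \<in> N}"
        using top_zero W.el_zero addsub_0[OF Na] by simp
      show "x \<ominus>\<^bsub>L0\<^esub> y \<in> {x \<in> carrier L0. W.el (top x) \<in> N}"
        if "x \<in> {x \<in> carrier L0. W.el (top x) \<in> N}" "y \<in> {x \<in> carrier L0. W.el (top x) \<in> N}" for x y
        using that el_top_diff[of x y] addsub_diff[OF Na] by force
    qed auto
    show "S \<subseteq> V0.el ` carrier L0" by (auto simp: S_def)
    show "V0.act u s \<in> S" if u: "u \<in> uq.even_gens m n" and "s \<in> S" for u s
      using that even_act_top[OF u] W.V.even_stableD(3)[OF N u] unfolding S_def
      by (auto simp: V0.act_el intro!: imageI) metis
    show "V0.sc c s \<in> S" if "s \<in> S" for c s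
      using that sc_top W.V.even_stableD(4)[OF N] unfolding S_def
      by (auto simp: V0.sc_el intro!: imageI) metis
  qed
  then have "S = {0} \<or> S = V0.el ` carrier L0"
    using HP.simple0 by blast
  then show ?thesis
  proof
    assume "S = {0}"
    then have "x = \<zero>\<^bsub>L0\<^esub>" if "x \<in> carrier L0" "W.el (top x) \<in> N" for x
      using that V0.el_eq_0 unfolding S_def by blast
    then have "N \<subseteq> {0}"
      using NY top_zero W.el_zero by (auto simp: subset_iff)
    then show ?thesis using addsub_0[OF Na] by blast
  next
    assume S: "S = V0.el ` carrier L0"
    have "W.el (top x) \<in> N" if x: "x \<in> carrier L0" for x
    proof -
      have "V0.el x \<in> S" using S x by blast
      then obtain y where "y \<in> carrier L0" "W.el (top y) \<in> N" "V0.el x = V0.el y"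
        unfolding S_def by blast
      then show ?thesis using V0.el_inj x by blast
    qed
    then show ?thesis using NY by blast
  qed
qed

lemma top_highest: "W.V.highest lam (W.el (top v0))"
proof (rule W.highestI)
  have h: "(dist_of m n (h_binom m n i r) :: 'f dist) \<in> carrier (Dist_P m n)" if i: "i \<in> {1..m + n}" for i r
    unfolding uq_component_binom[OF i, symmetric] dist_of_dtens
    using ev_gens_P uq.even_gensI(3)[OF i, of r] by (auto simp: ev_gens_def)
  have c: "dist_scalar m n c \<in> carrier (Dist_P m n)" for c :: 'f
    using ev_gens_P by (auto simp: ev_gens_def)
  show "top v0 \<in> weight_space m n X.Ext lam"
    unfolding weight_space_def
  proof (intro CollectI conjI ballI allI top_closed v0_L0)
    fix i r assume i: "i \<in> {1..m + n}"
    show "dist_of m n (h_binom m n i r) \<odot>\<^bsub>X.Ext\<^esub> top v0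
        = dist_scalar m n (of_int (int_binomial (lam i) r)) \<odot>\<^bsub>X.Ext\<^esub> top v0"
      unfolding P_smult_top[OF h[OF i] v0_L0] P_smult_top[OF c v0_L0]
      using v0(1) i unfolding weight_space_def by simp
  qed
  show "\<forall>(i, j)\<in>I0 m n. \<forall>r\<ge>1. dist_of m n (e_divpow m n i j r) \<odot>\<^bsub>X.Ext\<^esub> top v0 = \<zero>\<^bsub>X.Ext\<^esub>"
  proof (clarify)
    fix i j and r :: nat assume ij: "(i, j) \<in> I0 m n" and r: "r \<ge> 1"
    have "e_divpow m n i j r = uq_component m n (divpow (uq_unit m n i j) r)"
      using I0_D[OF ij] by (simp add: uq_component_divpow)
    then have "(dist_of m n (e_divpow m n i j r) :: 'f dist) \<in> carrier (Dist_P m n)"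
      using ev_gens_P uq.even_gensI(1)[OF ij, of r] by (auto simp: ev_gens_def dist_of_dtens)
    then show "dist_of m n (e_divpow m n i j r) \<odot>\<^bsub>X.Ext\<^esub> top v0 = \<zero>\<^bsub>X.Ext\<^esub>"
      using P_smult_top[OF _ v0_L0] v0(3) ij r top_zero by fastforce
  qed
qed

theorem Ind_isomorphic: "modules_isomorphic (Dist_G m n) (Ind_GP m n L0) L"
proof -
  obtain f where f: "\<And>x. x \<in> carrier L0 \<Longrightarrow> f x \<in> carrier L"
      "\<And>x y. x \<in> carrier L0 \<Longrightarrow> y \<in> carrier L0 \<Longrightarrow> f (x \<oplus>\<^bsub>L0\<^esub> y) = f x \<oplus>\<^bsub>L\<^esub> f y"
      "\<And>b x. b \<in> carrier (Dist_P m n) \<Longrightarrow> x \<in> carrier L0 \<Longrightarrow> f (b \<odot>\<^bsub>L0\<^esub> x) = b \<odot>\<^bsub>L\<^esub> f x" "f v0 = v"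
    using P_hom_exists by blast
  obtain h where h: "h \<in> hom (add_monoid X.Ext) (add_monoid L)"
      "\<And>(a :: 'f dist) x. a \<in> carrier (Dist_G m n) \<Longrightarrow> x \<in> carrier L0 \<Longrightarrow> h (X.tens a x) = a \<odot>\<^bsub>L\<^esub> f x"
      "\<And>(a :: 'f dist) z. a \<in> carrier (Dist_G m n) \<Longrightarrow> z \<in> carrier X.Ext \<Longrightarrow> h (a \<odot>\<^bsub>X.Ext\<^esub> z) = a \<odot>\<^bsub>L\<^esub> h z"
    using X.universal[OF left_G f(1-3)] by blast
  interpret h: group_hom "add_monoid X.Ext" "add_monoid L" h
    using h(1) by (intro group_hom.intro group_hom_axioms.intro X.Ext.a_group VL.M.a_group)
  have hv: "h (top v0) = v"
    unfolding top_def using h(2)[OF X.A.one_closed v0_L0] f(4) VL.smult_one v_L by simp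
  have "subgroup (h ` carrier X.Ext) (add_monoid L)"
    using h.img_is_subgroup by simp
  then have "submodule (h ` carrier X.Ext) (Dist_G m n) L"
  proof (intro submodule.intro submodule_axioms.intro)
    fix a :: "'f dist" and y assume a: "a \<in> carrier (Dist_G m n)" and "y \<in> h ` carrier X.Ext"
    then obtain z where z: "z \<in> carrier X.Ext" "y = h z" by blast
    then have "a \<odot>\<^bsub>X.Ext\<^esub> z \<in> carrier X.Ext"
      using W.smult_closed a z W.K_all by blast
    then show "a \<odot>\<^bsub>L\<^esub> y \<in> h ` carrier X.Ext"
      using h(3)[OF a z(1)] z(2) by (metis imageI)
  qed
  moreover have "v \<in> h ` carrier X.Ext"
    using hv top_closed[OF v0_L0] by force
  ultimately have surj: "h ` carrier X.Ext = carrier L"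
    using simple_G v(2) unfolding simple_module_def by blast
  define N where "N = {z \<in> carrier X.Ext. h z = \<zero>\<^bsub>L\<^esub>}"
  have "submodule N (Dist_G m n) X.Ext"
  proof (intro submodule.intro submodule_axioms.intro)
    show "subgroup N (add_monoid X.Ext)"
      using h.subgroup_kernel by (simp add: kernel_def N_def)
    fix a :: "'f dist" and z assume a: "a \<in> carrier (Dist_G m n)" and z: "z \<in> N"
    then show "a \<odot>\<^bsub>X.Ext\<^esub> z \<in> N"
      using h(3)[OF a] W.smult_closed W.K_all VL.smult_zero_right VL.K_all unfolding N_def by auto
  qed
  then have st: "W.V.stable (W.el ` N)"
    by (rule W.submodule_stable)
  have "W.el ` N = {0}"
  proof (rule ccontr)
    assume "W.el ` N \<noteq> {0}"
    then have "W.el (top v0) \<in> W.el ` N"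
      using W.V.typical_submodule[OF Y_even_stable Y_killed Y_generates Y_simple _ top_highest nonzero st] v0_L0 by blast
    then have "h (top v0) = \<zero>\<^bsub>L\<^esub>"
      using W.el_inj top_closed[OF v0_L0] unfolding N_def by auto
    then show False using hv v(2) by simp
  qed
  then have N: "z = \<zero>\<^bsub>X.Ext\<^esub>" if "z \<in> carrier X.Ext" "h z = \<zero>\<^bsub>L\<^esub>" for z
    using that W.el_eq_0 unfolding N_def by blast
  have "inj_on h (carrier X.Ext)"
    using h.inj_on_one_iff N by simp
  then have "bij_betw h (carrier X.Ext) (carrier L)"
    using surj by (simp add: bij_betw_def)
  moreover have "h (y \<oplus>\<^bsub>X.Ext\<^esub> z) = h y \<oplus>\<^bsub>L\<^esub> h z" if "y \<in> carrier X.Ext" "z \<in> carrier X.Ext" for y z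
    using h.hom_mult[of y z] that by simp
  ultimately show ?thesis
    unfolding modules_isomorphic_def Ind_GP_def using h(3) by blast
qed

end

theorem theorem10p5:
  fixes m n p :: nat
    and lam :: "nat \<Rightarrow> int"
    and L0 :: "(('f::alg_closed_field) dist, 'v) module"
    and L :: "('f dist, 'w) module"
  assumes "m \<ge> 1" and "n \<ge> 1"
    and "CHAR('f) = p" and "p > 2"
    and "lam \<in> dominant_weights m n"
    and "p_typical p m n lam"
    and "inflated_simple_Gev_module m n lam L0"
    and "simple_G_module m n lam L"
  shows "modules_isomorphic (Dist_G m n) (Ind_GP m n L0) L"
proof -
  have "simple_Gev_module m n lam L0"
    using assms(7) by (simp add: inflated_simple_Gev_module_def)
  then obtain v0 where v0: "v0 \<in> weight_space m n L0 lam" "v0 \<noteq> \<zero>\<^bsub>L0\<^esub>"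
      "\<forall>(i, j)\<in>I0 m n. \<forall>r\<ge>1. dist_of m n (e_divpow m n i j r) \<odot>\<^bsub>L0\<^esub> v0 = \<zero>\<^bsub>L0\<^esub>"
    unfolding simple_Gev_module_def by blast
  obtain v where v: "v \<in> weight_space m n L lam" "v \<noteq> \<zero>\<^bsub>L\<^esub>"
      "\<forall>(i, j)\<in>I0 m n. \<forall>r\<ge>1. dist_of m n (e_divpow m n i j r) \<odot>\<^bsub>L\<^esub> v = \<zero>\<^bsub>L\<^esub>"
      "\<forall>(i, j)\<in>I1 m n. dist_of m n (e_divpow m n i j 1) \<odot>\<^bsub>L\<^esub> v = \<zero>\<^bsub>L\<^esub>"
    using assms(8) unfolding simple_G_module_def by blast
  interpret induced_pair m n lam L0 L v0 v
    using assms(7,8) v0 v p_typical_nonzero[of m n lam, where 'f = 'f] assms(3,6)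
    unfolding inflated_simple_Gev_module_def simple_Gev_module_def simple_G_module_def integrable_def
    by unfold_locales blast+
  show ?thesis by (rule Ind_isomorphic)
qed

end
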